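(* Let $v_0\in\mathcal{A}_+\cup\mathcal{A}_-$, let $v(x,t)=(S_tv_0)(x)$, let $\omega=\operatorname{curl} v$, $\omega_0=\operatorname{curl} v_0$, and let $\lambda_1(x,t)\ge\lambda_2(x,t)\ge\lambda_3(x,t)$ be the eigenvalues of the deformation tensor associated with $v(x,t)$, for $t\in(0,T(v_0))$. Then for all $t\in(0,T(v_0))$ the following estimates hold. (i) If $v_0\in\mathcal{A}_+$, then $$\exp\left(\frac12\int_0^t\inf_{x\in\mathbb{T}^3}|\lambda_2(x,s)|\,ds\right)\le\frac{\|\omega(t)\|_{L^2}}{\|\omega_0\|_{L^2}}\le\exp\left(\int_0^t\sup_{x\in\mathbb{T}^3}|\lambda_2(x,s)|\,ds\right).$$ (ii) If $v_0\in\mathcal{A}_-$, then $$\exp\left(-\int_0^t\sup_{x\in\mathbb{T}^3}|\lambda_2(x,s)|\,ds\right)\le\frac{\|\omega(t)\|_{L^2}}{\|\omega_0\|_{L^2}}\le\exp\left(-\frac12\int_0^t\inf_{x\in\mathbb{T}^3}|\lambda_2(x,s)|\,ds\right).$$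
   Context: $\mathbb{T}^3$ is the 3D periodic box (all functions are periodic in space). Fix an integer $m>5/2$. $H^m(\mathbb{T}^3)$ is the standard $L^2$-based Sobolev space and $\mathbb{H}^m_\sigma=\{u\in[H^m(\mathbb{T}^3)]^3 : \operatorname{div} u=0\}$. The Euler equations are $$\frac{\partial v}{\partial t}+(v\cdot\nabla)v=-\nabla p,\qquad \operatorname{div} v=0,\qquad v(x,0)=v_0(x).$$ For $v_0\in\mathbb{H}^m_\sigma$, $T_*(v_0)$ is the maximal time of unique existence of a solution in $\mathbb{H}^m_\sigma$ (i.e. $v\in C([0,T_*(v_0));\mathbb{H}^m_\sigma)$), and $S_t$ is the solution operator $v_0\mapsto v(t)=S_tv_0$ for $0\le t<T_*(v_0)$. For a differentiable vector field $f=(f_1,f_2,f_3)$ on $\mathbb{T}^3$, $\lambda_1(f)\ge\lambda_2(f)\ge\lambda_3(f)$ denote the eigenvalues (scalar fields on $\mathbb{T}^3$) of the deformation tensor $\frac12\left(\frac{\partial f_j}{\partial x_i}+\frac{\partial f_i}{\partial x_j}\right)_{i,j}$. Define $$\mathcal{A}_+=\{f\in\mathbb{H}^m_\sigma : \inf_{x\in\mathbb{T}^3}\lambda_2(f)(x)>0\},\qquad \mathcal{A}_-=\{f\in\mathbb{H}^m_\sigma : \sup_{x\in\mathbb{T}^3}\lambda_2(f)(x)<0\}.$$ For $f\in\mathcal{A}_+$, $$T(f)=\inf\{t\in(0,T_*(f)) : \exists x\in\mathbb{T}^3\text{ such that }\lambda_2(S_tf)(x)<0\},$$ and for $f\in\mathcal{A}_-$,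 $$T(f)=\inf\{t\in(0,T_*(f)) : \exists x\in\mathbb{T}^3\text{ such that }\lambda_2(S_tf)(x)>0\},$$ with $T(f)=T_*(f)$ if the corresponding set is empty. $\|\cdot\|_{L^2}$ is the norm of $L^2(\mathbb{T}^3)$. *)

theory Defs
  imports "HOL-Analysis.Analysis"
begin

text \<open>
  Functions on the torus (period 1 in each coordinate) are represented by periodic functions
  on \<open>real ^ 3\<close>, and integrals over the torus are taken over the unit cube.
\<close>

type_synonym R3 = "real ^ 3"
type_synonym scalar_field = "R3 \<Rightarrow> real"
type_synonym vector_field = "R3 \<Rightarrow> R3"

definition periodic :: "(R3 \<Rightarrow> 'a) \<Rightarrow> bool" where
  "periodic f \<longleftrightarrow> (\<forall>x i. f (x + axis i 1) = f x)"

definition unit_cube :: "R3 set" where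
  "unit_cube = cbox 0 1"


subsection \<open>Differential operators\<close>

definition partial :: "3 \<Rightarrow> scalar_field \<Rightarrow> scalar_field" where
  "partial i f x = frechet_derivative f (at x) (axis i 1)"

definition grad :: "scalar_field \<Rightarrow> vector_field" where
  "grad f x = (\<chi> i. partial i f x)"

definition divergence :: "vector_field \<Rightarrow> scalar_field" where
  "divergence f x = (\<Sum>i\<in>UNIV. partial i (\<lambda>y. f y $ i) x)"

definition curl :: "vector_field \<Rightarrow> vector_field" where
  "curl f x = vector
     [partial 2 (\<lambda>y. f y $ 3) x - partial 3 (\<lambda>y. f y $ 2) x,
      partial 3 (\<lambda>y. f y $ 1) x - partial 1 (\<lambda>y. f y $ 3) x,
      partial 1 (\<lambda>y. f y $ 2) x - partial 2 (\<lambda>y. f y $ 1) x]"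

text \<open>\<open>advect u f\<close> is \<open>(u \<cdot> \<nabla>) f\<close>.\<close>

definition advect :: "vector_field \<Rightarrow> vector_field \<Rightarrow> vector_field" where
  "advect u f x = (\<chi> j. \<Sum>i\<in>UNIV. u x $ i * partial i (\<lambda>y. f y $ j) x)"


subsection \<open>Sobolev spaces on the torus\<close>

type_synonym multi_index = "nat ^ 3"

definition mi_order :: "multi_index \<Rightarrow> nat" where
  "mi_order \<alpha> = (\<Sum>i\<in>UNIV. \<alpha> $ i)"

definition mi_deriv :: "multi_index \<Rightarrow> scalar_field \<Rightarrow> scalar_field" where
  "mi_deriv \<alpha> f =
     (partial 1 ^^ (\<alpha> $ 1)) ((partial 2 ^^ (\<alpha> $ 2)) ((partial 3 ^^ (\<alpha> $ 3)) f))"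

text \<open>The infinitely differentiable functions on the torus.\<close>

definition test_function :: "scalar_field \<Rightarrow> bool" where
  "test_function \<phi> \<longleftrightarrow> periodic \<phi> \<and> (\<forall>\<alpha> x. mi_deriv \<alpha> \<phi> differentiable (at x))"

definition L2_torus :: "scalar_field set" where
  "L2_torus = {g. periodic g \<and> g \<in> borel_measurable lebesgue \<and>
                  set_integrable lebesgue unit_cube (\<lambda>x. (g x)\<^sup>2)}"

definition L2_norm_torus :: "(R3 \<Rightarrow> 'a::real_normed_vector) \<Rightarrow> real" where
  "L2_norm_torus f = sqrt (LINT x:unit_cube|lebesgue. (norm (f x))\<^sup>2)"

definition is_weak_deriv :: "multi_index \<Rightarrow> scalar_field \<Rightarrow> scalar_field \<Rightarrow> bool" where
  "is_weak_deriv \<alpha> f g \<longleftrightarrow> g \<in> L2_torus \<and>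
     (\<forall>\<phi>. test_function \<phi> \<longrightarrow>
        (LINT x:unit_cube|lebesgue. f x * mi_deriv \<alpha> \<phi> x) =
        (-1) ^ mi_order \<alpha> * (LINT x:unit_cube|lebesgue. g x * \<phi> x))"

text \<open>
  Weak derivatives are unique only up to null sets; the choice is immaterial, since
  \<open>weak_deriv\<close> is used only inside \<open>L2_norm_torus\<close>.
\<close>

definition weak_deriv :: "multi_index \<Rightarrow> scalar_field \<Rightarrow> scalar_field" where
  "weak_deriv \<alpha> f = (SOME g. is_weak_deriv \<alpha> f g)"

text \<open>
  \<open>H\<^sup>m\<close>, with every class represented by its continuous member (it exists and is
  unique for \<open>m > 3/2\<close>, and is continuously differentiable for \<open>m > 5/2\<close>). This makes
  derivatives and eigenvalues below meaningful pointwise.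
\<close>

definition sobolev :: "nat \<Rightarrow> scalar_field set" where
  "sobolev m = {f. periodic f \<and> continuous_on UNIV f \<and>
                   (\<forall>\<alpha>. mi_order \<alpha> \<le> m \<longrightarrow> (\<exists>g. is_weak_deriv \<alpha> f g))}"

definition sobolev_norm :: "nat \<Rightarrow> vector_field \<Rightarrow> real" where
  "sobolev_norm m u =
     sqrt (\<Sum>j\<in>UNIV. \<Sum>\<alpha> | mi_order \<alpha> \<le> m. (L2_norm_torus (weak_deriv \<alpha> (\<lambda>x. u x $ j)))\<^sup>2)"

definition sobolev_sigma :: "nat \<Rightarrow> vector_field set" where
  "sobolev_sigma m = {u. (\<forall>j. (\<lambda>x. u x $ j) \<in> sobolev m) \<and> (\<forall>x. divergence u x = 0)}"


subsection \<open>The Euler equations\<close>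

text \<open>
  \<open>euler_solution m T v\<^sub>0 v\<close>: \<open>v\<close> is a solution in \<open>C([0,T); sobolev_sigma m)\<close>.
  For \<open>m > 5/2\<close> such solutions have \<open>\<partial>v/\<partial>t\<close> and \<open>\<nabla>p\<close> continuous in space-time, so the equation
  is read pointwise. Values of \<open>v\<close> outside \<open>[0,T)\<close> are irrelevant.
\<close>

definition euler_solution ::
    "nat \<Rightarrow> real \<Rightarrow> vector_field \<Rightarrow> (real \<Rightarrow> vector_field) \<Rightarrow> bool" where
  "euler_solution m T v\<^sub>0 v \<longleftrightarrow>
     0 < T \<and> v 0 = v\<^sub>0 \<and>
     (\<forall>t\<in>{0..<T}. v t \<in> sobolev_sigma m) \<and>
     (\<forall>t\<in>{0..<T}. ((\<lambda>s. sobolev_norm m (\<lambda>x. v s x - v t x)) \<longlongrightarrow> 0) (at t within {0..<T})) \<and>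
     (\<exists>p :: real \<Rightarrow> scalar_field.
        (\<forall>t\<in>{0..<T}. periodic (p t) \<and> (\<forall>x. p t differentiable (at x))) \<and>
        continuous_on ({0..<T} \<times> UNIV) (\<lambda>(t, x). grad (p t) x) \<and>
        (\<forall>t\<in>{0..<T}. \<forall>x.
           ((\<lambda>s. v s x) has_vector_derivative (- advect (v t) (v t) x - grad (p t) x))
             (at t within {0..<T})))"

definition unique_existence :: "nat \<Rightarrow> real \<Rightarrow> vector_field \<Rightarrow> bool" where
  "unique_existence m T v\<^sub>0 \<longleftrightarrow>
     (\<exists>v. euler_solution m T v\<^sub>0 v \<and>
          (\<forall>w. euler_solution m T v\<^sub>0 w \<longrightarrow> (\<forall>t\<in>{0..<T}. w t = v t)))"

definition T_max :: "nat \<Rightarrow> vector_field \<Rightarrow> ereal" where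
  "T_max m v\<^sub>0 = (SUP T\<in>{T. unique_existence m T v\<^sub>0}. ereal T)"

text \<open>The solution operator \<open>S\<^sub>t\<close>, meaningful for \<open>0 \<le> t < T_max m v\<^sub>0\<close>.\<close>

definition S :: "nat \<Rightarrow> real \<Rightarrow> vector_field \<Rightarrow> vector_field" where
  "S m t v\<^sub>0 = (THE u. \<exists>T v. t < T \<and> unique_existence m T v\<^sub>0 \<and>
                            euler_solution m T v\<^sub>0 v \<and> u = v t)"


subsection \<open>Deformation tensor and its eigenvalues\<close>

definition deformation :: "vector_field \<Rightarrow> R3 \<Rightarrow> real ^ 3 ^ 3" where
  "deformation f x =
     (\<chi> i j. (partial i (\<lambda>y. f y $ j) x + partial j (\<lambda>y. f y $ i) x) / 2)"

text \<open>
  The eigenvalues of a symmetric matrix in decreasing order, counted with multiplicity as roots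
  of the characteristic polynomial.
\<close>

definition eigenvalues :: "real ^ 3 ^ 3 \<Rightarrow> real ^ 3" where
  "eigenvalues A = (THE l. l $ 1 \<ge> l $ 2 \<and> l $ 2 \<ge> l $ 3 \<and>
     (\<forall>z. det (mat z - A) = (z - l $ 1) * (z - l $ 2) * (z - l $ 3)))"

definition lam :: "3 \<Rightarrow> vector_field \<Rightarrow> scalar_field" where
  "lam i f x = eigenvalues (deformation f x) $ i"

definition A_plus :: "nat \<Rightarrow> vector_field set" where
  "A_plus m = {f \<in> sobolev_sigma m. (INF x. lam 2 f x) > 0}"

definition A_minus :: "nat \<Rightarrow> vector_field set" where
  "A_minus m = {f \<in> sobolev_sigma m. (SUP x. lam 2 f x) < 0}"

definition sign_change_times :: "nat \<Rightarrow> vector_field \<Rightarrow> real set" where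
  "sign_change_times m f =
     (if f \<in> A_plus m
      then {t. 0 < t \<and> ereal t < T_max m f \<and> (\<exists>x. lam 2 (S m t f) x < 0)}
      else {t. 0 < t \<and> ereal t < T_max m f \<and> (\<exists>x. lam 2 (S m t f) x > 0)})"

text \<open>
  The time \<open>T(f)\<close>, meaningful for \<open>f \<in> A_plus m \<union> A_minus m\<close> (the two sets are disjoint).
\<close>

definition T_sign :: "nat \<Rightarrow> vector_field \<Rightarrow> ereal" where
  "T_sign m f = (if sign_change_times m f = {} then T_max m f
                 else (INF t\<in>sign_change_times m f. ereal t))"

end

theory Submission
  imports Defs
begin

text \<open>
  Let \<open>A = \<nabla>v\<close>, let \<open>S\<close> be its symmetric part and \<open>\<lambda>\<^sub>1 \<ge> \<lambda>\<^sub>2 \<ge> \<lambda>\<^sub>3\<close> the eigenvalues of \<open>S\<close>; their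
  sum is \<open>div v = 0\<close>. For divergence free fields \<open>\<integral> |\<omega>|\<^sup>2 = \<integral> |A|\<^sup>2 = 2 \<integral> |S|\<^sup>2\<close>, because
  \<open>\<integral> tr A\<^sup>2 = \<integral> (tr A)\<^sup>2 = 0\<close>. Along a solution this quantity changes at the rate
  \<open>-2 \<integral> tr (A\<^sup>2 A\<^sup>T)\<close>, since transport and pressure drop out; and pointwise
  \<open>tr (A\<^sup>2 A\<^sup>T) = 4 det S - det A\<close>, where \<open>det A\<close> is a null Lagrangian. So the rate is
  \<open>-8 \<integral> \<lambda>\<^sub>1 \<lambda>\<^sub>2 \<lambda>\<^sub>3\<close>. If \<open>\<lambda>\<^sub>2 \<ge> 0\<close>, then \<open>-\<lambda>\<^sub>1 \<lambda>\<^sub>2 \<lambda>\<^sub>3 = \<lambda>\<^sub>2 \<lambda>\<^sub>1 (\<lambda>\<^sub>1 + \<lambda>\<^sub>2)\<close> lies between \<open>\<lambda>\<^sub>2 |S|\<^sup>2 / 4\<close> and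
  \<open>\<lambda>\<^sub>2 |S|\<^sup>2 / 2\<close>, so the rate lies between \<open>inf |\<lambda>\<^sub>2|\<close> and \<open>2 sup |\<lambda>\<^sub>2|\<close> times the enstrophy, and
  Gronwall's inequality and a square root give the estimates. If \<open>\<lambda>\<^sub>2 \<le> 0\<close>, the same applies to
  \<open>-S\<close> and the sign of the rate is reversed.

  The smallest admissible order is \<open>m = 3\<close>, where \<open>v\<close> is \<open>C\<^sup>1\<close> but its second derivatives need not be
  continuous. Differentiating the equation pointwise is avoided: every integration by parts
  is done for difference quotients, where it is an exact consequence of translation invariance, and
  then one passes to the limit. This is how \<open>grad_energy_balance\<close>, \<open>integral_partial_mult_swap\<close> and
  \<open>integral_jacobian_eq_0\<close> are obtained for \<open>C\<^sup>1\<close> fields.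

  What is left to know about a solution is that it depends continuously on time in \<open>C\<^sup>1\<close>. This is
  \<open>sobolev_embedding\<close>, proved with Fourier series: Bessel's inequality for the weak derivatives
  bounds the coefficients, and three derivatives suffice to sum the series of first derivatives
  absolutely in dimension three. The integrals over time make sense because the ordered eigenvalues
  of a symmetric matrix are continuous functions of it (\<open>continuous_on_eigenvalues\<close>).
\<close>

section \<open>Integration and difference quotients on the torus\<close>

lemma periodic_add_axis_int:
  assumes "periodic f"
  shows "f (x + of_int n *\<^sub>R axis i 1) = f x"
proof (induction n rule: int_induct[where k = 0])
  case base
  then show ?case by simp
next
  case (step1 n)
  have "x + of_int (n + 1) *\<^sub>R axis i 1 = (x + of_int n *\<^sub>R axis i 1) + axis i (1::real)"
    by (simp add: algebra_simps)
  with step1 assms show ?case unfolding periodic_def by metis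
next
  case (step2 n)
  have "x + of_int n *\<^sub>R axis i 1 = (x + of_int (n - 1) *\<^sub>R axis i 1) + axis i (1::real)"
    by (simp add: algebra_simps)
  with step2 assms show ?case unfolding periodic_def by metis
qed

lemma R3_expand: "(x::R3) = (x $ 1) *\<^sub>R axis 1 1 + (x $ 2) *\<^sub>R axis 2 1 + (x $ 3) *\<^sub>R axis 3 1"
  by (simp add: vec_eq_iff forall_3 axis_def)

lemma periodic_add_int:
  assumes "periodic f"
  shows "f (x + (\<chi> i. of_int (n i))) = f x"
proof -
  have "x + (\<chi> i. of_int (n i)) = x + of_int (n 1) *\<^sub>R axis 1 1 + of_int (n 2) *\<^sub>R axis 2 1 + of_int (n 3) *\<^sub>R axis 3 1"
    by (simp add: vec_eq_iff forall_3 axis_def)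
  then show ?thesis by (metis periodic_add_axis_int[OF assms])
qed

lemma unit_cube_representative: "\<exists>n. (x::R3) + (\<chi> i. of_int (n i)) \<in> unit_cube"
proof -
  have "0 \<le> x $ i + of_int (- \<lfloor>x $ i\<rfloor>) \<and> x $ i + of_int (- \<lfloor>x $ i\<rfloor>) \<le> 1" for i
    using floor_correct[of "x $ i"] by (simp, linarith)
  then have "x + (\<chi> i. of_int (- \<lfloor>x $ i\<rfloor>)) \<in> unit_cube"
    unfolding unit_cube_def mem_box_cart by simp
  then show ?thesis by (rule exI[where x = "\<lambda>i. - \<lfloor>x $ i\<rfloor>"])
qed

lemma periodic_shift: "periodic f \<Longrightarrow> periodic (\<lambda>x. f (x + a))"
  unfolding periodic_def by (metis (no_types, lifting) add.commute add.left_commute)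

text \<open>
  Cut the shifted cube at the face \<open>x\<^sub>i = 1\<close>; by periodicity the slab beyond it is the slab that
  the shift left uncovered.
\<close>

lemma integral_shift_axis_unit:
  fixes F :: "R3 \<Rightarrow> 'a::banach"
  assumes per: "periodic F" and cont: "continuous_on UNIV F" and s: "0 \<le> s" "s \<le> 1"
  shows "integral unit_cube (\<lambda>x. F (x + s *\<^sub>R axis i 1)) = integral unit_cube F"
proof -
  let ?e = "axis i 1 :: R3"
  have e: "?e \<in> Basis" by (simp add: axis_in_Basis_iff)
  have dot: "x \<bullet> ?e = x $ i" for x :: R3 by (simp add: inner_axis)
  have axis_nth: "?e $ j = (if j = i then 1 else 0)" for j by (simp add: axis_def)
  have box: "x \<in> cbox a b \<longleftrightarrow> (a $ i \<le> x $ i \<and> x $ i \<le> b $ i) \<and> (\<forall>j. j \<noteq> i \<longrightarrow> a $ j \<le> x $ j \<and> x $ j \<le> b $ j)"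
    for x a b :: R3
    by (auto simp: mem_box_cart)
  have int: "F integrable_on cbox a b" for a b
    by (rule integrable_continuous) (rule continuous_on_subset[OF cont], simp)
  have "integral unit_cube (\<lambda>x. F (x + s *\<^sub>R ?e)) = integral (cbox (s *\<^sub>R ?e) (1 + s *\<^sub>R ?e)) F"
    using integral_shift_cbox[of "s *\<^sub>R ?e" "s *\<^sub>R ?e" "1 + s *\<^sub>R ?e" F] by (simp add: unit_cube_def)
  also have "\<dots> = integral (cbox (s *\<^sub>R ?e) (1 + s *\<^sub>R ?e) \<inter> {x. x \<bullet> ?e \<le> 1}) F
                + integral (cbox (s *\<^sub>R ?e) (1 + s *\<^sub>R ?e) \<inter> {x. x \<bullet> ?e \<ge> 1}) F"
    by (rule integral_split[OF int e])
  also have "cbox (s *\<^sub>R ?e) (1 + s *\<^sub>R ?e) \<inter> {x. x \<bullet> ?e \<le> 1} = cbox (s *\<^sub>R ?e) 1"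
    using s unfolding dot by (auto simp: box axis_nth)
  also have "cbox (s *\<^sub>R ?e) (1 + s *\<^sub>R ?e) \<inter> {x. x \<bullet> ?e \<ge> 1} = cbox ?e (1 + s *\<^sub>R ?e)"
    using s unfolding dot by (auto simp: box axis_nth)
  also have "integral (cbox ?e (1 + s *\<^sub>R ?e)) F = integral (cbox 0 (1 + (s - 1) *\<^sub>R ?e)) (\<lambda>x. F (x + ?e))"
    using integral_shift_cbox[of ?e ?e "1 + s *\<^sub>R ?e" F] by (simp add: algebra_simps)
  also have "(\<lambda>x. F (x + ?e)) = F" using per by (auto simp: periodic_def)
  also have "integral (cbox (s *\<^sub>R ?e) 1) F + integral (cbox 0 (1 + (s - 1) *\<^sub>R ?e)) F = integral (cbox 0 1) F"
  proof -
    have "integral (cbox 0 1) F = integral (cbox 0 1 \<inter> {x. x \<bullet> ?e \<le> s}) F + integral (cbox 0 1 \<inter> {x. x \<bullet> ?e \<ge> s}) F"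
      by (rule integral_split[OF int e])
    also have "cbox 0 1 \<inter> {x. x \<bullet> ?e \<le> s} = cbox 0 (1 + (s - 1) *\<^sub>R ?e)"
      using s unfolding dot by (auto simp: box axis_nth)
    also have "cbox 0 1 \<inter> {x. x \<bullet> ?e \<ge> s} = cbox (s *\<^sub>R ?e) 1"
      using s unfolding dot by (auto simp: box axis_nth)
    finally show ?thesis by simp
  qed
  finally show ?thesis by (simp add: unit_cube_def)
qed

lemma integral_shift_axis:
  fixes F :: "R3 \<Rightarrow> 'a::banach"
  assumes per: "periodic F" and cont: "continuous_on UNIV F"
  shows "integral unit_cube (\<lambda>x. F (x + s *\<^sub>R axis i 1)) = integral unit_cube F"
proof -
  have "F (x + s *\<^sub>R axis i 1) = F (x + frac s *\<^sub>R axis i 1)" for x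
  proof -
    have "x + s *\<^sub>R axis i 1 = (x + frac s *\<^sub>R axis i 1) + of_int \<lfloor>s\<rfloor> *\<^sub>R axis i (1::real)"
      by (simp add: frac_def algebra_simps)
    then show ?thesis using periodic_add_axis_int[OF per] by metis
  qed
  then show ?thesis
    using integral_shift_axis_unit[OF per cont, of "frac s" i] by (simp add: frac_lt_1 less_imp_le)
qed

lemma continuous_on_shift:
  fixes F :: "R3 \<Rightarrow> 'a::topological_space"
  shows "continuous_on UNIV F \<Longrightarrow> continuous_on UNIV (\<lambda>x. F (x + a))"
  by (rule continuous_on_compose2[of UNIV F]) (auto intro!: continuous_intros)

lemma integral_torus_shift:
  fixes F :: "R3 \<Rightarrow> 'a::banach"
  assumes per: "periodic F" and cont: "continuous_on UNIV F"
  shows "integral unit_cube (\<lambda>x. F (x + a)) = integral unit_cube F"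
proof -
  let ?G = "\<lambda>x. F (x + (a $ 1) *\<^sub>R axis 1 1)"
  let ?H = "\<lambda>x. ?G (x + (a $ 2) *\<^sub>R axis 2 1)"
  note sh = periodic_shift continuous_on_shift
  have "F (x + a) = ?H (x + (a $ 3) *\<^sub>R axis 3 1)" for x
    by (subst R3_expand[of a]) (simp add: algebra_simps)
  then have "integral unit_cube (\<lambda>x. F (x + a)) = integral unit_cube (\<lambda>x. ?H (x + (a $ 3) *\<^sub>R axis 3 1))"
    by simp
  also have "\<dots> = integral unit_cube ?H"
    by (intro integral_shift_axis sh per cont)
  also have "\<dots> = integral unit_cube ?G"
    by (rule integral_shift_axis[of ?G]) (intro sh per cont)+
  also have "\<dots> = integral unit_cube F"
    by (intro integral_shift_axis sh per cont)
  finally show ?thesis .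
qed

definition dq :: "real \<Rightarrow> 3 \<Rightarrow> scalar_field \<Rightarrow> scalar_field" where
  "dq h i f x = (f (x + h *\<^sub>R axis i 1) - f x) / h"

lemma partial_eq: "(f has_derivative f') (at x) \<Longrightarrow> partial i f x = f' (axis i 1)"
  by (simp add: partial_def frechet_derivative_at[symmetric])

lemma dq_mean_value:
  assumes d: "\<And>x. f differentiable (at x)" and h: "h > 0"
  shows "\<exists>\<theta>. 0 \<le> \<theta> \<and> \<theta> \<le> h \<and> dq h i f x = partial i f (x + \<theta> *\<^sub>R axis i 1)"
proof -
  have der: "((\<lambda>s. f (x + s *\<^sub>R axis i 1)) has_real_derivative partial i f (x + s *\<^sub>R axis i 1)) (at s)" for s
  proof -
    have "(f has_derivative frechet_derivative f (at (x + s *\<^sub>R axis i 1))) (at (x + s *\<^sub>R axis i 1))"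
      using d frechet_derivative_works by blast
    then have "((\<lambda>s. f (x + s *\<^sub>R axis i 1)) has_derivative 
        (\<lambda>u. frechet_derivative f (at (x + s *\<^sub>R axis i 1)) (u *\<^sub>R axis i 1))) (at s)"
      by (rule has_derivative_compose[rotated]) (auto intro!: derivative_eq_intros)
    moreover have "frechet_derivative f (at y) (u *\<^sub>R axis i 1) = u * partial i f y" for u y
      using linear_frechet_derivative[OF d] by (simp add: partial_def linear_cmul)
    ultimately show ?thesis
      by (simp add: has_field_derivative_def mult.commute[of _ "partial i f _"])
  qed
  obtain z where z: "0 < z" "z < h" 
      "f (x + h *\<^sub>R axis i 1) - f (x + 0 *\<^sub>R axis i 1) = (h - 0) * partial i f (x + z *\<^sub>R axis i 1)"
    using MVT2[of 0 h "\<lambda>s. f (x + s *\<^sub>R axis i 1)" "\<lambda>s. partial i f (x + s *\<^sub>R axis i 1)"] h der by auto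
  then show ?thesis using h by (intro exI[of _ z]) (auto simp: dq_def)
qed

lemma has_derivative_shift:
  fixes f :: "R3 \<Rightarrow> 'a::real_normed_vector"
  assumes "(f has_derivative D) (at (x + a))"
  shows "((\<lambda>y. f (y + a)) has_derivative D) (at x)"
  by (rule has_derivative_compose[where f = "\<lambda>y. y + a" and f' = "\<lambda>h. h", OF _ assms])
    (auto intro!: derivative_eq_intros)

lemma partial_shift:
  assumes "f differentiable (at (x + a))"
  shows "partial i (\<lambda>y. f (y + a)) x = partial i f (x + a)"
  using assms has_derivative_shift partial_eq unfolding differentiable_def by metis

lemma periodic_partial:
  assumes "periodic f" "\<And>x. f differentiable (at x)"
  shows "periodic (partial i f)"
  unfolding periodic_def
proof (intro allI)
  fix x j
  have "(\<lambda>y. f (y + axis j 1)) = f" using assms(1) by (auto simp: periodic_def)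
  then show "partial i f (x + axis j 1) = partial i f x"
    using partial_shift[OF assms(2), where a = "axis j 1" and x = x] by simp
qed

text \<open>
  The mean value theorem turns a difference quotient into a partial derivative at a nearby point,
  and on the torus a continuous partial derivative is uniformly continuous. The compact parameter
  set serves as a time interval later; the moving base point \<open>x + h *\<^sub>R w\<close> absorbs the shifts that
  the discrete product rule produces.
\<close>

lemma uniform_limit_dq:
  fixes f :: "'p::metric_space \<Rightarrow> scalar_field"
  assumes K: "compact K" and per: "\<And>p. p \<in> K \<Longrightarrow> periodic (f p)"
    and d: "\<And>p x. p \<in> K \<Longrightarrow> f p differentiable (at x)"
    and cont: "continuous_on (K \<times> UNIV) (\<lambda>(p, x). partial i (f p) x)"
  shows "uniform_limit (K \<times> UNIV) (\<lambda>h (p, x). dq h i (f p) (x + h *\<^sub>R w))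
           (\<lambda>(p, x). partial i (f p) x) (at_right 0)"
proof (rule uniform_limitI)
  fix e :: real assume "e > 0"
  obtain B where B: "\<And>x. x \<in> unit_cube \<Longrightarrow> norm x \<le> B"
    using bounded_cbox[of "0::R3" 1] unfolding unit_cube_def bounded_iff by auto
  let ?C = "cball 0 (B + norm w + 1) :: R3 set"
  have "uniformly_continuous_on (K \<times> ?C) (\<lambda>(p, x). partial i (f p) x)"
    by (intro compact_uniformly_continuous compact_Times K continuous_on_subset[OF cont]) auto
  then obtain r where r: "r > 0" "\<And>p x y. p \<in> K \<Longrightarrow> x \<in> ?C \<Longrightarrow> y \<in> ?C \<Longrightarrow> dist x y < r \<Longrightarrow> 
      dist (partial i (f p) x) (partial i (f p) y) < e"
    using \<open>e > 0\<close> unfolding uniformly_continuous_on_def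
    by (force simp: dist_Pair_Pair)
  let ?b = "min 1 (r / (norm w + 1))"
  have "?b > 0" using r(1) by (simp add: add_nonneg_pos)
  have "eventually (\<lambda>h. h \<in> {0<..<?b}) (at_right (0::real))"
    by (rule eventually_at_right_real) fact
  then show "\<forall>\<^sub>F h in at_right 0. \<forall>q\<in>K \<times> UNIV.
      dist (case q of (p, x) \<Rightarrow> dq h i (f p) (x + h *\<^sub>R w)) (case q of (p, x) \<Rightarrow> partial i (f p) x) < e"
  proof eventually_elim
    case (elim h)
    have main: "dist (dq h i (f p) (x + h *\<^sub>R w)) (partial i (f p) x) < e" if p: "p \<in> K" for p x
    proof -
      obtain n where n: "x + (\<chi> i. of_int (n i)) \<in> unit_cube" using unit_cube_representative by blast
      define z where "z = x + (\<chi> i. of_int (n i))"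
      obtain \<theta> where \<theta>: "0 \<le> \<theta>" "\<theta> \<le> h" 
          "dq h i (f p) (x + h *\<^sub>R w) = partial i (f p) (x + h *\<^sub>R w + \<theta> *\<^sub>R axis i 1)"
        using dq_mean_value[OF d[OF p], of h] elim by auto
      define y where "y = h *\<^sub>R w + \<theta> *\<^sub>R (axis i 1 :: R3)"
      have "norm y \<le> h * norm w + \<theta>"
        unfolding y_def using elim \<theta>
        by (intro order_trans[OF norm_triangle_ineq]) (auto simp: norm_axis_1)
      also have "\<dots> \<le> h * (norm w + 1)" using \<theta> by (simp add: algebra_simps)
      finally have y1: "norm y \<le> h * (norm w + 1)" .
      have y2: "norm y < r"
        using y1 elim by (auto simp: pos_less_divide_eq add_nonneg_pos)
      have y3: "norm y \<le> norm w + 1"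
        using y1 elim mult_right_mono[of h 1 "norm w + 1"] by (auto intro: order_trans)
      have zB: "norm z \<le> B" using B n by (simp add: z_def)
      have P: "periodic (partial i (f p))" by (rule periodic_partial[OF per[OF p] d[OF p]])
      have "dist (partial i (f p) (z + y)) (partial i (f p) z) < e"
        by (rule r(2)[OF p])
           (use zB y2 y3 norm_ge_zero[of w] norm_triangle_ineq[of z y]
             in \<open>simp_all add: dist_norm[of "z + y"] del: norm_ge_zero mem_cball add: mem_cball_0\<close>)
      moreover have "partial i (f p) z = partial i (f p) x"
        unfolding z_def by (rule periodic_add_int[OF P])
      moreover have "partial i (f p) (z + y) = partial i (f p) (x + y)"
        unfolding z_def using periodic_add_int[OF P, of "x + y" n] by (simp add: algebra_simps)
      ultimately show ?thesis using \<theta>(3) by (simp add: y_def algebra_simps)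
    qed
    then show ?case by auto
  qed
qed

definition C1_torus :: "scalar_field \<Rightarrow> bool" where
  "C1_torus f \<longleftrightarrow> periodic f \<and> (\<forall>x. f differentiable (at x)) \<and> (\<forall>i. continuous_on UNIV (partial i f))"

lemma C1_torusD:
  assumes "C1_torus f"
  shows "periodic f" "f differentiable (at x)" "continuous_on UNIV (partial i f)"
    "continuous_on UNIV f" "periodic (partial i f)"
proof -
  show *: "periodic f" "f differentiable (at x)" "continuous_on UNIV (partial i f)" for x i
    using assms by (auto simp: C1_torus_def)
  then show "continuous_on UNIV f"
    by (meson continuous_at_imp_continuous_on differentiable_imp_continuous_within)
  from * show "periodic (partial i f)" by (intro periodic_partial)
qed

lemma C1_torus_mult:
  assumes f: "C1_torus f" and g: "C1_torus g"
  shows "C1_torus (\<lambda>x. f x * g x)" "partial i (\<lambda>x. f x * g x) x = f x * partial i g x + partial i f x * g x"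
proof -
  have D: "((\<lambda>x. f x * g x) has_derivative 
     (\<lambda>h. f x * frechet_derivative g (at x) h + frechet_derivative f (at x) h * g x)) (at x)" for x
    using C1_torusD(2)[OF f, of x] C1_torusD(2)[OF g, of x]
    by (intro has_derivative_mult) (auto simp: frechet_derivative_works)
  show p: "partial i (\<lambda>x. f x * g x) x = f x * partial i g x + partial i f x * g x" for i x
    using partial_eq[OF D] by (simp add: partial_def)
  show "C1_torus (\<lambda>x. f x * g x)"
    unfolding C1_torus_def p[abs_def]
    using D C1_torusD[OF f] C1_torusD[OF g]
    by (auto intro!: continuous_intros simp: differentiable_def) (auto simp: periodic_def)
qed

lemma C1_torus_lincomb:
  assumes f: "C1_torus f" and g: "C1_torus g"
  shows "C1_torus (\<lambda>x. a * f x + b * g x)" 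
    "partial i (\<lambda>x. a * f x + b * g x) x = a * partial i f x + b * partial i g x"
proof -
  have D: "((\<lambda>x. a * f x + b * g x) has_derivative 
     (\<lambda>h. a * frechet_derivative f (at x) h + b * frechet_derivative g (at x) h)) (at x)" for x
    using C1_torusD(2)[OF f, of x] C1_torusD(2)[OF g, of x]
    by (auto intro!: has_derivative_add has_derivative_mult_right simp: frechet_derivative_works)
  show p: "partial i (\<lambda>x. a * f x + b * g x) x = a * partial i f x + b * partial i g x" for i x
    using partial_eq[OF D] by (simp add: partial_def)
  show "C1_torus (\<lambda>x. a * f x + b * g x)"
    unfolding C1_torus_def p[abs_def]
    using D C1_torusD[OF f] C1_torusD[OF g]
    by (auto intro!: continuous_intros simp: differentiable_def) (auto simp: periodic_def)
qed

lemma C1_torus_shift: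
  assumes f: "C1_torus f"
  shows "C1_torus (\<lambda>x. f (x + a))" 
  unfolding C1_torus_def partial_shift[OF C1_torusD(2)[OF f], abs_def]
  using C1_torusD[OF f] has_derivative_shift[of f]
  by (auto intro: continuous_on_shift periodic_shift simp: differentiable_def) metis

lemma C1_torus_dq:
  assumes f: "C1_torus f"
  shows "C1_torus (dq h i f)" "partial j (dq h i f) x = dq h i (partial j f) x"
proof -
  have eq: "dq h i f = (\<lambda>x. (1/h) * f (x + h *\<^sub>R axis i 1) + (- 1/h) * f x)"
    by (auto simp: dq_def fun_eq_iff field_simps) (simp add: diff_divide_distrib)
  show "C1_torus (dq h i f)" unfolding eq by (intro C1_torus_lincomb C1_torus_shift f)
  show "partial j (dq h i f) x = dq h i (partial j f) x"
    unfolding eq C1_torus_lincomb(2)[OF C1_torus_shift[OF f] f] partial_shift[OF C1_torusD(2)[OF f]]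
    by (simp add: dq_def diff_divide_distrib)
qed

lemma integrable_unit_cube:
  fixes F :: "R3 \<Rightarrow> 'a::banach"
  shows "continuous_on UNIV F \<Longrightarrow> F integrable_on unit_cube"
  unfolding unit_cube_def by (rule integrable_continuous) (erule continuous_on_subset, simp)

lemma integral_tendsto_uniform:
  fixes g :: "R3 \<Rightarrow> 'a::banach"
  assumes "uniform_limit unit_cube f g F" "\<And>n. continuous_on unit_cube (f n)" "F \<noteq> bot"
  shows "((\<lambda>n. integral unit_cube (f n)) \<longlongrightarrow> integral unit_cube g) F"
proof -
  obtain I J where "\<And>n. (f n has_integral I n) unit_cube" "(g has_integral J) unit_cube" "(I \<longlongrightarrow> J) F"
    using uniform_limit_integral_cbox[where a = 0 and b = 1 and f = f and g = g and F = F] assms unfolding unit_cube_def by blast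
  moreover from this have "I = (\<lambda>n. integral unit_cube (f n))" "J = integral unit_cube g"
    by (auto simp: fun_eq_iff intro: integral_unique[symmetric])
  ultimately show ?thesis by simp
qed

lemma uniform_limit_dq_fixed:
  assumes "periodic f" "\<And>x. f differentiable (at x)" "continuous_on UNIV (partial i f)"
  shows "uniform_limit unit_cube (\<lambda>h x. dq h i f (x + h *\<^sub>R w)) (partial i f) (at_right 0)"
proof -
  have "uniform_limit ({0::real} \<times> UNIV) (\<lambda>h (p, x). dq h i f (x + h *\<^sub>R w)) (\<lambda>(p, x). partial i f x) (at_right 0)"
    using assms 
    by (intro uniform_limit_dq) (auto intro!: continuous_on_compose2[OF assms(3)] continuous_intros simp: split_beta)
  then show ?thesis by (force simp: uniform_limit_iff elim: eventually_mono)
qed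

lemma continuous_on_dq:
  "continuous_on UNIV f \<Longrightarrow> continuous_on A (\<lambda>x. dq h i f (x + w))"
  unfolding dq_def divide_inverse
  by (intro continuous_intros; rule continuous_on_compose2[of UNIV f]) (auto intro!: continuous_intros)

lemma integral_dq_mult:
  assumes "periodic f" "continuous_on UNIV f" "periodic g" "continuous_on UNIV g"
  shows "integral unit_cube (\<lambda>x. dq h i f x * g (x + h *\<^sub>R axis i 1)) = - integral unit_cube (\<lambda>x. f x * dq h i g x)"
proof -
  let ?a = "h *\<^sub>R axis i 1 :: R3"
  have c: "continuous_on UNIV (\<lambda>x. f x * g x)" and p: "periodic (\<lambda>x. f x * g x)"
    and c': "continuous_on UNIV (\<lambda>x. f x * g (x + ?a))"
    using assms by (auto intro!: continuous_intros continuous_on_shift simp: periodic_def)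
  note I = integrable_unit_cube
  have "integral unit_cube (\<lambda>x. dq h i f x * g (x + ?a)) = 
      integral unit_cube (\<lambda>x. (1 / h) * (f (x + ?a) * g (x + ?a) - f x * g (x + ?a)))"
    by (intro integral_cong) (simp add: dq_def field_simps)
  also have "\<dots> = (1 / h) * (integral unit_cube (\<lambda>x. f (x + ?a) * g (x + ?a)) - integral unit_cube (\<lambda>x. f x * g (x + ?a)))"
    using I[OF c'] I[OF continuous_on_shift[OF c, of ?a]] by (simp add: integral_diff)
  also have "integral unit_cube (\<lambda>x. f (x + ?a) * g (x + ?a)) = integral unit_cube (\<lambda>x. f x * g x)"
    by (rule integral_torus_shift[OF p c])
  also have "(1 / h) * (integral unit_cube (\<lambda>x. f x * g x) - integral unit_cube (\<lambda>x. f x * g (x + ?a))) =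
      integral unit_cube (\<lambda>x. (1 / h) * (f x * g x - f x * g (x + ?a)))"
    using I[OF c'] I[OF c] by (simp add: integral_diff)
  also have "\<dots> = integral unit_cube (\<lambda>x. - (f x * dq h i g x))"
    by (intro integral_cong) (simp add: dq_def diff_divide_distrib algebra_simps)
  finally show ?thesis by simp
qed

text \<open>
  Difference quotients integrate to \<open>0\<close> by translation invariance and converge uniformly.
\<close>

lemma integral_partial_eq_0:
  assumes f: "periodic f" "\<And>x. f differentiable (at x)" "continuous_on UNIV (partial i f)"
  shows "integral unit_cube (partial i f) = 0"
proof -
  have cf: "continuous_on UNIV f"
    using f(2) by (meson continuous_at_imp_continuous_on differentiable_imp_continuous_within)
  have "integral unit_cube (dq h i f) = 0" for h :: real
    using integral_dq_mult[OF f(1) cf, of "\<lambda>_. 1" h i] by (simp add: dq_def[of h i "\<lambda>_. 1"] periodic_def)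
  moreover have "((\<lambda>h. integral unit_cube (\<lambda>x. dq h i f (x + h *\<^sub>R 0))) \<longlongrightarrow> integral unit_cube (partial i f)) (at_right 0)"
    by (rule integral_tendsto_uniform[OF uniform_limit_dq_fixed[OF f]]) (rule continuous_on_dq[OF cf], simp)
  ultimately show ?thesis by (simp add: tendsto_const_iff)
qed

text \<open>
  For divergence free \<open>V\<close> the integrand is the divergence of \<open>q V\<close>.
\<close>

lemma integral_transport_eq_0:
  fixes V :: vector_field
  assumes V: "\<And>j. C1_torus (\<lambda>x. V x $ j)" and div: "\<And>x. divergence V x = 0" and q: "C1_torus q"
  shows "integral unit_cube (\<lambda>x. \<Sum>j\<in>UNIV. V x $ j * partial j q x) = 0"
proof -
  note m = C1_torus_mult[OF V q]
  have "(\<Sum>j\<in>UNIV. partial j (\<lambda>x. V x $ j * q x) x) = (\<Sum>j\<in>UNIV. V x $ j * partial j q x) + divergence V x * q x" for x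
    by (simp add: m(2) sum.distrib divergence_def sum_distrib_right)
  then have "integral unit_cube (\<lambda>x. \<Sum>j\<in>UNIV. V x $ j * partial j q x) 
      = integral unit_cube (\<lambda>x. \<Sum>j\<in>UNIV. partial j (\<lambda>x. V x $ j * q x) x)"
    using div by simp
  also have "\<dots> = (\<Sum>j\<in>UNIV. integral unit_cube (partial j (\<lambda>x. V x $ j * q x)))"
    by (rule integral_sum) (auto intro: integrable_unit_cube C1_torusD(3) m(1))
  also have "\<dots> = 0"
    by (intro sum.neutral ballI integral_partial_eq_0 C1_torusD[OF m(1)])
  finally show ?thesis .
qed


section \<open>Null Lagrangians\<close>

lemma bounded_image_unit_cube:
  fixes g :: "R3 \<Rightarrow> 'a::real_normed_vector"
  assumes "continuous_on UNIV g"
  shows "bounded (g ` unit_cube)"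
  unfolding unit_cube_def
  by (intro compact_imp_bounded compact_continuous_image continuous_on_subset[OF assms]) auto

lemma dq_commute: "dq h i (dq h j f) x = dq h j (dq h i f) x"
  by (simp add: dq_def diff_divide_distrib add_ac)

lemma dq_mult:
  "dq h i (\<lambda>x. f x * g x) x = dq h i f x * g (x + h *\<^sub>R axis i 1) + f x * dq h i g x"
  by (simp add: dq_def diff_divide_distrib algebra_simps)

lemma dq_shift: "dq h i (\<lambda>x. f (x + a)) x = dq h i f (x + a)"
  by (simp add: dq_def algebra_simps)

lemmas uniform_limit_dq_C1 = uniform_limit_dq_fixed[OF C1_torusD(1,2,3)]

text \<open>
  \<open>\<partial>\<^sub>i f \<partial>\<^sub>j g - \<partial>\<^sub>j f \<partial>\<^sub>i g\<close> is formally the divergence of a field built from first derivatives,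
  which need not be differentiable. For difference quotients summation by parts is an exact
  identity on merely continuous functions, so the symmetry holds before the limit and survives it
  with \<open>C\<^sup>1\<close> regularity only.
\<close>

lemma integral_partial_mult_swap:
  assumes f: "C1_torus f" and g: "C1_torus g"
  shows "integral unit_cube (\<lambda>x. partial i f x * partial j g x) = integral unit_cube (\<lambda>x. partial j f x * partial i g x)"
proof -
  define T where "T i j h = integral unit_cube (\<lambda>x. dq h i f (x + h *\<^sub>R 0) * dq h j g (x + h *\<^sub>R axis i 1))" for i j h
  have lim: "(T i j \<longlongrightarrow> integral unit_cube (\<lambda>x. partial i f x * partial j g x)) (at_right 0)" for i j
    unfolding T_def
    by (intro integral_tendsto_uniform uniform_lim_mult uniform_limit_dq_C1 f g
        bounded_image_unit_cube C1_torusD(3) continuous_intros continuous_on_dq C1_torusD(4)) simp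
  have "T i j h = - integral unit_cube (\<lambda>x. f x * dq h i (dq h j g) x)" for i j h
    using integral_dq_mult[of f "dq h j g" h i] C1_torusD[OF f] C1_torusD[OF C1_torus_dq(1)[OF g]]
    unfolding T_def by simp
  then have "T i j = T j i" by (simp add: fun_eq_iff dq_commute[of _ i j])
  with lim[of i j] lim[of j i] show ?thesis
    by (intro tendsto_unique[of "at_right (0::real)" "T i j"]) simp_all
qed

text \<open>
  The Jacobian determinant is a null Lagrangian. The shifts below are those of the cup product of
  cubical cochains, for which the discrete Leibniz rule is exact; after summation by parts the
  antisymmetric sum cancels because the difference operators commute.
\<close>

lemma integral_jacobian_eq_0:
  assumes a: "C1_torus a" and b: "C1_torus b" and c: "C1_torus c"
  defines "L \<equiv> \<lambda>i j k. integral unit_cube (\<lambda>x. partial i a x * (partial j b x * partial k c x))"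
  shows "L 1 2 3 - L 1 3 2 + L 2 3 1 - L 2 1 3 + L 3 1 2 - L 3 2 1 = 0"
proof -
  let ?e = "\<lambda>h i. h *\<^sub>R axis i 1 :: R3"
  define T where "T i j k h = integral unit_cube (\<lambda>x. dq h i a (x + h *\<^sub>R 0) * 
      (dq h j b (x + h *\<^sub>R axis i 1) * dq h k c (x + h *\<^sub>R (axis i 1 + axis j 1))))" for i j k h
  have lim: "(T i j k \<longlongrightarrow> L i j k) (at_right 0)" for i j k
    unfolding T_def L_def
    by (intro integral_tendsto_uniform uniform_lim_mult uniform_limit_dq_C1 a b c
        bounded_image_unit_cube C1_torusD(3) continuous_intros continuous_on_dq C1_torusD(4)) simp
  \<comment> \<open>the two terms of the discrete product rule: \<open>U\<close> is symmetric in \<open>i, j\<close> and \<open>W\<close> in \<open>i, k\<close>\<close>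
  define U where "U i j k h = integral unit_cube (\<lambda>x. a x * (dq h i (dq h j b) x * dq h k c (x + ?e h i + ?e h j)))" for i j k h
  define W where "W i j k h = integral unit_cube (\<lambda>x. a x * (dq h j b x * dq h i (dq h k c) (x + ?e h j)))" for i j k h
  have T: "T i j k h = - (U i j k h + W i j k h)" for i j k h
  proof -
    let ?g = "\<lambda>x. dq h j b x * dq h k c (x + ?e h j)"
    note C1 = C1_torusD[OF a] C1_torusD[OF C1_torus_dq(1)[OF b]] C1_torusD[OF C1_torus_dq(1)[OF c]]
      C1_torusD[OF C1_torus_dq(1)[OF C1_torus_dq(1)[OF b]]] C1_torusD[OF C1_torus_dq(1)[OF C1_torus_dq(1)[OF c]]]
      C1_torusD[OF C1_torus_mult(1)[OF C1_torus_dq(1)[OF b] C1_torus_shift[OF C1_torus_dq(1)[OF c]]]]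
    have "T i j k h = - integral unit_cube (\<lambda>x. a x * dq h i ?g x)"
      using integral_dq_mult[of a ?g h i] C1 unfolding T_def by (simp add: algebra_simps)
    also have "integral unit_cube (\<lambda>x. a x * dq h i ?g x) = U i j k h + W i j k h"
      unfolding U_def W_def dq_mult dq_shift distrib_left
      by (intro integral_add integrable_unit_cube continuous_intros continuous_on_shift C1)
    finally show ?thesis .
  qed
  have U: "U i j k = U j i k" for i j k
    unfolding U_def by (simp add: dq_commute[of _ i j] add.assoc add.commute[of "?e _ i"] fun_eq_iff)
  have W: "W i j k = W k j i" for i j k
    unfolding W_def by (simp add: dq_commute[of _ i k] fun_eq_iff)
  have "T 1 2 3 h - T 1 3 2 h + T 2 3 1 h - T 2 1 3 h + T 3 1 2 h - T 3 2 1 h = 0" for h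
    unfolding T U[of 1 2] U[of 1 3] U[of 2 3] W[of 1 2 3] W[of 1 3 2] W[of 2 1 3] by simp
  moreover have "((\<lambda>h. T 1 2 3 h - T 1 3 2 h + T 2 3 1 h - T 2 1 3 h + T 3 1 2 h - T 3 2 1 h) \<longlongrightarrow> 
     L 1 2 3 - L 1 3 2 + L 2 3 1 - L 2 1 3 + L 3 1 2 - L 3 2 1) (at_right 0)"
    by (intro tendsto_intros lim)
  ultimately show ?thesis by (simp add: tendsto_const_iff)
qed


section \<open>Fourier series on the torus\<close>

definition phase :: "int ^ 3 \<Rightarrow> R3 \<Rightarrow> real" where
  "phase k x = 2 * pi * (\<Sum>i\<in>UNIV. of_int (k $ i) * x $ i)"

definition fexp :: "int ^ 3 \<Rightarrow> R3 \<Rightarrow> complex" where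
  "fexp k x = cis (phase k x)"

lemma phase_simps:
  "phase k (x + y) = phase k x + phase k y" "phase (k + l) x = phase k x + phase l x"
  "phase (- k) x = - phase k x" "phase k (s *\<^sub>R x) = s * phase k x"
  "phase k (axis i 1) = 2 * pi * of_int (k $ i)" "phase 0 x = 0" "phase k 0 = 0"
  by (simp_all add: phase_def sum_3 algebra_simps axis_def)
     (use exhaust_3[of i] in auto)

lemma phase_has_derivative: "(phase k has_derivative phase k) (at x within A)"
proof (rule bounded_linear_imp_has_derivative)
  have "linear (phase k)" by (rule linearI) (simp_all add: phase_simps)
  then show "bounded_linear (phase k)" by (simp add: linear_conv_bounded_linear)
qed

lemma continuous_on_phase [continuous_intros]: "continuous_on A (phase k)"
  unfolding phase_def[abs_def] by (intro continuous_intros)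

lemma fexp_simps:
  "fexp k (x + y) = fexp k x * fexp k y" "fexp (k + l) x = fexp k x * fexp l x"
  "cnj (fexp k x) = fexp (- k) x" "norm (fexp k x) = 1" "fexp 0 x = 1"
  by (simp_all add: fexp_def phase_simps cis_mult cis_cnj)

lemma continuous_on_fexp [continuous_intros]: "continuous_on A (fexp k)"
  unfolding fexp_def[abs_def] by (intro continuous_intros)

lemma cis_2pi_int: "cis (2 * pi * of_int n) = 1"
  by (simp add: complex_eq_iff)

lemma periodic_fexp: "periodic (fexp k)"
  unfolding periodic_def fexp_simps(1) by (simp add: fexp_def phase_simps cis_2pi_int)

lemma content_unit_cube: "measure lborel unit_cube = 1"
  unfolding unit_cube_def
  by (subst content_cbox_cart) (auto simp: mem_box_cart intro!: exI[of _ "0::R3"] simp flip: ex_in_conv)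

lemma integral_fexp: "integral unit_cube (fexp k) = (if k = 0 then 1 else 0)"
proof (cases "k = 0")
  case True
  with content_unit_cube show ?thesis
    by (simp add: fexp_simps(5)[abs_def] unit_cube_def)
next
  case False
  then obtain i where i: "k $ i \<noteq> 0" by (auto simp: vec_eq_iff)
  \<comment> \<open>a shift by half a wavelength reverses the sign\<close>
  let ?a = "(1 / (2 * of_int (k $ i))) *\<^sub>R axis i 1 :: R3"
  have "fexp k ?a = -1" using i by (simp add: fexp_def phase_simps)
  then have "integral unit_cube (\<lambda>x. fexp k (x + ?a)) = - integral unit_cube (fexp k)"
    by (simp add: fexp_simps(1))
  moreover have "integral unit_cube (\<lambda>x. fexp k (x + ?a)) = integral unit_cube (fexp k)"
    by (intro integral_torus_shift periodic_fexp continuous_intros)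
  ultimately show ?thesis using False by (simp add: complex_eq_iff)
qed

subsection \<open>Trigonometric test functions\<close>

lemma partial_wave: 
  "partial i (\<lambda>x. c * cos (phase k x + b)) = (\<lambda>x. (c * (2 * pi * of_int (k $ i))) * cos (phase k x + (b + pi / 2)))"
proof
  fix x
  have "((\<lambda>x. c * cos (phase k x + b)) has_derivative (\<lambda>h. c * (- sin (phase k x + b) * phase k h))) (at x)"
    by (auto intro!: derivative_eq_intros phase_has_derivative)
  from partial_eq[OF this, of i]
  show "partial i (\<lambda>x. c * cos (phase k x + b)) x = (c * (2 * pi * of_int (k $ i))) * cos (phase k x + (b + pi / 2))"
    by (simp add: phase_simps cos_add[of "phase k x + b" "pi / 2"] add.assoc[symmetric])
qed

lemma funpow_partial_wave: 
  "(partial i ^^ n) (\<lambda>x. c * cos (phase k x + b)) = 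
     (\<lambda>x. (c * (2 * pi * of_int (k $ i)) ^ n) * cos (phase k x + (b + of_nat n * (pi / 2))))"
proof (induction n)
  case (Suc n)
  show ?case
    unfolding funpow.simps o_apply Suc.IH partial_wave by (simp add: algebra_simps add_divide_distrib)
qed simp

lemma mi_deriv_wave_ex: "\<exists>c' b'. mi_deriv \<alpha> (\<lambda>x. c * cos (phase k x + b)) = (\<lambda>x. c' * cos (phase k x + b'))"
  unfolding mi_deriv_def funpow_partial_wave by blast

lemma test_function_wave: "test_function (\<lambda>x. cos (phase k x + b))"
proof -
  have "mi_deriv \<alpha> (\<lambda>x. cos (phase k x + b)) differentiable (at x)" for \<alpha> x
  proof -
    obtain c' b' where e: "mi_deriv \<alpha> (\<lambda>x. cos (phase k x + b)) = (\<lambda>x. c' * cos (phase k x + b'))"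
      using mi_deriv_wave_ex[of \<alpha> 1 k b] by auto
    have "((\<lambda>x. c' * cos (phase k x + b')) has_derivative (\<lambda>h. c' * (- sin (phase k x + b') * phase k h))) (at x)"
      by (auto intro!: derivative_eq_intros phase_has_derivative)
    then show ?thesis unfolding e by (rule differentiableI)
  qed
  moreover have "periodic (\<lambda>x. cos (phase k x + b))"
    unfolding periodic_def phase_simps
  proof (intro allI)
    fix x and i :: 3
    show "cos (phase k x + 2 * pi * of_int (k $ i) + b) = cos (phase k x + b)"
      using cos_add[of "phase k x + b" "2 * pi * of_int (k $ i)"] by (simp add: add_ac)
  qed
  ultimately show ?thesis by (simp add: test_function_def)
qed

lemma mi_order_axis: "mi_order (axis i n) = n"
  using exhaust_3[of i] by (auto simp: mi_order_def sum_3 axis_def)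

lemma mi_deriv_axis: "mi_deriv (axis i n) = partial i ^^ n"
  using exhaust_3[of i] by (auto simp: mi_deriv_def fun_eq_iff axis_def)

subsection \<open>Fourier coefficients and Bessel's inequality\<close>

definition fcoef :: "scalar_field \<Rightarrow> int ^ 3 \<Rightarrow> complex" where
  "fcoef g k = (LINT x:unit_cube|lebesgue. of_real (g x) * fexp (- k) x)"

lemma unit_cube_lmeasurable: "unit_cube \<in> lmeasurable"
  by (simp add: unit_cube_def)

lemma unit_cube_sets [measurable]: "unit_cube \<in> sets lebesgue"
  using unit_cube_lmeasurable by auto

lemma set_integrable_continuous_cube:
  fixes F :: "R3 \<Rightarrow> 'a::euclidean_space"
  shows "continuous_on UNIV F \<Longrightarrow> set_integrable lebesgue unit_cube F"
  unfolding unit_cube_def by (rule absolutely_integrable_continuous) (erule continuous_on_subset, simp)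

lemma LINT_continuous_cube:
  fixes F :: "R3 \<Rightarrow> 'a::euclidean_space"
  shows "continuous_on UNIV F \<Longrightarrow> (LINT x:unit_cube|lebesgue. F x) = integral unit_cube F"
  by (intro set_lebesgue_integral_eq_integral set_integrable_continuous_cube)

lemma borel_measurable_lebesgue_continuous:
  fixes F :: "R3 \<Rightarrow> 'a::euclidean_space"
  shows "continuous_on UNIV F \<Longrightarrow> F \<in> borel_measurable lebesgue"
  by (intro measurable_completion) (simp add: borel_measurable_continuous_onI)

lemma L2_set_integrable:
  assumes "g \<in> L2_torus"
  shows "set_integrable lebesgue unit_cube g"
proof (rule set_integrable_bound)
  have "set_integrable lebesgue unit_cube (\<lambda>x. 1 :: real)"
    by (rule set_integrable_continuous_cube) simp
  then show "set_integrable lebesgue unit_cube (\<lambda>x. (g x)\<^sup>2 + 1)"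
    using assms by (intro set_integral_add) (auto simp: L2_torus_def)
  show "set_borel_measurable lebesgue unit_cube g"
  proof -
    have [measurable]: "g \<in> borel_measurable lebesgue" using assms by (simp add: L2_torus_def)
    show ?thesis unfolding set_borel_measurable_def by measurable
  qed
  have "\<bar>y\<bar> \<le> y\<^sup>2 + 1" for y :: real
    using sum_squares_ge_zero[of "\<bar>y\<bar> - 1" 0] zero_le_power2[of y] zero_le_power2[of "\<bar>y\<bar> - 1"]
    by (simp add: power2_eq_square algebra_simps)
  then show "AE x in lebesgue. x \<in> unit_cube \<longrightarrow> norm (g x) \<le> norm ((g x)\<^sup>2 + 1)"
    by (auto intro!: AE_I2 order_trans[of "\<bar>g _\<bar>"])
qed

lemma L2_set_integrable_mult:
  fixes F :: "R3 \<Rightarrow> complex"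
  assumes g: "g \<in> L2_torus" and F: "continuous_on UNIV F"
  shows "set_integrable lebesgue unit_cube (\<lambda>x. of_real (g x) * F x)"
proof -
  have "bounded (F ` unit_cube)"
    unfolding unit_cube_def
    by (intro compact_imp_bounded compact_continuous_image continuous_on_subset[OF F]) auto
  then obtain B where B: "\<And>x. x \<in> unit_cube \<Longrightarrow> norm (F x) \<le> B" "B > 0"
    by (auto simp: bounded_pos)
  show ?thesis
  proof (rule set_integrable_bound)
    show "set_integrable lebesgue unit_cube (\<lambda>x. B * g x)"
      using L2_set_integrable[OF g] by simp
    have [measurable]: "g \<in> borel_measurable lebesgue" "F \<in> borel_measurable lebesgue"
      using g borel_measurable_lebesgue_continuous[OF F] by (auto simp: L2_torus_def)
    show "set_borel_measurable lebesgue unit_cube (\<lambda>x. of_real (g x) * F x)"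
      unfolding set_borel_measurable_def by measurable
    show "AE x in lebesgue. x \<in> unit_cube \<longrightarrow> norm (complex_of_real (g x) * F x) \<le> norm (B * g x)"
      using B by (auto intro!: AE_I2 mult_mono simp: norm_mult abs_mult mult.commute[of "\<bar>g _\<bar>"])
  qed
qed

lemma continuous_in_L2:
  assumes "periodic f" "continuous_on UNIV f"
  shows "f \<in> L2_torus"
  unfolding L2_torus_def using assms borel_measurable_lebesgue_continuous[of f]
  by (auto intro!: set_integrable_continuous_cube continuous_intros)

lemma set_integral_sum:
  fixes f :: "'i \<Rightarrow> 'a \<Rightarrow> 'b::{banach, second_countable_topology}"
  assumes "\<And>i. i \<in> I \<Longrightarrow> set_integrable M A (f i)"
  shows "(LINT x:A|M. \<Sum>i\<in>I. f i x) = (\<Sum>i\<in>I. LINT x:A|M. f i x)"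
  using assms unfolding set_lebesgue_integral_def set_integrable_def scaleR_sum_right
  by (rule Bochner_Integration.integral_sum)

text \<open>
  The defect in the inequality is the squared distance from \<open>g\<close> to its Fourier polynomial over \<open>F\<close>.
\<close>

lemma bessel_inequality:
  assumes g: "g \<in> L2_torus" and F: "finite F"
  shows "(\<Sum>k\<in>F. (norm (fcoef g k))\<^sup>2) \<le> (L2_norm_torus g)\<^sup>2"
proof -
  let ?c = "fcoef g"
  \<comment> \<open>the conjugate of the Fourier polynomial of \<open>g\<close>\<close>
  define P where "P x = (\<Sum>k\<in>F. cnj (?c k) * fexp (- k) x)" for x
  have cP: "continuous_on UNIV P" unfolding P_def by (intro continuous_intros)
  have cP2: "continuous_on UNIV (\<lambda>x. (norm (P x))\<^sup>2)" by (intro continuous_intros cP)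
  let ?s = "\<Sum>k\<in>F. (norm (?c k))\<^sup>2"
  have gP: "(LINT x:unit_cube|lebesgue. of_real (g x) * P x) = of_real ?s"
  proof -
    have "(LINT x:unit_cube|lebesgue. of_real (g x) * P x) = 
       (LINT x:unit_cube|lebesgue. \<Sum>k\<in>F. cnj (?c k) * (of_real (g x) * fexp (- k) x))"
      by (simp add: P_def sum_distrib_left mult_ac)
    also have "\<dots> = (\<Sum>k\<in>F. LINT x:unit_cube|lebesgue. cnj (?c k) * (of_real (g x) * fexp (- k) x))"
      by (rule set_integral_sum) (intro set_integrable_mult_right impI L2_set_integrable_mult g continuous_intros)
    also have "\<dots> = (\<Sum>k\<in>F. cnj (?c k) * ?c k)"
      unfolding fcoef_def by simp
    also have "\<dots> = of_real ?s" 
      unfolding of_real_sum complex_norm_square by (simp add: mult.commute)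
    finally show ?thesis .
  qed
  have PP: "integral unit_cube (\<lambda>x. (norm (P x))\<^sup>2) = ?s"
  proof -
    have "complex_of_real (integral unit_cube (\<lambda>x. (norm (P x))\<^sup>2)) = integral unit_cube (\<lambda>x. of_real ((norm (P x))\<^sup>2))"
      using integral_linear[OF integrable_unit_cube[OF cP2] bounded_linear_of_real[where 'a = complex]] by (simp add: o_def)
    also have "\<dots> = integral unit_cube (\<lambda>x. \<Sum>k\<in>F. \<Sum>l\<in>F. (cnj (?c k) * ?c l) * fexp (l - k) x)"
    proof (rule integral_cong)
      fix x
      have "fexp (l - k) x = fexp (- k) x * fexp l x" for k l
        using fexp_simps(2)[of "-k" l x] by simp
      then show "complex_of_real ((norm (P x))\<^sup>2) = (\<Sum>k\<in>F. \<Sum>l\<in>F. (cnj (?c k) * ?c l) * fexp (l - k) x)"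
        unfolding complex_norm_square by (simp add: P_def sum_product fexp_simps mult_ac) (rule sum.swap)
    qed
    also have "\<dots> = (\<Sum>k\<in>F. \<Sum>l\<in>F. (cnj (?c k) * ?c l) * integral unit_cube (fexp (l - k)))"
      by (simp add: integral_sum F integrable_unit_cube continuous_intros)
    also have "\<dots> = (\<Sum>k\<in>F. cnj (?c k) * ?c k)"
      by (intro sum.cong refl) (simp add: integral_fexp F if_distrib[of "\<lambda>x. _ * x"] cong: if_cong)
    also have "\<dots> = of_real ?s" 
      unfolding of_real_sum complex_norm_square by (simp add: mult.commute)
    finally show ?thesis by (simp only: of_real_eq_iff)
  qed
  have i1: "set_integrable lebesgue unit_cube (\<lambda>x. (g x)\<^sup>2)" using g by (simp add: L2_torus_def)
  have i2': "set_integrable lebesgue unit_cube (\<lambda>x. of_real (g x) * P x)"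
    by (rule L2_set_integrable_mult[OF g cP])
  have i2: "set_integrable lebesgue unit_cube (\<lambda>x. g x * Re (P x))"
    using integrable_Re[OF i2'[unfolded set_integrable_def]] by (simp add: set_integrable_def)
  have i3: "set_integrable lebesgue unit_cube (\<lambda>x. (norm (P x))\<^sup>2)"
    by (rule set_integrable_continuous_cube[OF cP2])
  have Re: "(LINT x:unit_cube|lebesgue. g x * Re (P x)) = ?s"
    using integral_Re[OF i2'[unfolded set_integrable_def]] gP
    by (simp add: set_lebesgue_integral_def)
  have "0 \<le> (LINT x:unit_cube|lebesgue. (norm (of_real (g x) - cnj (P x)))\<^sup>2)"
    unfolding set_lebesgue_integral_def by (intro integral_nonneg_AE AE_I2) simp
  also have "\<dots> = (LINT x:unit_cube|lebesgue. (g x)\<^sup>2 - 2 * (g x * Re (P x)) + (norm (P x))\<^sup>2)"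
    by (intro arg_cong[where f = "set_lebesgue_integral lebesgue unit_cube"] ext) 
       (simp only: cmod_power2, simp add: power2_eq_square algebra_simps)
  also have "\<dots> = (LINT x:unit_cube|lebesgue. (g x)\<^sup>2) - 2 * ?s + ?s"
    using i1 i2 i3 by (simp add: set_integral_add set_integral_diff Re LINT_continuous_cube[OF cP2] PP)
  finally show ?thesis
    unfolding L2_norm_torus_def using set_lebesgue_integral_def 
    by (simp add: power2_eq_square[symmetric] set_lebesgue_integral_def)
qed


subsection \<open>Uniqueness of Fourier coefficients\<close>

text \<open>
  If \<open>h\<close> were positive at the strict maximum point of \<open>Q\<close>, then for large \<open>n\<close> the contribution of a
  small box around \<open>c\<close>, where \<open>Q\<close> exceeds some \<open>q'\<close>, would outweigh that of the part of the cube
  where \<open>h\<close> may be negative, on which \<open>Q\<close> stays below some \<open>q < q'\<close>.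
\<close>

lemma peak_argument:
  fixes h Q :: "R3 \<Rightarrow> real"
  assumes h: "continuous_on UNIV h" and Q: "continuous_on UNIV Q"
    and c: "c \<in> interior unit_cube" and Qc: "Q c = 1"
    and Q0: "\<And>x. x \<in> unit_cube \<Longrightarrow> 0 \<le> Q x" and Q1: "\<And>x. x \<in> unit_cube \<Longrightarrow> x \<noteq> c \<Longrightarrow> Q x < 1"
    and int: "\<And>n. integral unit_cube (\<lambda>x. h x * Q x ^ n) = 0"
  shows "h c \<le> 0"
proof (rule ccontr)
  assume "\<not> h c \<le> 0"
  define e where "e = h c / 2"
  have e: "0 < e" "e < h c" using \<open>\<not> h c \<le> 0\<close> by (auto simp: e_def)
  have "open (h -` {e<..})" using h by (simp add: open_vimage)
  moreover have "c \<in> h -` {e<..}" using e by simp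
  ultimately obtain d where d: "d > 0" "ball c d \<subseteq> h -` {e<..}" by (meson openE)
  have hd: "e \<le> h x" if "x \<in> ball c d" for x using d(2) that by force
  define K where "K = unit_cube - ball c d"
  have cK: "compact K" unfolding K_def unit_cube_def by (intro compact_diff compact_cbox) auto
  obtain q where q: "1 / 2 \<le> q" "q < 1" "\<And>x. x \<in> K \<Longrightarrow> Q x \<le> q"
  proof (cases "K = {}")
    case True
    then show ?thesis using that[of "1/2"] by auto
  next
    case False
    obtain y where y: "y \<in> K" "\<And>x. x \<in> K \<Longrightarrow> Q x \<le> Q y"
      using continuous_attains_sup[OF cK False continuous_on_subset[OF Q]] by auto
    have "y \<in> unit_cube" "y \<noteq> c" using y(1) d(1) by (auto simp: K_def)
    then have "Q y < 1" by (rule Q1)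
    then show ?thesis using that[of "max (1/2) (Q y)"] y(2) by fastforce
  qed
  define q' where "q' = (1 + q) / 2"
  have q': "q < q'" "q' < 1" "0 < q'" using q by (auto simp: q'_def)
  have "open (Q -` {q'<..} \<inter> interior unit_cube \<inter> ball c d)" using Q by (simp add: open_vimage open_Int)
  moreover have "c \<in> Q -` {q'<..} \<inter> interior unit_cube \<inter> ball c d" using q' Qc c d(1) by simp
  ultimately obtain a b where ab: "c \<in> box a b" "cbox a b \<subseteq> Q -` {q'<..} \<inter> interior unit_cube \<inter> ball c d"
    using open_contains_cbox by meson
  have sub: "cbox a b \<subseteq> unit_cube" using ab(2) interior_subset by blast
  define v where "v = measure lborel (cbox a b)"
  have v: "v > 0" unfolding v_def using ab(1) content_pos_lt_eq box_ne_empty(2) by (metis empty_iff)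
  obtain M where M: "\<And>x. x \<in> unit_cube \<Longrightarrow> \<bar>h x\<bar> \<le> M" "M > 0"
  proof -
    have "bounded (h ` unit_cube)"
      unfolding unit_cube_def
      by (intro compact_imp_bounded compact_continuous_image continuous_on_subset[OF h]) auto
    then show ?thesis using that by (auto simp: bounded_pos)
  qed
  have key: "e * q' ^ n * v \<le> M * q ^ n" for n
  proof -
    have i1: "(\<lambda>x. (if x \<in> cbox a b then e * q' ^ n else 0)) integrable_on unit_cube"
      using sub by (subst integrable_restrict_Int) (simp add: Int_absorb2 integrable_const)
    have I1: "integral unit_cube (\<lambda>x. (if x \<in> cbox a b then e * q' ^ n else 0)) = e * q' ^ n * v"
      using sub by (subst integral_restrict_Int) (simp add: Int_absorb2 v_def)
    have I2: "integral unit_cube (\<lambda>x. M * q ^ n) = M * q ^ n"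
      using content_unit_cube by (simp add: unit_cube_def)
    have "integral unit_cube (\<lambda>x. (if x \<in> cbox a b then e * q' ^ n else 0) - M * q ^ n)
        \<le> integral unit_cube (\<lambda>x. h x * Q x ^ n)"
    proof (rule integral_le)
      show "(\<lambda>x. (if x \<in> cbox a b then e * q' ^ n else 0) - M * q ^ n) integrable_on unit_cube"
        using i1 by (intro integrable_diff) (auto simp: unit_cube_def)
      show "(\<lambda>x. h x * Q x ^ n) integrable_on unit_cube"
        by (intro integrable_unit_cube continuous_intros h Q)
      fix x assume x: "x \<in> unit_cube"
      have p: "0 \<le> Q x ^ n" "0 \<le> M * q ^ n" using Q0[OF x] q M(2) by auto
      show "(if x \<in> cbox a b then e * q' ^ n else 0) - M * q ^ n \<le> h x * Q x ^ n"
      proof (cases "x \<in> ball c d")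
        case True
        have "0 \<le> h x * Q x ^ n" using hd[OF True] e p by auto
        moreover have "e * q' ^ n \<le> h x * Q x ^ n" if "x \<in> cbox a b"
          using that ab(2) q' e hd[OF True] by (intro mult_mono power_mono) auto
        ultimately show ?thesis using p by auto
      next
        case False
        then have "x \<in> K" "x \<notin> cbox a b" using x ab(2) by (auto simp: K_def)
        have "- (h x * Q x ^ n) \<le> \<bar>h x\<bar> * Q x ^ n"
          using p mult_right_mono[of "- h x" "\<bar>h x\<bar>" "Q x ^ n"] by simp
        also have "\<dots> \<le> M * q ^ n"
          using M(1)[OF x] M(2) q(3)[OF \<open>x \<in> K\<close>] Q0[OF x] by (intro mult_mono power_mono) auto
        finally show ?thesis using \<open>x \<notin> cbox a b\<close> by simp
      qed
    qed
    then show ?thesis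
      using i1 I1 I2 int content_unit_cube by (simp add: integral_diff unit_cube_def integrable_const)
  qed
  have "(\<lambda>n. (q / q') ^ n) \<longlonglongrightarrow> 0" by (rule LIMSEQ_realpow_zero) (use q q' in \<open>simp_all add: divide_less_eq\<close>)
  then have "(\<lambda>n. M * (q / q') ^ n) \<longlonglongrightarrow> M * 0" by (rule tendsto_mult[OF tendsto_const])
  moreover have "e * v \<le> M * (q / q') ^ n" for n
    using key[of n] q' by (simp add: power_divide pos_le_divide_eq mult_ac)
  ultimately have "e * v \<le> M * 0" by (intro LIMSEQ_le_const[of _ "M * 0" "e * v"]) auto
  then show False using e v by (simp add: mult_le_0_iff)
qed

lemma prod_UNIV_3: "prod f (UNIV :: 3 set) = f 1 * (f 2 * f 3)"
  unfolding UNIV_3 by (simp add: ac_simps)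

text \<open>
  Multiplying by \<open>(1 - cos (2 \<pi> x\<^sub>i)) / 2 = sin\<^sup>2 (\<pi> x\<^sub>i)\<close> only shifts frequencies by one unit, so the
  vanishing of all Fourier coefficients is preserved. The product over \<open>i\<close> peaks at the centre of
  the cube.
\<close>

lemma integral_peak_eq_0:
  fixes g :: "R3 \<Rightarrow> complex"
  assumes g: "continuous_on UNIV g" and z: "\<And>k. integral unit_cube (\<lambda>x. g x * fexp k x) = 0"
  shows "integral unit_cube (\<lambda>x. g x * of_real (\<Prod>i\<in>UNIV. (1 - cos (2 * pi * x $ i)) / 2) ^ n) = 0"
proof -
  let ?s = "\<lambda>i x. complex_of_real ((1 - cos (2 * pi * x $ i)) / 2)"
  define Z where "Z u \<longleftrightarrow> continuous_on UNIV u \<and> (\<forall>k. integral unit_cube (\<lambda>x. u x * fexp k x) = 0)" for u :: "R3 \<Rightarrow> complex"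
  have step: "Z (\<lambda>x. u x * ?s i x)" if u: "Z u" for u i
  proof -
    have c: "continuous_on UNIV u" and z: "\<And>k. integral unit_cube (\<lambda>x. u x * fexp k x) = 0"
      using u by (auto simp: Z_def)
    have s: "?s i x = 1 / 2 - (1 / 4) * fexp (axis i 1) x - (1 / 4) * fexp (- axis i 1) x" for x
    proof -
      have "phase (axis i 1) x = 2 * pi * x $ i"
        using exhaust_3[of i] by (auto simp: phase_def sum_3 axis_def)
      then show ?thesis by (simp add: fexp_def phase_simps complex_eq_iff)
    qed
    have "integral unit_cube (\<lambda>x. u x * ?s i x * fexp k x) = 0" for k
    proof -
      have eq: "u x * ?s i x * fexp k x = (1 / 2) * (u x * fexp k x) - (1 / 4) * (u x * fexp (axis i 1 + k) x)
          - (1 / 4) * (u x * fexp (- axis i 1 + k) x)" for x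
        unfolding s fexp_simps(2) by (simp add: algebra_simps)
      have ints: "(\<lambda>x. a * (u x * fexp l x)) integrable_on unit_cube" for a l
        by (intro integrable_unit_cube continuous_intros c)
      show ?thesis
        by (simp only: eq integral_diff integrable_diff ints integral_mult_right z) simp
    qed
    then show ?thesis using c unfolding Z_def by (auto intro!: continuous_intros)
  qed
  have Q: "Z (\<lambda>x. u x * of_real (\<Prod>i\<in>UNIV. (1 - cos (2 * pi * x $ i)) / 2))" if "Z u" for u
    using step[OF step[OF step[OF that, of 1], of 2], of 3] unfolding prod_UNIV_3 of_real_mult mult.assoc .
  have "Z (\<lambda>x. g x * of_real (\<Prod>i\<in>UNIV. (1 - cos (2 * pi * x $ i)) / 2) ^ n)"
  proof (induction n)
    case 0
    then show ?case using g z by (simp add: Z_def)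
  next
    case (Suc n)
    from Q[OF this] show ?case by (simp add: mult_ac)
  qed
  then have "integral unit_cube (\<lambda>x. g x * of_real (\<Prod>i\<in>UNIV. (1 - cos (2 * pi * x $ i)) / 2) ^ n * fexp 0 x) = 0"
    unfolding Z_def by blast
  then show ?thesis by (simp add: fexp_simps)
qed

lemma fourier_zero_centre:
  fixes g :: "R3 \<Rightarrow> complex"
  assumes g: "continuous_on UNIV g" and z: "\<And>k. integral unit_cube (\<lambda>x. g x * fexp k x) = 0"
  shows "g (\<chi> i. 1 / 2) = 0"
proof -
  let ?c = "(\<chi> i. 1 / 2) :: R3"
  let ?Q = "\<lambda>x::R3. \<Prod>i\<in>UNIV. (1 - cos (2 * pi * x $ i)) / 2"
  have f01: "0 \<le> (1 - cos y) / 2" "(1 - cos y) / 2 \<le> 1" for y :: real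
    using cos_le_one[of y] cos_ge_minus_one[of y] by simp_all
  have Q1: "?Q x < 1" if x: "x \<in> unit_cube" "x \<noteq> ?c" for x
  proof -
    obtain i where i: "x $ i \<noteq> 1 / 2" using x(2) by (auto simp: vec_eq_iff)
    have xi: "0 \<le> x $ i" "x $ i \<le> 1" using x(1) by (auto simp: unit_cube_def mem_box_cart)
    have "sin (pi * x $ i) < 1"
    proof -
      have "sin (pi * x $ i) \<noteq> 1"
      proof
        assume "sin (pi * x $ i) = 1"
        then have "cos (pi * x $ i) = 0" using sin_cos_squared_add[of "pi * x $ i"] by (simp del: sin_cos_squared_add)
        then have eq: "cos (pi * x $ i) = cos (pi / 2)" by simp
        have "0 \<le> pi * x $ i" "pi * x $ i \<le> pi"
          using xi mult_left_mono[of "x $ i" 1 pi] by simp_all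
        then have "pi * x $ i = pi / 2" by (rule cos_inj_pi[OF _ _ _ _ eq]) simp_all
        then show False using i by (simp add: field_simps)
      qed
      then show ?thesis using sin_le_one[of "pi * x $ i"] by linarith
    qed
    moreover have "0 \<le> sin (pi * x $ i)" using xi by (intro sin_ge_zero) (auto simp: mult_left_le)
    ultimately have "(sin (pi * x $ i))\<^sup>2 < 1" by (simp add: power_less_one_iff)
    then have "(1 - cos (2 * pi * x $ i)) / 2 < 1"
      using cos_double_sin[of "pi * x $ i"] by (simp add: mult.assoc)
    moreover have "?Q x = (1 - cos (2 * pi * x $ i)) / 2 * (\<Prod>j\<in>UNIV - {i}. (1 - cos (2 * pi * x $ j)) / 2)"
      by (rule prod.remove) auto
    moreover have "(\<Prod>j\<in>UNIV - {i}. (1 - cos (2 * pi * x $ j)) / 2) \<le> 1"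
      by (intro prod_le_1) (use f01 in auto)
    ultimately show ?thesis
      using mult_left_mono[of "\<Prod>j\<in>UNIV - {i}. (1 - cos (2 * pi * x $ j)) / 2" 1 "(1 - cos (2 * pi * x $ i)) / 2"] f01
      by (smt (verit) mult.right_neutral)
  qed
  have c: "?c \<in> interior unit_cube"
    unfolding unit_cube_def interior_cbox by (simp add: mem_box_cart)
  have cQ: "continuous_on UNIV ?Q" by (intro continuous_intros) auto
  have Q0: "0 \<le> ?Q x" for x by (intro prod_nonneg) (use f01 in auto)
  have Qc: "?Q ?c = 1" by simp
  have int: "integral unit_cube (\<lambda>x. T (g x) * ?Q x ^ n) = 0" if T: "bounded_linear T" "\<And>z r. T (z * of_real r) = T z * r" for T n
  proof -
    let ?F = "\<lambda>x. g x * of_real (?Q x) ^ n"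
    have "?F integrable_on unit_cube" by (intro integrable_unit_cube continuous_intros g) auto
    from integral_linear[OF this T(1)] integral_peak_eq_0[OF g z, of n] T(1)
    have "integral unit_cube (T \<circ> ?F) = 0" by (simp add: linear_simps)
    moreover have "T \<circ> ?F = (\<lambda>x. T (g x) * ?Q x ^ n)"
      using T(2)[of _ "?Q _ ^ n"] by (auto simp: fun_eq_iff simp del: of_real_prod)
    ultimately show ?thesis by simp
  qed
  have le: "T (g ?c) \<le> 0" if T: "bounded_linear T" "\<And>z r. T (z * of_real r) = T z * r" for T
    by (rule peak_argument[OF _ cQ c Qc Q0 Q1 int[OF T]])
       (auto intro: continuous_on_compose2[OF linear_continuous_on[OF T(1)] g])
  have "Re (g ?c) \<le> 0" "- Re (g ?c) \<le> 0" "Im (g ?c) \<le> 0" "- Im (g ?c) \<le> 0"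
    by (rule le; auto intro: bounded_linear_minus bounded_linear_Re bounded_linear_Im)+
  then show ?thesis by (simp add: complex_eq_iff)
qed

text \<open>
  A translation turns any point into the centre and multiplies the coefficients by phases.
\<close>

lemma fourier_unique:
  fixes g :: "R3 \<Rightarrow> complex"
  assumes per: "periodic g" and g: "continuous_on UNIV g" and z: "\<And>k. integral unit_cube (\<lambda>x. g x * fexp k x) = 0"
  shows "g y = 0"
proof -
  let ?a = "y - (\<chi> i. 1 / 2) :: R3"
  have "integral unit_cube (\<lambda>x. g (x + ?a) * fexp k x) = 0" for k
  proof -
    have eq: "g (x + ?a) * fexp k x = fexp k (- ?a) * (g (x + ?a) * fexp k (x + ?a))" for x
      using fexp_simps(1)[of k "x + ?a" "- ?a"] by simp
    have "integral unit_cube (\<lambda>x. g (x + ?a) * fexp k (x + ?a)) = integral unit_cube (\<lambda>x. g x * fexp k x)"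
      by (rule integral_torus_shift[of "\<lambda>x. g x * fexp k x"])
        (use per periodic_fexp[of k] g in \<open>auto simp: periodic_def intro!: continuous_intros\<close>)
    then show ?thesis by (simp only: eq integral_mult_right z mult_zero_right)
  qed
  from fourier_zero_centre[OF continuous_on_shift[OF g] this] show ?thesis by simp
qed


section \<open>The Sobolev embedding\<close>

subsection \<open>Weak derivatives and Fourier coefficients\<close>

text \<open>
  Weak derivatives are tested against real functions only. Two cosines a quarter period apart
  recover the complex coefficient up to a unimodular factor.
\<close>

lemma fcoef_wave:
  assumes g: "g \<in> L2_torus"
  shows "of_real (LINT x:unit_cube|lebesgue. g x * cos (phase k x + c)) 
     + \<i> * of_real (LINT x:unit_cube|lebesgue. g x * cos (phase k x + (c + pi / 2))) = cis (- c) * fcoef g k"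
proof -
  have int: "set_integrable lebesgue unit_cube (\<lambda>x. of_real (g x) * complex_of_real (cos (phase k x + d)))" for d
    by (intro L2_set_integrable_mult g continuous_intros)
  have "of_real (LINT x:unit_cube|lebesgue. g x * cos (phase k x + d)) = 
    (LINT x:unit_cube|lebesgue. of_real (g x) * complex_of_real (cos (phase k x + d)))" for d
    using set_integral_complex_of_real[of lebesgue unit_cube "\<lambda>x. g x * cos (phase k x + d)"] by simp
  then have "of_real (LINT x:unit_cube|lebesgue. g x * cos (phase k x + c)) 
     + \<i> * of_real (LINT x:unit_cube|lebesgue. g x * cos (phase k x + (c + pi / 2))) =
     (LINT x:unit_cube|lebesgue. of_real (g x) * complex_of_real (cos (phase k x + c)) + 
        \<i> * (of_real (g x) * complex_of_real (cos (phase k x + (c + pi / 2)))))"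
    using int by (simp add: set_integral_add del: of_real_mult)
  also have "\<dots> = (LINT x:unit_cube|lebesgue. cis (- c) * (of_real (g x) * fexp (- k) x))"
  proof (intro arg_cong[where f = "set_lebesgue_integral lebesgue unit_cube"] ext)
    fix x
    define y where "y = phase k x + c"
    have "cos (phase k x + (c + pi / 2)) = - sin y"
      using cos_add[of y "pi / 2"] by (simp add: y_def add.assoc)
    moreover have "cis (- c) * (of_real (g x) * fexp (- k) x) = of_real (g x) * cis (- y)"
      by (simp add: fexp_def phase_simps cis_mult y_def mult.left_commute[of "cis (- c)"] algebra_simps)
    ultimately show "of_real (g x) * complex_of_real (cos (phase k x + c)) + 
        \<i> * (of_real (g x) * complex_of_real (cos (phase k x + (c + pi / 2)))) = cis (- c) * (of_real (g x) * fexp (- k) x)"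
      unfolding y_def[symmetric] by (simp add: complex_eq_iff)
  qed
  also have "\<dots> = cis (- c) * fcoef g k" by (simp add: fcoef_def)
  finally show ?thesis .
qed

text \<open>
  Differentiating a wave multiplies its amplitude by \<open>2 \<pi> k\<^sub>i\<close> and shifts its phase by \<open>\<pi> / 2\<close>; the
  phase does not affect the modulus.
\<close>

lemma norm_fcoef_weak_deriv:
  assumes f: "f \<in> L2_torus" and w: "is_weak_deriv (axis i n) f g"
  shows "norm (fcoef g k) = \<bar>2 * pi * of_int (k $ i)\<bar> ^ n * norm (fcoef f k)"
proof -
  let ?J = "\<lambda>g b. LINT x:unit_cube|lebesgue. g x * cos (phase k x + b)"
  let ?a = "2 * pi * of_int (k $ i) :: real"
  have g: "g \<in> L2_torus" using w by (simp add: is_weak_deriv_def)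
  have rel: "?J g b = (-1) ^ n * ?a ^ n * ?J f (b + of_nat n * (pi / 2))" for b
  proof -
    have e: "f x * mi_deriv (axis i n) (\<lambda>x. cos (phase k x + b)) x 
        = ?a ^ n * (f x * cos (phase k x + (b + of_nat n * (pi / 2))))" for x
      using funpow_partial_wave[of n i 1 k b] by (simp add: mi_deriv_axis)
    have "(LINT x:unit_cube|lebesgue. f x * mi_deriv (axis i n) (\<lambda>x. cos (phase k x + b)) x) = (-1) ^ n * ?J g b"
      using w test_function_wave[of k b] unfolding is_weak_deriv_def mi_order_axis by blast
    then have "(-1) ^ n * ?J g b = ?a ^ n * ?J f (b + of_nat n * (pi / 2))"
      unfolding e by simp
    then have "(-1) ^ n * ((-1) ^ n * ?J g b) = (-1) ^ n * (?a ^ n * ?J f (b + of_nat n * (pi / 2)))" by simp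
    then show ?thesis by (simp add: mult.assoc[symmetric] power_mult_distrib[symmetric])
  qed
  have "fcoef g k = of_real (?J g 0) + \<i> * of_real (?J g (pi / 2))"
    using fcoef_wave[OF g, of k 0] by simp
  also have "\<dots> = of_real ((-1) ^ n * ?a ^ n) * 
     (of_real (?J f (of_nat n * (pi / 2))) + \<i> * of_real (?J f (of_nat n * (pi / 2) + pi / 2)))"
    unfolding rel[of 0] rel[of "pi / 2"] add.commute[of "pi / 2" "of_nat n * (pi / 2)"]
    by (simp add: algebra_simps)
  also have "\<dots> = of_real ((-1) ^ n * ?a ^ n) * (cis (- (of_nat n * (pi / 2))) * fcoef f k)"
    by (simp only: fcoef_wave[OF f])
  finally show ?thesis
    by (simp only: norm_mult norm_of_real norm_cis abs_mult power_abs) simp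
qed

subsection \<open>Lattice sums\<close>

text \<open>
  A quantity comparable to \<open>1 + |k|\<close>. As a maximum it makes two estimates immediate: its sixth power
  is one of \<open>1\<close> and \<open>|2 \<pi> k\<^sub>i|\<^sup>6\<close>, which derivatives of order \<open>0\<close> and \<open>3\<close> control, and it dominates
  each \<open>1 + |k\<^sub>i|\<close> separately, which factorises lattice sums.
\<close>

definition freq_weight :: "int ^ 3 \<Rightarrow> real" where
  "freq_weight k = max 1 (max \<bar>2 * pi * of_int (k $ 1)\<bar> (max \<bar>2 * pi * of_int (k $ 2)\<bar> \<bar>2 * pi * of_int (k $ 3)\<bar>))"

lemma freq_weight_ge: "1 \<le> freq_weight k" "\<bar>2 * pi * of_int (k $ i)\<bar> \<le> freq_weight k" "1 + \<bar>of_int (k $ i)\<bar> \<le> freq_weight k"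
proof -
  show 1: "1 \<le> freq_weight k" by (simp add: freq_weight_def)
  show 2: "\<bar>2 * pi * of_int (k $ i)\<bar> \<le> freq_weight k"
    using exhaust_3[of i] unfolding freq_weight_def by (auto simp only: le_max_iff_disj)
  show "1 + \<bar>of_int (k $ i)\<bar> \<le> freq_weight k"
  proof (cases "k $ i = 0")
    case False
    then have "1 \<le> \<bar>k $ i\<bar>" by linarith
    then have "(1::real) \<le> \<bar>of_int (k $ i)\<bar>" by (metis of_int_1_le_iff of_int_abs)
    moreover have "2 * \<bar>of_int (k $ i)\<bar> \<le> 2 * pi * \<bar>of_int (k $ i) :: real\<bar>"
      using pi_ge_two by (intro mult_right_mono) auto
    ultimately show ?thesis using 2 by (simp add: abs_mult)
  qed (use 1 in simp)
qed

lemma int_sum_bound: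
  "\<exists>C\<ge>0. \<forall>A. finite A \<longrightarrow> (\<Sum>n\<in>A. (1 + \<bar>real_of_int n\<bar>) powr (- 4 / 3)) \<le> C"
proof -
  define s where "s j = (1 + real j) powr (- 4 / 3)" for j
  have "summable (\<lambda>j. real (Suc j) powr (- 4 / 3))"
    by (subst summable_Suc_iff) (simp add: summable_real_powr_iff)
  then have sum: "summable s" by (simp add: s_def[abs_def])
  have half: "(\<Sum>n\<in>B. (1 + \<bar>real_of_int n\<bar>) powr (- 4 / 3)) \<le> suminf s" 
    if "finite B" "inj_on (\<lambda>n. nat \<bar>n\<bar>) B" for B
  proof -
    have "(\<Sum>n\<in>B. (1 + \<bar>real_of_int n\<bar>) powr (- 4 / 3)) = (\<Sum>n\<in>B. s (nat \<bar>n\<bar>))"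
      by (simp add: s_def)
    also have "\<dots> = sum s ((\<lambda>n. nat \<bar>n\<bar>) ` B)"
      using that(2) by (simp add: sum.reindex)
    also have "\<dots> \<le> suminf s"
      using that(1) by (intro sum_le_suminf sum) (auto simp: s_def)
    finally show ?thesis .
  qed
  have "(\<Sum>n\<in>A. (1 + \<bar>real_of_int n\<bar>) powr (- 4 / 3)) \<le> suminf s + suminf s" if A: "finite A" for A
  proof -
    have "(\<Sum>n\<in>A. (1 + \<bar>real_of_int n\<bar>) powr (- 4 / 3)) = 
      (\<Sum>n\<in>A \<inter> {0..}. (1 + \<bar>real_of_int n\<bar>) powr (- 4 / 3)) + (\<Sum>n\<in>A \<inter> - {0..}. (1 + \<bar>real_of_int n\<bar>) powr (- 4 / 3))"
      using A by (subst sum.union_disjoint[symmetric]) (auto intro!: sum.cong)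
    also have "\<dots> \<le> suminf s + suminf s"
      using A by (intro add_mono half) (auto simp: inj_on_def)
    finally show ?thesis .
  qed
  moreover have "0 \<le> suminf s" using sum by (intro suminf_nonneg) (auto simp: s_def)
  ultimately show ?thesis by (intro exI[of _ "suminf s + suminf s"]) auto
qed

text \<open>
  The fourth inverse power splits into three factors, one for each coordinate, with exponent
  \<open>-4/3 < -1\<close>. This is where dimension three enters.
\<close>

lemma lattice_sum_bound: "\<exists>L\<ge>0. \<forall>F. finite F \<longrightarrow> (\<Sum>k\<in>F. ((1 / freq_weight k)\<^sup>2)\<^sup>2) \<le> L"
proof -
  define t where "t n = (1 + \<bar>real_of_int n\<bar>) powr (- 4 / 3)" for n
  obtain C where C: "C \<ge> 0" "\<And>A. finite A \<Longrightarrow> sum t A \<le> C"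
    using int_sum_bound unfolding t_def by blast
  have le: "((1 / freq_weight k)\<^sup>2)\<^sup>2 \<le> t (k $ 1) * (t (k $ 2) * t (k $ 3))" for k
  proof -
    have f: "freq_weight k powr (- 4 / 3) \<le> t (k $ i)" for i
      unfolding t_def using freq_weight_ge(3)[of k i] by (intro powr_mono2') auto
    have "((1 / freq_weight k)\<^sup>2)\<^sup>2 = freq_weight k powr (- 4)"
      using freq_weight_ge(1)[of k] by (simp add: powr_minus divide_inverse flip: powr_numeral) (simp add: power_mult[symmetric] power_inverse)
    also have "\<dots> = freq_weight k powr (- 4 / 3) * (freq_weight k powr (- 4 / 3) * freq_weight k powr (- 4 / 3))"
      by (simp flip: powr_add)
    also have "\<dots> \<le> t (k $ 1) * (t (k $ 2) * t (k $ 3))"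
      by (intro mult_mono f) (auto simp: t_def)
    finally show ?thesis .
  qed
  have "(\<Sum>k\<in>F. ((1 / freq_weight k)\<^sup>2)\<^sup>2) \<le> C * (C * C)" if F: "finite F" for F
  proof -
    define A where "A = (\<lambda>k. k $ 1) ` F \<union> (\<lambda>k. k $ 2) ` F \<union> (\<lambda>k. k $ 3) ` F"
    have A: "finite A" using F by (simp add: A_def)
    have inj: "inj_on (\<lambda>k. (k $ 1, k $ 2, k $ 3)) F" by (auto simp: inj_on_def vec_eq_iff forall_3)
    have "(\<Sum>k\<in>F. ((1 / freq_weight k)\<^sup>2)\<^sup>2) \<le> (\<Sum>k\<in>F. t (k $ 1) * (t (k $ 2) * t (k $ 3)))"
      by (intro sum_mono le)
    also have "\<dots> = (\<Sum>(a, b, c)\<in>(\<lambda>k. (k $ 1, k $ 2, k $ 3)) ` F. t a * (t b * t c))"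
      using inj by (simp add: sum.reindex)
    also have "\<dots> \<le> (\<Sum>(a, b, c)\<in>A \<times> A \<times> A. t a * (t b * t c))"
      using A by (intro sum_mono2) (auto simp: A_def t_def)
    also have "\<dots> = sum t A * (sum t A * sum t A)"
      by (simp add: sum.cartesian_product[symmetric] sum_distrib_left sum_distrib_right mult_ac)
    also have "\<dots> \<le> C * (C * C)"
      by (intro mult_mono C A mult_nonneg_nonneg sum_nonneg) (auto simp: t_def C)
    finally show ?thesis .
  qed
  then show ?thesis using C(1) by (intro exI[of _ "C * (C * C)"]) auto
qed

definition scalar_sobolev_norm :: "nat \<Rightarrow> scalar_field \<Rightarrow> real" where
  "scalar_sobolev_norm m f = sqrt (\<Sum>\<alpha> | mi_order \<alpha> \<le> m. (L2_norm_torus (weak_deriv \<alpha> f))\<^sup>2)"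

lemma finite_mi_order: "finite {\<alpha>. mi_order \<alpha> \<le> m}"
proof (rule finite_subset)
  show "{\<alpha>. mi_order \<alpha> \<le> m} \<subseteq> (\<lambda>(a, b, c). vector [a, b, c]) ` ({..m} \<times> {..m} \<times> {..m})"
  proof
    fix \<alpha> assume "\<alpha> \<in> {\<alpha>. mi_order \<alpha> \<le> m}"
    then show "\<alpha> \<in> (\<lambda>(a, b, c). vector [a, b, c]) ` ({..m} \<times> {..m} \<times> {..m})"
      by (intro image_eqI[of _ _ "(\<alpha> $ 1, \<alpha> $ 2, \<alpha> $ 3)"]) (auto simp: mi_order_def sum_3 vec_eq_iff forall_3)
  qed
qed auto

text \<open>
  Write \<open>w\<close> for the weight and \<open>c\<close> for the coefficients. Bessel's inequality for the weak
  derivatives of order \<open>0\<close> and \<open>3\<close> along the axes bounds \<open>\<Sum> w\<^sup>6 |c|\<^sup>2\<close>, and the Cauchy-Schwarz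
  inequality for \<open>w |c| = w\<^sup>-\<^sup>2 \<cdot> w\<^sup>3 |c|\<close> leaves the convergent lattice sum of \<open>w\<^sup>-\<^sup>4\<close>.
\<close>

lemma sobolev_coefficients_summable:
  "\<exists>C\<ge>0. \<forall>m f F. 3 \<le> m \<longrightarrow> f \<in> sobolev m \<longrightarrow> finite F \<longrightarrow> 
     (\<Sum>k\<in>F. freq_weight k * norm (fcoef f k)) \<le> C * scalar_sobolev_norm m f"
proof -
  obtain L where L: "L \<ge> 0" "\<And>F. finite F \<Longrightarrow> (\<Sum>k\<in>F. ((1 / freq_weight k)\<^sup>2)\<^sup>2) \<le> L"
    using lattice_sum_bound by blast
  have "(\<Sum>k\<in>F. freq_weight k * norm (fcoef f k)) \<le> sqrt L * scalar_sobolev_norm m f"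
    if m: "3 \<le> m" and f: "f \<in> sobolev m" and F: "finite F" for m f F
  proof -
    have fL2: "f \<in> L2_torus" using f by (intro continuous_in_L2) (auto simp: sobolev_def)
    define N2 where "N2 = (\<Sum>\<alpha> | mi_order \<alpha> \<le> m. (L2_norm_torus (weak_deriv \<alpha> f))\<^sup>2)"
    have N2: "0 \<le> N2" by (simp add: N2_def sum_nonneg)
    define g where "g i n = weak_deriv (axis i n) f" for i n
    have g: "is_weak_deriv (axis i n) f (g i n)" if "n \<le> 3" for i n
      using f that m unfolding g_def weak_deriv_def sobolev_def
      by (intro someI_ex[of "is_weak_deriv (axis i n) f"]) (auto simp: mi_order_axis)
    have bes: "(\<Sum>k\<in>F. (\<bar>2 * pi * of_int (k $ i)\<bar> ^ n * norm (fcoef f k))\<^sup>2) \<le> (L2_norm_torus (g i n))\<^sup>2" 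
      if "n \<le> 3" for i :: 3 and n
      using bessel_inequality[OF _ F, of "g i n"] g[OF that, of i] 
      unfolding norm_fcoef_weak_deriv[OF fL2 g[OF that]] by (simp add: is_weak_deriv_def)
    have "(\<Sum>k\<in>F. (freq_weight k ^ 3 * norm (fcoef f k))\<^sup>2) \<le> 
      (\<Sum>k\<in>F. (\<bar>2 * pi * of_int (k $ 1)\<bar> ^ 0 * norm (fcoef f k))\<^sup>2 + (\<Sum>i\<in>UNIV. (\<bar>2 * pi * of_int (k $ i)\<bar> ^ 3 * norm (fcoef f k))\<^sup>2))"
    proof (rule sum_mono)
      fix k :: "int ^ 3"
      let ?a = "\<lambda>i. \<bar>2 * pi * of_int (k $ i)\<bar> :: real"
      have "freq_weight k \<in> {1, ?a 1, ?a 2, ?a 3}" unfolding freq_weight_def max_def by auto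
      then show "(freq_weight k ^ 3 * norm (fcoef f k))\<^sup>2 \<le> (?a 1 ^ 0 * norm (fcoef f k))\<^sup>2 + (\<Sum>i\<in>UNIV. (?a i ^ 3 * norm (fcoef f k))\<^sup>2)"
        unfolding sum_3 by (elim insertE emptyE) (simp_all add: add_increasing add_increasing2)
    qed
    also have "\<dots> \<le> (L2_norm_torus (g 1 0))\<^sup>2 + (\<Sum>i\<in>UNIV. (L2_norm_torus (g i 3))\<^sup>2)"
      unfolding sum.distrib by (subst sum.swap) (intro add_mono sum_mono bes; simp)
    also have "\<dots> = (\<Sum>\<alpha>\<in>{0, axis 1 3, axis 2 3, axis 3 3}. (L2_norm_torus (weak_deriv \<alpha> f))\<^sup>2)"
    proof -
      have "axis 1 3 \<noteq> (0::multi_index)" "axis 2 3 \<noteq> (0::multi_index)" "axis 3 3 \<noteq> (0::multi_index)"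
        "axis 1 3 \<noteq> (axis 2 3 ::multi_index)" "axis 1 3 \<noteq> (axis 3 3 ::multi_index)" "axis 2 3 \<noteq> (axis 3 3 ::multi_index)"
        by (auto simp: axis_eq_axis axis_eq_0_iff)
      moreover have z: "axis 1 0 = (0::multi_index)" by (simp add: axis_eq_0_iff)
      ultimately show ?thesis by (simp add: g_def sum_3 z)
    qed
    also have "\<dots> \<le> N2"
      unfolding N2_def using m by (intro sum_mono2 finite_mi_order) (auto simp: mi_order_axis, simp add: mi_order_def)
    finally have A: "(\<Sum>k\<in>F. (freq_weight k ^ 3 * norm (fcoef f k))\<^sup>2) \<le> N2" .
    have e: "freq_weight k * norm (fcoef f k) = (1 / freq_weight k)\<^sup>2 * (freq_weight k ^ 3 * norm (fcoef f k))" for k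
      using freq_weight_ge(1)[of k] by (simp add: power2_eq_square power3_eq_cube)
    have "(\<Sum>k\<in>F. freq_weight k * norm (fcoef f k))\<^sup>2 \<le>
      (\<Sum>k\<in>F. ((1 / freq_weight k)\<^sup>2)\<^sup>2) * (\<Sum>k\<in>F. (freq_weight k ^ 3 * norm (fcoef f k))\<^sup>2)"
      unfolding e by (rule Cauchy_Schwarz_ineq_sum)
    also have "\<dots> \<le> L * N2"
      by (intro mult_mono L F A sum_nonneg) (auto simp: L)
    finally have "(\<Sum>k\<in>F. freq_weight k * norm (fcoef f k)) \<le> sqrt (L * N2)" by (rule real_le_rsqrt)
    then show ?thesis by (simp add: scalar_sobolev_norm_def N2_def real_sqrt_mult)
  qed
  then show ?thesis using L(1) by (intro exI[of _ "sqrt L"]) auto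
qed

subsection \<open>Summing the Fourier series\<close>

lemma fcoef_eq_integral: "continuous_on UNIV f \<Longrightarrow> fcoef f k = integral unit_cube (\<lambda>x. of_real (f x) * fexp (- k) x)"
  unfolding fcoef_def by (rule LINT_continuous_cube) (intro continuous_intros)

text \<open>
  The series converges uniformly to a continuous function with the same Fourier coefficients as \<open>f\<close>.
\<close>

lemma fourier_inversion:
  assumes f: "periodic f" "continuous_on UNIV f" and b: "bij (b :: nat \<Rightarrow> int ^ 3)"
    and s: "summable (\<lambda>n. norm (fcoef f (b n)))"
  shows "(\<lambda>n. Re (fcoef f (b n) * fexp (b n) x)) sums f x"
proof -
  let ?u = "\<lambda>n x. fcoef f (b n) * fexp (b n) x"
  define G where "G x = (\<Sum>n. ?u n x)" for x
  have ul: "uniform_limit UNIV (\<lambda>N x. \<Sum>n<N. ?u n x) G sequentially"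
    unfolding G_def by (rule Weierstrass_m_test[OF _ s]) (simp add: norm_mult fexp_simps)
  have G: "continuous_on UNIV G"
    by (rule uniform_limit_theorem[OF _ ul]) (auto intro!: always_eventually continuous_intros)
  have perG: "periodic G" using periodic_fexp by (simp add: periodic_def G_def)
  have Gl: "integral unit_cube (\<lambda>x. G x * fexp (- l) x) = fcoef f l" for l
  proof -
    obtain j where j: "b j = l" using b by (metis bij_pointE)
    have ints: "(\<lambda>x. c * fexp k x) integrable_on unit_cube" for c k
      by (intro integrable_unit_cube continuous_intros)
    have part: "integral unit_cube (\<lambda>x. (\<Sum>n<N. ?u n x) * fexp (- l) x) = (\<Sum>n<N. if n = j then fcoef f l else 0)" for N
    proof -
      have e: "(\<Sum>n<N. ?u n x) * fexp (- l) x = (\<Sum>n<N. fcoef f (b n) * fexp (b n + - l) x)" for x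
        unfolding sum_distrib_right fexp_simps(2) mult.assoc ..
      have "integral unit_cube (\<lambda>x. (\<Sum>n<N. ?u n x) * fexp (- l) x) = (\<Sum>n<N. fcoef f (b n) * integral unit_cube (fexp (b n + - l)))"
        unfolding e by (subst integral_sum) (use ints in auto)
      also have "\<dots> = (\<Sum>n<N. if n = j then fcoef f l else 0)"
        using j b by (intro sum.cong refl) (auto simp: integral_fexp bij_def inj_def)
      finally show ?thesis .
    qed
    have "uniform_limit unit_cube (\<lambda>N x. (\<Sum>n<N. ?u n x) * fexp (- l) x) (\<lambda>x. G x * fexp (- l) x) sequentially"
      by (intro uniform_lim_mult uniform_limit_on_subset[OF ul] uniform_limit_const bounded_image_unit_cube G continuous_intros)
         auto
    then have "(\<lambda>N. integral unit_cube (\<lambda>x. (\<Sum>n<N. ?u n x) * fexp (- l) x)) \<longlonglongrightarrow> integral unit_cube (\<lambda>x. G x * fexp (- l) x)"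
      by (rule integral_tendsto_uniform) (auto intro!: continuous_intros)
    moreover have "(\<lambda>N. integral unit_cube (\<lambda>x. (\<Sum>n<N. ?u n x) * fexp (- l) x)) \<longlonglongrightarrow> fcoef f l"
      unfolding part by (rule tendsto_eventually) (auto simp: eventually_at_top_dense intro!: exI[of _ j])
    ultimately show ?thesis by (rule LIMSEQ_unique)
  qed
  have cf: "continuous_on UNIV (\<lambda>x. complex_of_real (f x))" by (intro continuous_intros f)
  have "of_real (f x) - G x = 0"
  proof (rule fourier_unique[of "\<lambda>x. of_real (f x) - G x"])
    show "periodic (\<lambda>x. complex_of_real (f x) - G x)" using f(1) perG by (simp add: periodic_def)
    show "continuous_on UNIV (\<lambda>x. complex_of_real (f x) - G x)" by (intro continuous_intros cf G)
    fix k
    have "integral unit_cube (\<lambda>x. (of_real (f x) - G x) * fexp k x) = 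
       integral unit_cube (\<lambda>x. of_real (f x) * fexp k x) - integral unit_cube (\<lambda>x. G x * fexp k x)"
      unfolding left_diff_distrib
      by (intro integral_diff integrable_unit_cube continuous_intros cf G)
    then show "integral unit_cube (\<lambda>x. (of_real (f x) - G x) * fexp k x) = 0"
      using Gl[of "- k"] fcoef_eq_integral[OF f(2), of "- k"] by simp
  qed
  moreover have "(\<lambda>n. ?u n x) sums G x"
    unfolding sums_def by (rule tendsto_uniform_limitI[OF ul]) simp
  ultimately have "(\<lambda>n. ?u n x) sums of_real (f x)" by simp
  from sums_Re[OF this] show ?thesis by simp
qed

text \<open>
  The weight dominates the factors that a first derivative brings out, so the series may be
  differentiated term by term. The common bound is what makes the embedding quantitative.
\<close>

lemma C1_torus_of_fourier:
  assumes f: "periodic f" "continuous_on UNIV f" and b: "bij (b :: nat \<Rightarrow> int ^ 3)"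
    and s: "summable (\<lambda>n. freq_weight (b n) * norm (fcoef f (b n)))"
  shows "C1_torus f" "\<bar>f x\<bar> \<le> (\<Sum>n. freq_weight (b n) * norm (fcoef f (b n)))"
    "\<bar>partial i f x\<bar> \<le> (\<Sum>n. freq_weight (b n) * norm (fcoef f (b n)))"
proof -
  define c where "c n = fcoef f (b n)" for n
  let ?M = "\<lambda>n. freq_weight (b n) * norm (c n)"
  have M: "summable ?M" using s by (simp add: c_def)
  define u where "u n x = Re (c n * fexp (b n) x)" for n x
  define v where "v i n x = - (2 * pi * of_int (b n $ i)) * Im (c n * fexp (b n) x)" for i n x
  have cM: "norm (c n) \<le> ?M n" for n
    using freq_weight_ge(1)[of "b n"] mult_right_mono[of 1 "freq_weight (b n)" "norm (c n)"] by simp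
  have uM: "norm (u n x) \<le> ?M n" for n x
    using order_trans[OF abs_Re_le_cmod cM[of n]] abs_Re_le_cmod[of "c n * fexp (b n) x"] cM[of n]
    by (simp add: u_def norm_mult fexp_simps)
  have vM: "norm (v i n x) \<le> ?M n" for i n x
    unfolding v_def using freq_weight_ge(2)[of "b n" i] abs_Im_le_cmod[of "c n * fexp (b n) x"] freq_weight_ge(1)[of "b n"]
    by (simp only: real_norm_def abs_mult[of "- _"] abs_minus_cancel)
       (intro mult_mono; simp add: norm_mult fexp_simps)
  have cs: "summable (\<lambda>n. norm (fcoef f (b n)))"
    by (rule summable_comparison_test[OF _ M]) (use cM in \<open>auto simp: c_def\<close>)
  have uf: "(\<lambda>n. u n x) sums f x" for x
    unfolding u_def c_def by (rule fourier_inversion[OF f b cs])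
  define g where "g i x = (\<Sum>n. v i n x)" for i x
  have ul: "uniform_limit UNIV (\<lambda>N x. \<Sum>n<N. v i n x) (g i) sequentially" for i
    unfolding g_def by (rule Weierstrass_m_test[OF vM M])
  have gc: "continuous_on UNIV (g i)" for i
    by (rule uniform_limit_theorem[OF _ ul]) (auto intro!: always_eventually continuous_intros simp: v_def[abs_def])
  have du: "(u n has_derivative (\<lambda>h. \<Sum>i\<in>UNIV. h $ i * v i n x)) (at x)" for n x
  proof -
    have u: "u n = (\<lambda>x. Re (c n) * cos (phase (b n) x) - Im (c n) * sin (phase (b n) x))"
      by (simp add: u_def fexp_def fun_eq_iff)
    have "(\<Sum>i\<in>UNIV. h $ i * v i n x) = Re (c n) * (- sin (phase (b n) x) * phase (b n) h) - Im (c n) * (cos (phase (b n) x) * phase (b n) h)" for h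
      by (simp add: v_def fexp_def sum_3 phase_def[of _ h] algebra_simps)
    then show ?thesis unfolding u
      by (auto intro!: derivative_eq_intros phase_has_derivative simp: fun_eq_iff)
  qed
  obtain F where F: "\<And>x. (\<lambda>n. u n x) sums F x" "\<And>x. (F has_derivative (\<lambda>h. \<Sum>i\<in>UNIV. h $ i * g i x)) (at x)"
  proof -
    have "\<exists>F. \<forall>x\<in>UNIV. (\<lambda>n. u n x) sums F x \<and> (F has_derivative (\<lambda>h. \<Sum>i\<in>UNIV. h $ i * g i x)) (at x within UNIV)"
    proof (rule has_derivative_series[where f' = "\<lambda>n x h. \<Sum>i\<in>UNIV. h $ i * v i n x"])
      show "convex (UNIV :: R3 set)" by simp
      show "(u n has_derivative (\<lambda>h. \<Sum>i\<in>UNIV. h $ i * v i n x)) (at x within UNIV)" for n x using du by simp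
      show "(\<lambda>n. u n 0) sums f 0" by (rule uf)
      fix e :: real assume e: "e > 0"
      have "\<forall>\<^sub>F N in sequentially. \<forall>i\<in>UNIV. \<forall>x\<in>UNIV. dist (\<Sum>n<N. v i n x) (g i x) < e / 3"
        using uniform_limitD[OF ul, of "e / 3"] e by (intro eventually_ball_finite) auto
      then show "\<forall>\<^sub>F N in sequentially. \<forall>x\<in>UNIV. \<forall>h. 
         norm ((\<Sum>n<N. \<Sum>i\<in>UNIV. h $ i * v i n x) - (\<Sum>i\<in>UNIV. h $ i * g i x)) \<le> e * norm h"
      proof eventually_elim
        case (elim N)
        show ?case
        proof (intro ballI allI)
          fix x h :: R3
          have "(\<Sum>n<N. \<Sum>i\<in>UNIV. h $ i * v i n x) - (\<Sum>i\<in>UNIV. h $ i * g i x) = (\<Sum>i\<in>UNIV. h $ i * ((\<Sum>n<N. v i n x) - g i x))"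
            by (subst sum.swap) (simp add: sum_distrib_left sum_subtractf right_diff_distrib)
          also have "norm \<dots> \<le> (\<Sum>i\<in>(UNIV::3 set). norm h * (e / 3))"
          proof (rule sum_norm_le)
            fix i :: 3
            have "\<bar>(\<Sum>n<N. v i n x) - g i x\<bar> \<le> e / 3" using elim by (simp add: dist_real_def less_imp_le)
            then show "norm (h $ i * ((\<Sum>n<N. v i n x) - g i x)) \<le> norm h * (e / 3)"
              unfolding real_norm_def abs_mult by (intro mult_mono component_le_norm_cart) auto
          qed
          finally show "norm ((\<Sum>n<N. \<Sum>i\<in>UNIV. h $ i * v i n x) - (\<Sum>i\<in>UNIV. h $ i * g i x)) \<le> e * norm h"
            by (simp add: mult.commute)
        qed
      qed
    qed simp
    then show ?thesis using that by auto
  qed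
  have "F = f" using F(1) uf sums_unique2 by blast
  then have df: "(f has_derivative (\<lambda>h. \<Sum>i\<in>UNIV. h $ i * g i x)) (at x)" for x using F(2) by simp
  have pf: "partial i f = g i" for i
  proof
    fix x
    show "partial i f x = g i x" using partial_eq[OF df, of i x] exhaust_3[of i] by (auto simp: sum_3 axis_def)
  qed
  show "C1_torus f" unfolding C1_torus_def pf using f df gc by (auto simp: differentiable_def)
  have bound: "\<bar>\<Sum>n. w n\<bar> \<le> suminf ?M" if "\<And>n. norm (w n) \<le> ?M n" for w :: "nat \<Rightarrow> real"
    using summable_comparison_test[OF _ M, of w] norm_suminf_le[OF that M] that by auto
  show "\<bar>f x\<bar> \<le> (\<Sum>n. freq_weight (b n) * norm (fcoef f (b n)))"
    using bound[of "\<lambda>n. u n x", OF uM] sums_unique[OF uf[of x]] by (simp add: c_def)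
  show "\<bar>partial i f x\<bar> \<le> (\<Sum>n. freq_weight (b n) * norm (fcoef f (b n)))"
    unfolding pf g_def using bound[of "\<lambda>n. v i n x", OF vM] by (simp add: c_def)
qed

lemma ex_enumeration: "\<exists>b :: nat \<Rightarrow> int ^ 3. bij b"
proof -
  have "inj (\<lambda>n. vec n :: int ^ 3)" by (auto simp: inj_def vec_eq_iff)
  then have "infinite (UNIV :: (int ^ 3) set)"
    using finite_imageD[of "\<lambda>n. vec n :: int ^ 3" UNIV] infinite_UNIV_int by (metis finite_subset top_greatest)
  then show ?thesis using bij_betw_from_nat_into[of "UNIV :: (int ^ 3) set"] by auto
qed

theorem sobolev_embedding:
  "\<exists>C\<ge>0. \<forall>m f. 3 \<le> m \<longrightarrow> f \<in> sobolev m \<longrightarrow> C1_torus f \<and> 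
     (\<forall>x. \<bar>f x\<bar> \<le> C * scalar_sobolev_norm m f) \<and> (\<forall>i x. \<bar>partial i f x\<bar> \<le> C * scalar_sobolev_norm m f)"
proof -
  obtain C where C: "C \<ge> 0" "\<And>m f F. 3 \<le> m \<Longrightarrow> f \<in> sobolev m \<Longrightarrow> finite F \<Longrightarrow> 
     (\<Sum>k\<in>F. freq_weight k * norm (fcoef f k)) \<le> C * scalar_sobolev_norm m f"
    using sobolev_coefficients_summable by blast
  obtain b :: "nat \<Rightarrow> int ^ 3" where b: "bij b" using ex_enumeration by blast
  have "C1_torus f \<and> (\<forall>x. \<bar>f x\<bar> \<le> C * scalar_sobolev_norm m f) \<and> (\<forall>i x. \<bar>partial i f x\<bar> \<le> C * scalar_sobolev_norm m f)"
    if m: "3 \<le> m" and f: "f \<in> sobolev m" for m f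
  proof -
    let ?a = "\<lambda>n. freq_weight (b n) * norm (fcoef f (b n))"
    have pf: "periodic f" "continuous_on UNIV f" using f by (auto simp: sobolev_def)
    have nn: "0 \<le> ?a n" for n using freq_weight_ge(1)[of "b n"] by simp
    have part: "(\<Sum>n<N. ?a n) \<le> C * scalar_sobolev_norm m f" for N
    proof -
      have "(\<Sum>n<N. ?a n) = (\<Sum>k\<in>b ` {..<N}. freq_weight k * norm (fcoef f k))"
        using b by (subst sum.reindex) (auto simp: bij_def intro: inj_on_subset)
      then show ?thesis using C(2)[OF m f, of "b ` {..<N}"] by simp
    qed
    have s: "summable ?a" by (rule summableI_nonneg_bounded[OF nn part])
    have le: "suminf ?a \<le> C * scalar_sobolev_norm m f" by (rule suminf_le_const[OF s part])
    show ?thesis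
      using C1_torus_of_fourier[OF pf b s] le by (meson order_trans)
  qed
  then show ?thesis using C(1) by blast
qed


section \<open>Eigenvalues of symmetric matrices\<close>

definition char_roots :: "real ^ 3 ^ 3 \<Rightarrow> real ^ 3 \<Rightarrow> bool" where
  "char_roots A l \<longleftrightarrow> l $ 1 \<ge> l $ 2 \<and> l $ 2 \<ge> l $ 3 \<and>
     (\<forall>z. det (mat z - A) = (z - l $ 1) * (z - l $ 2) * (z - l $ 3))"

lemma char_roots_unique:
  assumes "char_roots A l" "char_roots A l'"
  shows "l = l'"
proof -
  have eq: "(z - l $ 1) * (z - l $ 2) * (z - l $ 3) = (z - l' $ 1) * (z - l' $ 2) * (z - l' $ 3)" for z
    using assms by (simp add: char_roots_def)
  have o: "l $ 1 \<ge> l $ 2" "l $ 2 \<ge> l $ 3" "l' $ 1 \<ge> l' $ 2" "l' $ 2 \<ge> l' $ 3"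
    using assms by (auto simp: char_roots_def)
  have "l $ 1 = l' $ 1"
    using eq[of "l $ 1"] eq[of "l' $ 1"] o by auto
  moreover have "l $ 3 = l' $ 3"
    using eq[of "l $ 3"] eq[of "l' $ 3"] o by auto
  moreover have "l $ 1 + l $ 2 + l $ 3 = l' $ 1 + l' $ 2 + l' $ 3"
    using eq[of 0] eq[of 1] eq[of "-1"] by (simp add: algebra_simps)
  ultimately show ?thesis by (simp add: vec_eq_iff forall_3)
qed

lemma char_poly_eq:
  fixes A :: "'a::comm_ring_1 ^ 3 ^ 3"
  shows "det (mat z - A) = z ^ 3 - (A$1$1 + A$2$2 + A$3$3) * z ^ 2 
    + (A$1$1 * A$2$2 + A$1$1 * A$3$3 + A$2$2 * A$3$3 - A$1$2 * A$2$1 - A$1$3 * A$3$1 - A$2$3 * A$3$2) * z - det A"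
  by (simp add: det_3 mat_def algebra_simps power2_eq_square power3_eq_cube)

lemma char_roots_coeffs:
  assumes "char_roots A l"
  shows "l$1 + l$2 + l$3 = A$1$1 + A$2$2 + A$3$3"
    "l$1 * l$2 + l$1 * l$3 + l$2 * l$3 = 
       A$1$1 * A$2$2 + A$1$1 * A$3$3 + A$2$2 * A$3$3 - A$1$2 * A$2$1 - A$1$3 * A$3$1 - A$2$3 * A$3$2"
    "l$1 * l$2 * l$3 = det A"
proof -
  have eq: "(z - l $ 1) * (z - l $ 2) * (z - l $ 3) = z ^ 3 - (A$1$1 + A$2$2 + A$3$3) * z ^ 2 
    + (A$1$1 * A$2$2 + A$1$1 * A$3$3 + A$2$2 * A$3$3 - A$1$2 * A$2$1 - A$1$3 * A$3$1 - A$2$3 * A$3$2) * z - det A" for z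
    using assms by (simp add: char_roots_def char_poly_eq)
  show "l$1 * l$2 * l$3 = det A" using eq[of 0] by simp
  then show "l$1 + l$2 + l$3 = A$1$1 + A$2$2 + A$3$3"
    "l$1 * l$2 + l$1 * l$3 + l$2 * l$3 = 
       A$1$1 * A$2$2 + A$1$1 * A$3$3 + A$2$2 * A$3$3 - A$1$2 * A$2$1 - A$1$3 * A$3$1 - A$2$3 * A$3$2"
    using eq[of 1] eq[of "-1"] by (simp_all add: algebra_simps)
qed

text \<open>
  The Hermitian form \<open>w\<^sup>* A w = z |w|\<^sup>2\<close> equals its own conjugate.
\<close>

lemma hermitian_eigenvalue_real:
  fixes A :: "real ^ 'n ^ 'n" and w :: "complex ^ 'n"
  assumes sym: "transpose A = A" and w: "w \<noteq> 0"
    and ev: "\<And>i. (\<Sum>j\<in>UNIV. complex_of_real (A $ i $ j) * w $ j) = z * w $ i"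
  shows "Im z = 0"
proof -
  define q where "q = (\<Sum>i\<in>UNIV. \<Sum>j\<in>UNIV. cnj (w $ i) * (complex_of_real (A $ i $ j) * w $ j))"
  have Aij: "A $ i $ j = A $ j $ i" for i j
    using arg_cong[OF sym, of "\<lambda>M. M $ j $ i"] by (simp add: transpose_def)
  have "q = (\<Sum>i\<in>UNIV. cnj (w $ i) * (z * w $ i))"
    unfolding q_def by (simp add: sum_distrib_left[symmetric] ev)
  also have "\<dots> = z * complex_of_real (\<Sum>i\<in>UNIV. (norm (w $ i))\<^sup>2)"
    unfolding of_real_sum complex_norm_square sum_distrib_left by (intro sum.cong refl) (simp add: mult_ac)
  finally have q: "q = z * complex_of_real (\<Sum>i\<in>UNIV. (norm (w $ i))\<^sup>2)" .
  have "cnj q = (\<Sum>i\<in>UNIV. \<Sum>j\<in>UNIV. w $ i * (complex_of_real (A $ i $ j) * cnj (w $ j)))"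
    unfolding q_def by simp
  also have "\<dots> = q"
  proof -
    have "w $ i * (complex_of_real (A $ i $ j) * cnj (w $ j)) = cnj (w $ j) * (complex_of_real (A $ j $ i) * w $ i)" for i j
      by (simp add: Aij[of j i])
    then show ?thesis unfolding q_def by (subst sum.swap) (simp only:)
  qed
  finally have "Im q = 0" by (simp add: complex_eq_iff)
  moreover have "(\<Sum>i\<in>UNIV. (norm (w $ i))\<^sup>2) \<noteq> 0"
    using w by (auto simp: sum_nonneg_eq_0_iff vec_eq_iff)
  ultimately show ?thesis using q by simp
qed

lemma cubic_has_real_root: "\<exists>r::real. r ^ 3 - a * r ^ 2 + b * r - c = 0"
proof -
  define f where "f r = r ^ 3 - a * r ^ 2 + b * r - c" for r
  \<comment> \<open>from here on the cubic term outweighs the others\<close>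
  define B where "B = 1 + \<bar>a\<bar> + \<bar>b\<bar> + \<bar>c\<bar>"
  have B: "B \<ge> 1" by (simp add: B_def)
  have B2: "1 \<le> B\<^sup>2" "B \<le> B\<^sup>2"
    using B mult_left_mono[OF B, of B] one_le_power[OF B, of 2] by (simp_all add: power2_eq_square)
  have "\<bar>a * B ^ 2\<bar> + \<bar>b * B\<bar> + \<bar>c\<bar> = \<bar>a\<bar> * B\<^sup>2 + \<bar>b\<bar> * B + \<bar>c\<bar> * 1"
    using B by (simp add: abs_mult)
  also have "\<dots> \<le> \<bar>a\<bar> * B\<^sup>2 + \<bar>b\<bar> * B\<^sup>2 + \<bar>c\<bar> * B\<^sup>2"
    by (intro add_mono mult_left_mono B2) auto
  also have "\<dots> = (\<bar>a\<bar> + \<bar>b\<bar> + \<bar>c\<bar>) * B\<^sup>2" by (simp add: distrib_right)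
  also have "\<dots> \<le> B * B\<^sup>2" by (rule mult_right_mono) (simp_all add: B_def)
  finally have bd: "\<bar>a * B ^ 2\<bar> + \<bar>b * B\<bar> + \<bar>c\<bar> \<le> B ^ 3" by (simp add: power3_eq_cube power2_eq_square)
  have "f (- B) = - (B ^ 3) - a * B\<^sup>2 - b * B - c" "f B = B ^ 3 - a * B\<^sup>2 + b * B - c"
    by (simp_all add: f_def power3_eq_cube)
  with bd have "f (- B) \<le> 0" "0 \<le> f B" by linarith+
  moreover have "\<And>x. isCont f x" unfolding f_def by (intro continuous_intros)
  ultimately obtain x where "f x = 0" using IVT[of f "-B" 0 B] B by auto
  then show ?thesis unfolding f_def by blast
qed

lemma singular_imp_kernel:
  fixes B :: "'a::field ^ 'n ^ 'n"
  assumes "det B = 0"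
  obtains w where "w \<noteq> 0" "B *v w = 0"
proof -
  have "\<not> invertible B" using assms invertible_det_nz by blast
  then show ?thesis
    using that unfolding invertible_left_inverse matrix_left_invertible_ker by blast
qed

lemma ex_sorted_roots:
  fixes p q r :: real
  shows "\<exists>l::real^3. l $ 1 \<ge> l $ 2 \<and> l $ 2 \<ge> l $ 3 \<and> (\<forall>z. (z - p) * (z - q) * (z - r) = (z - l $ 1) * (z - l $ 2) * (z - l $ 3))"
proof -
  have *: "\<exists>l::real^3. l $ 1 \<ge> l $ 2 \<and> l $ 2 \<ge> l $ 3 \<and> (\<forall>z. (z - p) * (z - q) * (z - r) = (z - l $ 1) * (z - l $ 2) * (z - l $ 3))"
    if "a \<ge> b" "b \<ge> c" "\<And>z. (z - p) * (z - q) * (z - r) = (z - a) * (z - b) * (z - c)" for a b c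
    using that by (intro exI[of _ "vector [a, b, c]"]) simp
  consider "p \<ge> q" "q \<ge> r" | "p \<ge> r" "r \<ge> q" | "q \<ge> p" "p \<ge> r" | "q \<ge> r" "r \<ge> p" | "r \<ge> p" "p \<ge> q" | "r \<ge> q" "q \<ge> p"
    by linarith
  then show ?thesis by cases (erule (1) *, simp add: mult_ac)+
qed

text \<open>
  A real cubic has a real root; were the remaining quadratic factor without real roots, its
  complex root would be a non-real eigenvalue of a symmetric matrix.
\<close>

lemma ex_char_roots:
  assumes sym: "transpose A = A"
  shows "\<exists>l. char_roots A l"
proof -
  define a where "a = A$1$1 + A$2$2 + A$3$3"
  define b where "b = A$1$1 * A$2$2 + A$1$1 * A$3$3 + A$2$2 * A$3$3 - A$1$2 * A$2$1 - A$1$3 * A$3$1 - A$2$3 * A$3$2"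
  have P: "det (mat z - A) = z ^ 3 - a * z ^ 2 + b * z - det A" for z
    unfolding a_def b_def by (rule char_poly_eq)
  obtain r where r: "r ^ 3 - a * r ^ 2 + b * r - det A = 0" using cubic_has_real_root by blast
  \<comment> \<open>division by \<open>z - r\<close> leaves \<open>z\<^sup>2 + \<beta> z + \<gamma>\<close>\<close>
  define \<beta> where "\<beta> = r - a"
  define \<gamma> where "\<gamma> = r\<^sup>2 - a * r + b"
  have detA: "det A = r * \<gamma>" using r by (simp add: \<gamma>_def algebra_simps power3_eq_cube power2_eq_square)
  have disc: "\<beta>\<^sup>2 - 4 * \<gamma> \<ge> 0"
  proof (rule ccontr)
    assume neg: "\<not> ?thesis"
    define y where "y = sqrt (4 * \<gamma> - \<beta>\<^sup>2)"
    have y: "y > 0" "y\<^sup>2 = 4 * \<gamma> - \<beta>\<^sup>2" using neg by (auto simp: y_def)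
    define z where "z = Complex (- \<beta> / 2) (y / 2)"
    have quad: "z\<^sup>2 + complex_of_real \<beta> * z + complex_of_real \<gamma> = 0"
      using y(2) by (simp add: z_def complex_eq_iff power2_eq_square field_simps)
    define AC where "AC = (\<chi> i j. complex_of_real (A $ i $ j))"
    have "det AC = complex_of_real (det A)" by (simp add: det_3 AC_def)
    then have "det (mat z - AC) = z ^ 3 - of_real a * z ^ 2 + of_real b * z - of_real (det A)"
      unfolding char_poly_eq by (simp add: AC_def a_def b_def)
    also have "\<dots> = (z - of_real r) * (z\<^sup>2 + of_real \<beta> * z + of_real \<gamma>)"
      unfolding detA by (simp add: \<beta>_def \<gamma>_def algebra_simps power3_eq_cube power2_eq_square)
    also have "\<dots> = 0" by (simp add: quad)
    finally obtain w where w: "w \<noteq> 0" "(mat z - AC) *v w = 0" by (rule singular_imp_kernel)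
    then have "AC *v w = mat z *v w" by (simp add: matrix_vector_mult_diff_rdistrib)
    then have "(\<Sum>j\<in>UNIV. complex_of_real (A $ i $ j) * w $ j) = z * w $ i" for i
      by (simp add: vec_eq_iff matrix_vector_mult_def AC_def mat_def if_distrib[of "\<lambda>x. x * _"] cong: if_cong)
    then have "Im z = 0" by (rule hermitian_eigenvalue_real[OF sym w(1)])
    then show False using y(1) by (simp add: z_def)
  qed
  define s where "s = sqrt (\<beta>\<^sup>2 - 4 * \<gamma>)"
  have s: "s\<^sup>2 = \<beta>\<^sup>2 - 4 * \<gamma>" using disc by (simp add: s_def)
  have "det (mat z - A) = (z - r) * (z - (- \<beta> + s) / 2) * (z - (- \<beta> - s) / 2)" for z
  proof -
    have "(z - (- \<beta> + s) / 2) * (z - (- \<beta> - s) / 2) = z\<^sup>2 + \<beta> * z + \<gamma>"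
      using s by (simp add: field_simps power2_eq_square)
    moreover have "det (mat z - A) = (z - r) * (z\<^sup>2 + \<beta> * z + \<gamma>)"
      unfolding P detA by (simp add: \<beta>_def \<gamma>_def algebra_simps power3_eq_cube power2_eq_square)
    ultimately show ?thesis by (simp only: mult.assoc)
  qed
  then show ?thesis
    using ex_sorted_roots[of r "(- \<beta> + s) / 2" "(- \<beta> - s) / 2"] by (simp add: char_roots_def)
qed

lemma char_roots_eigenvalues:
  assumes "transpose A = A"
  shows "char_roots A (eigenvalues A)"
proof -
  have "\<exists>!l. char_roots A l" using ex_char_roots[OF assms] char_roots_unique by blast
  then have "char_roots A (THE l. char_roots A l)" by (rule theI')
  moreover have "eigenvalues A = (THE l. char_roots A l)" unfolding eigenvalues_def char_roots_def ..
  ultimately show ?thesis by simp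
qed

lemma norm_matrix_sq: "(norm (A :: real^'n^'m))\<^sup>2 = (\<Sum>i\<in>UNIV. \<Sum>j\<in>UNIV. (A $ i $ j)\<^sup>2)"
  by (simp add: norm_vec_def L2_set_def sum_nonneg)

lemma norm_eigenvalues:
  assumes "transpose A = A"
  shows "norm (eigenvalues A) = norm A"
proof -
  note c = char_roots_coeffs[OF char_roots_eigenvalues[OF assms]]
  let ?l = "eigenvalues A"
  have Aij: "A $ i $ j = A $ j $ i" for i j
    using arg_cong[OF assms, of "\<lambda>M. M $ j $ i"] by (simp add: transpose_def)
  have "(norm ?l)\<^sup>2 = (?l$1 + ?l$2 + ?l$3)\<^sup>2 - 2 * (?l$1 * ?l$2 + ?l$1 * ?l$3 + ?l$2 * ?l$3)"
    by (simp add: norm_vec_def L2_set_def sum_nonneg sum_3 power2_eq_square algebra_simps)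
  also have "\<dots> = (norm A)\<^sup>2"
    unfolding c norm_matrix_sq sum_3 Aij[of 2 1] Aij[of 3 1] Aij[of 3 2]
    by (simp add: power2_eq_square algebra_simps)
  finally show ?thesis by simp
qed

text \<open>
  The ordered roots are singled out by closed conditions and are bounded by the norm of the matrix,
  so on bounded sets of matrices they form a closed graph in a compact set.
\<close>

lemma continuous_on_eigenvalues: "continuous_on {A. transpose A = A} eigenvalues"
proof (rule continuous_on_sequentiallyI)
  fix X :: "nat \<Rightarrow> real^3^3" and A
  assume X: "\<forall>n. X n \<in> {A. transpose A = A}" and A: "A \<in> {A. transpose A = A}" and lim: "X \<longlonglongrightarrow> A"
  obtain R where R: "\<And>n. norm (X n) \<le> R"
    using convergent_imp_bounded[OF lim] by (auto simp: bounded_iff)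
  have "norm A \<le> R" by (rule Lim_bounded[OF tendsto_norm[OF lim]]) (use R in auto)
  define S where "S = {A::real^3^3. transpose A = A \<and> norm A \<le> R}"
  have graph: "(\<lambda>A. (A, eigenvalues A)) ` S = 
     {(A, l). transpose A = A \<and> norm A \<le> R \<and> l $ 1 \<ge> l $ 2 \<and> l $ 2 \<ge> l $ 3 \<and>
       (\<forall>z. det (mat z - A) = (z - l $ 1) * (z - l $ 2) * (z - l $ 3))}"
    (is "_ = ?G")
  proof -
    have "l = eigenvalues A \<longleftrightarrow> char_roots A l" if "transpose A = A" for A l
      using char_roots_eigenvalues[OF that] char_roots_unique by blast
    then have "(A, l) \<in> (\<lambda>A. (A, eigenvalues A)) ` S \<longleftrightarrow> (A, l) \<in> ?G" for A l
      by (force simp: S_def image_iff char_roots_def)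
    then show ?thesis by auto
  qed
  have "closed ((\<lambda>A. (A, eigenvalues A)) ` S)"
    unfolding graph char_poly_eq det_3 transpose_def split_beta
    by (intro closed_Collect_conj closed_Collect_all closed_Collect_eq closed_Collect_le continuous_intros)
  then have "continuous_on S eigenvalues"
    by (intro continuous_from_closed_graph[where T = "cball 0 R"]) (auto simp: S_def norm_eigenvalues)
  then show "(\<lambda>n. eigenvalues (X n)) \<longlonglongrightarrow> eigenvalues A"
    by (rule continuous_on_tendsto_compose[OF _ lim]) (use X A R \<open>norm A \<le> R\<close> in \<open>auto simp: S_def\<close>)
qed

text \<open>
  Write \<open>a \<ge> b \<ge> c\<close> for the eigenvalues. With \<open>c = -(a + b)\<close> one has \<open>-det A = b a (a + b)\<close> and
  \<open>|A|\<^sup>2 = 2 (a\<^sup>2 + a b + b\<^sup>2)\<close>, and \<open>0 \<le> b \<le> a\<close> gives both bounds. The second part is the first for \<open>-A\<close>.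
\<close>

lemma middle_eigenvalue_bounds:
  fixes A :: "real^3^3"
  assumes sym: "transpose A = A" and tr: "A$1$1 + A$2$2 + A$3$3 = 0"
  shows "0 \<le> eigenvalues A $ 2 \<Longrightarrow> 
      eigenvalues A $ 2 * (norm A)\<^sup>2 \<le> - 4 * det A \<and> - 2 * det A \<le> eigenvalues A $ 2 * (norm A)\<^sup>2"
    and "eigenvalues A $ 2 \<le> 0 \<Longrightarrow> 
      - (eigenvalues A $ 2) * (norm A)\<^sup>2 \<le> 4 * det A \<and> 2 * det A \<le> - (eigenvalues A $ 2) * (norm A)\<^sup>2"
proof -
  note cr = char_roots_eigenvalues[OF sym]
  define a b c where abc: "a = eigenvalues A $ 1" "b = eigenvalues A $ 2" "c = eigenvalues A $ 3"
  have o: "a \<ge> b" "b \<ge> c" using cr by (auto simp: char_roots_def abc)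
  have s: "a + b + c = 0" and d: "det A = a * b * c"
    using char_roots_coeffs[OF cr] tr by (auto simp: abc)
  have n: "(norm A)\<^sup>2 = a\<^sup>2 + b\<^sup>2 + c\<^sup>2"
    unfolding norm_eigenvalues[OF sym, symmetric] abc
    by (simp add: norm_vec_def L2_set_def sum_nonneg sum_3)
  {
    assume "0 \<le> eigenvalues A $ 2"
    then have b: "0 \<le> b" by (simp add: abc)
    have c: "c = - (a + b)" using s by simp
    have "- 4 * det A - b * (norm A)\<^sup>2 = b * (2 * ((a - b) * (a + b)) + 2 * (a * b))"
      unfolding n d c by (simp add: power2_eq_square algebra_simps)
    moreover have "b * (norm A)\<^sup>2 - (- 2 * det A) = b * (2 * b\<^sup>2)"
      unfolding n d c by (simp add: power2_eq_square algebra_simps)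
    moreover have "0 \<le> (a - b) * (a + b)" "0 \<le> a * b"
      by (rule mult_nonneg_nonneg; use o b in linarith)+
    then have "0 \<le> b * (2 * ((a - b) * (a + b)) + 2 * (a * b))" "0 \<le> b * (2 * b\<^sup>2)"
      by (rule_tac [!] mult_nonneg_nonneg) (use b in auto)
    ultimately show "eigenvalues A $ 2 * (norm A)\<^sup>2 \<le> - 4 * det A \<and> - 2 * det A \<le> eigenvalues A $ 2 * (norm A)\<^sup>2"
      unfolding abc(2)[symmetric] by linarith
  next
    assume "eigenvalues A $ 2 \<le> 0"
    then have b: "0 \<le> - b" by (simp add: abc)
    have a: "a = - (b + c)" using s by simp
    have "4 * det A - (- b * (norm A)\<^sup>2) = (- b) * (2 * ((b - c) * (- b - c)) + 2 * ((- c) * (- b)))"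
      unfolding n d a by (simp add: power2_eq_square algebra_simps)
    moreover have "- b * (norm A)\<^sup>2 - 2 * det A = (- b) * (2 * b\<^sup>2)"
      unfolding n d a by (simp add: power2_eq_square algebra_simps)
    moreover have "0 \<le> (b - c) * (- b - c)" "0 \<le> (- c) * (- b)"
      by (rule mult_nonneg_nonneg; use o b in linarith)+
    then have "0 \<le> (- b) * (2 * ((b - c) * (- b - c)) + 2 * ((- c) * (- b)))" "0 \<le> (- b) * (2 * b\<^sup>2)"
      by (rule_tac [!] mult_nonneg_nonneg) (use b in auto)
    ultimately show "- (eigenvalues A $ 2) * (norm A)\<^sup>2 \<le> 4 * det A \<and> 2 * det A \<le> - (eigenvalues A $ 2) * (norm A)\<^sup>2"
      unfolding abc(2)[symmetric] by linarith
  }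
qed


section \<open>The enstrophy balance\<close>

lemma divergence_shift:
  assumes "\<And>j. C1_torus (\<lambda>x. u x $ j)" 
  shows "divergence (\<lambda>y. u (y + a)) x = divergence u (x + a)"
  unfolding divergence_def using partial_shift[OF C1_torusD(2)[OF assms]] by simp

lemma divergence_dq:
  assumes u: "\<And>j. C1_torus (\<lambda>x. u x $ j)"
  shows "divergence (\<lambda>y. \<chi> j. dq h k (\<lambda>z. u z $ j) y) x = dq h k (divergence u) x"
  unfolding divergence_def vec_lambda_beta C1_torus_dq(2)[OF u]
  by (simp add: dq_def sum_subtractf sum_divide_distrib diff_divide_distrib)

text \<open>
  The discrete product rule splits the difference quotient of \<open>(u \<cdot> \<nabla>) u\<close> into a transport term, in
  which a shifted copy of \<open>u\<close> acts on the difference quotient of \<open>u\<close>, and the cubic term on the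
  right. The transport term integrates to \<open>0\<close> against the difference quotient itself, being half the
  derivative of its square along a divergence free field; the pressure term does because the
  difference quotient is divergence free.
\<close>

lemma integral_dq_momentum:
  fixes u :: vector_field
  assumes u: "\<And>j. C1_torus (\<lambda>x. u x $ j)" and div: "\<And>x. divergence u x = 0" and p: "C1_torus p"
  shows "integral unit_cube (\<lambda>x. \<Sum>k\<in>UNIV. \<Sum>j\<in>UNIV. 
            dq h k (\<lambda>y. u y $ j) x * dq h k (\<lambda>y. (- advect u u y - grad p y) $ j) x)
   = - integral unit_cube (\<lambda>x. \<Sum>k\<in>UNIV. \<Sum>j\<in>UNIV. \<Sum>i\<in>UNIV.
            dq h k (\<lambda>y. u y $ j) x * dq h k (\<lambda>y. u y $ i) x * partial i (\<lambda>y. u y $ j) x)"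
proof -
  define D where "D k j = dq h k (\<lambda>y. u y $ j)" for k j
  let ?e = "\<lambda>k. h *\<^sub>R axis k 1 :: R3"
  have D: "C1_torus (D k j)" for k j unfolding D_def by (rule C1_torus_dq(1)[OF u])
  have DD: "partial i (\<lambda>x. D k j x * D k j x) x = 2 * (partial i (D k j) x * D k j x)" for i k j x
    using C1_torus_mult(2)[OF D D, of i k j k j x] by simp
  define A where "A k j x = (\<Sum>i\<in>UNIV. u (x + ?e k) $ i * partial i (\<lambda>x. D k j x * D k j x) x)" for k j x
  define B where "B k j i x = D k j x * D k i x * partial i (\<lambda>y. u y $ j) x" for k j i x
  define C where "C k x = (\<Sum>j\<in>UNIV. (\<chi> j. D k j x) $ j * partial j (dq h k p) x)" for k x
  have A0: "integral unit_cube (A k j) = 0" for k j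
    unfolding A_def
    by (rule integral_transport_eq_0[of "\<lambda>x. u (x + ?e k)"])
       (simp_all add: divergence_shift[OF u] div C1_torus_mult(1)[OF D D] C1_torus_shift[OF u])
  have C0: "integral unit_cube (C k) = 0" for k
    unfolding C_def
  proof (rule integral_transport_eq_0[of "\<lambda>x. \<chi> j. D k j x"])
    show "C1_torus (\<lambda>x. (\<chi> j. D k j x) $ j)" for j using D by simp
    show "divergence (\<lambda>x. \<chi> j. D k j x) x = 0" for x
      unfolding D_def divergence_dq[OF u] by (simp add: div dq_def)
  qed (rule C1_torus_dq(1)[OF p])
  have cA: "continuous_on UNIV (A k j)" for k j
    unfolding A_def
    by (intro continuous_intros continuous_on_shift[of "\<lambda>x. u x $ _"] C1_torusD(4)[OF u] C1_torusD(3)[OF C1_torus_mult(1)[OF D D]])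
  have cB: "continuous_on UNIV (B k j i)" for k j i
    unfolding B_def by (intro continuous_intros C1_torusD(3)[OF u] C1_torusD(4)[OF D])
  have cC: "continuous_on UNIV (C k)" for k
    unfolding C_def by (simp, intro continuous_intros C1_torusD(4)[OF D] C1_torusD(3)[OF C1_torus_dq(1)[OF p]])
  have w: "dq h k (\<lambda>y. (- advect u u y - grad p y) $ j) x =
    - (\<Sum>i\<in>UNIV. u (x + ?e k) $ i * partial i (D k j) x) - (\<Sum>i\<in>UNIV. D k i x * partial i (\<lambda>y. u y $ j) x) - partial j (dq h k p) x" for k j x
  proof -
    have "dq h k (\<lambda>y. (- advect u u y - grad p y) $ j) x = 
       - (\<Sum>i\<in>UNIV. dq h k (\<lambda>y. partial i (\<lambda>z. u z $ j) y * u y $ i) x) - dq h k (partial j p) x"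
      by (simp add: advect_def grad_def dq_def sum_subtractf sum_divide_distrib diff_divide_distrib mult.commute[of "u _ $ _"])
    moreover have "dq h k (\<lambda>y. partial i (\<lambda>z. u z $ j) y * u y $ i) x = 
        u (x + ?e k) $ i * partial i (D k j) x + D k i x * partial i (\<lambda>y. u y $ j) x" for i
      unfolding dq_mult D_def C1_torus_dq(2)[OF u] by (simp add: mult.commute)
    moreover have "dq h k (partial j p) x = partial j (dq h k p) x" by (rule C1_torus_dq(2)[OF p, symmetric])
    ultimately show ?thesis by (simp add: sum.distrib)
  qed
  have "integral unit_cube (\<lambda>x. \<Sum>k\<in>UNIV. \<Sum>j\<in>UNIV. D k j x * dq h k (\<lambda>y. (- advect u u y - grad p y) $ j) x)
     = integral unit_cube (\<lambda>x. - (\<Sum>k\<in>UNIV. \<Sum>j\<in>UNIV. \<Sum>i\<in>UNIV. B k j i x) - (\<Sum>k\<in>UNIV. (\<Sum>j\<in>UNIV. (1 / 2) * A k j x)) - (\<Sum>k\<in>UNIV. C k x))"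
  proof (rule integral_cong)
    fix x
    have "(1 / 2) * A k j x = D k j x * (\<Sum>i\<in>UNIV. u (x + ?e k) $ i * partial i (D k j) x)" for k j
      unfolding A_def DD by (simp add: sum_distrib_left algebra_simps)
    moreover have "(\<Sum>i\<in>UNIV. B k j i x) = D k j x * (\<Sum>i\<in>UNIV. D k i x * partial i (\<lambda>y. u y $ j) x)" for k j
      unfolding B_def by (simp add: sum_distrib_left mult.assoc)
    ultimately show "(\<Sum>k\<in>UNIV. \<Sum>j\<in>UNIV. D k j x * dq h k (\<lambda>y. (- advect u u y - grad p y) $ j) x) =
        - (\<Sum>k\<in>UNIV. \<Sum>j\<in>UNIV. \<Sum>i\<in>UNIV. B k j i x) - (\<Sum>k\<in>UNIV. (\<Sum>j\<in>UNIV. (1 / 2) * A k j x)) - (\<Sum>k\<in>UNIV. C k x)"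
      unfolding w C_def by (simp add: right_diff_distrib sum_subtractf sum_negf)
  qed
  also have "\<dots> = - integral unit_cube (\<lambda>x. \<Sum>k\<in>UNIV. \<Sum>j\<in>UNIV. \<Sum>i\<in>UNIV. B k j i x) 
      - (\<Sum>k\<in>UNIV. \<Sum>j\<in>UNIV. (1 / 2) * integral unit_cube (A k j)) - (\<Sum>k\<in>UNIV. integral unit_cube (C k))"
  proof -
    have iB: "(\<lambda>x. - (\<Sum>k\<in>UNIV. \<Sum>j\<in>UNIV. \<Sum>i\<in>UNIV. B k j i x)) integrable_on unit_cube"
      by (intro integrable_unit_cube continuous_intros cB)
    have iA: "(\<lambda>x. (\<Sum>j\<in>UNIV. (1 / 2) * A k j x)) integrable_on unit_cube" "(\<lambda>x. (1 / 2) * A k j x) integrable_on unit_cube" for k j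
      by (intro integrable_unit_cube continuous_intros cA)+
    have iC: "C k integrable_on unit_cube" for k
      by (intro integrable_unit_cube cC)
    show ?thesis
      by (simp only: integral_diff integrable_diff integrable_sum integral_sum iB iA iC finite integral_neg integral_mult_right)
  qed
  finally show ?thesis unfolding A0 C0 by (simp add: D_def B_def)
qed

lemma uniform_limit_sum:
  fixes f :: "'i \<Rightarrow> 'a \<Rightarrow> 'b \<Rightarrow> 'c::real_normed_vector"
  assumes "\<And>i. i \<in> I \<Longrightarrow> uniform_limit X (f i) (l i) F"
  shows "uniform_limit X (\<lambda>a x. \<Sum>i\<in>I. f i a x) (\<lambda>x. \<Sum>i\<in>I. l i x) F"
  using assms by (induction I rule: infinite_finite_induct) (auto intro: uniform_limit_const uniform_limit_add)

lemma uniform_limit_integral_unit_cube: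
  fixes g :: "'p \<Rightarrow> R3 \<Rightarrow> 'b::banach"
  assumes ul: "uniform_limit (K \<times> unit_cube) (\<lambda>h (s, x). f h s x) (\<lambda>(s, x). g s x) F"
    and f: "\<And>h s. s \<in> K \<Longrightarrow> f h s integrable_on unit_cube" and g: "\<And>s. s \<in> K \<Longrightarrow> g s integrable_on unit_cube"
  shows "uniform_limit K (\<lambda>h s. integral unit_cube (f h s)) (\<lambda>s. integral unit_cube (g s)) F"
proof (rule uniform_limitI)
  fix e :: real assume e: "e > 0"
  from uniform_limitD[OF ul, of "e / 2"] e
  have "\<forall>\<^sub>F h in F. \<forall>q\<in>K \<times> unit_cube. dist (case q of (s, x) \<Rightarrow> f h s x) (case q of (s, x) \<Rightarrow> g s x) < e / 2" by simp
  then show "\<forall>\<^sub>F h in F. \<forall>s\<in>K. dist (integral unit_cube (f h s)) (integral unit_cube (g s)) < e"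
  proof eventually_elim
    case (elim h)
    show ?case
    proof
      fix s assume s: "s \<in> K"
      have "((\<lambda>x. f h s x - g s x) has_integral (integral unit_cube (f h s) - integral unit_cube (g s))) unit_cube"
        by (intro has_integral_diff integrable_integral f g s)
      then have "norm (integral unit_cube (f h s) - integral unit_cube (g s)) \<le> e / 2 * measure lborel unit_cube"
        unfolding unit_cube_def
        by (rule has_integral_bound[rotated]) (use elim s e in \<open>force simp: unit_cube_def dist_norm intro: less_imp_le\<close>)+
      then show "dist (integral unit_cube (f h s)) (integral unit_cube (g s)) < e"
        using e by (simp add: content_unit_cube dist_norm)
    qed
  qed
qed

lemma continuous_on_space_shift:
  fixes f :: "'p::topological_space \<Rightarrow> R3 \<Rightarrow> 'b::topological_space"
  assumes "continuous_on (K \<times> UNIV) (\<lambda>(s, x). f s x)"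
  shows "continuous_on (K \<times> A) (\<lambda>(s, x). f s (x + a))"
proof -
  have "continuous_on (K \<times> A) (\<lambda>q. (\<lambda>(s, x). f s x) (fst q, snd q + a))"
    by (rule continuous_on_compose2[OF assms]) (auto intro!: continuous_intros)
  then show ?thesis by (simp add: split_beta)
qed

lemma continuous_on_dq_param:
  fixes f :: "'p::topological_space \<Rightarrow> scalar_field"
  assumes "continuous_on (K \<times> UNIV) (\<lambda>(s, x). f s x)"
  shows "continuous_on (K \<times> A) (\<lambda>(s, x). dq h k (f s) x)"
  using continuous_on_space_shift[OF assms, of A "h *\<^sub>R axis k 1"] continuous_on_space_shift[OF assms, of A 0]
  unfolding dq_def split_beta divide_inverse by (auto intro!: continuous_intros)

text \<open>The rate of change of \<open>\<integral> |\<nabla>v|\<^sup>2\<close> is \<open>-2\<close> times the integral of this cubic expression.\<close>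

definition stretching :: "vector_field \<Rightarrow> scalar_field" where
  "stretching u x = (\<Sum>k\<in>UNIV. \<Sum>j\<in>UNIV. \<Sum>i\<in>UNIV.
     partial k (\<lambda>y. u y $ j) x * partial k (\<lambda>y. u y $ i) x * partial i (\<lambda>y. u y $ j) x)"

definition grad_energy :: "vector_field \<Rightarrow> real" where
  "grad_energy u = integral unit_cube (\<lambda>x. \<Sum>k\<in>UNIV. \<Sum>j\<in>UNIV. (partial k (\<lambda>y. u y $ j) x)\<^sup>2)"

text \<open>
  For fixed \<open>h > 0\<close> the energy of the difference quotients is differentiable in time by the
  equation alone. As \<open>h\<close> tends to \<open>0\<close> the energies converge, and the rates do so uniformly in
  time, without any second derivative of \<open>v\<close>.
\<close>

lemma grad_energy_balance:
  fixes v :: "real \<Rightarrow> vector_field" and p :: "real \<Rightarrow> scalar_field"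
  assumes \<tau>: "0 \<le> \<tau>"
    and C1: "\<And>s j. s \<in> {0..\<tau>} \<Longrightarrow> C1_torus (\<lambda>x. v s x $ j)"
    and div: "\<And>s x. s \<in> {0..\<tau>} \<Longrightarrow> divergence (v s) x = 0"
    and cv: "\<And>j. continuous_on ({0..\<tau>} \<times> UNIV) (\<lambda>(s, x). v s x $ j)"
    and cdv: "\<And>i j. continuous_on ({0..\<tau>} \<times> UNIV) (\<lambda>(s, x). partial i (\<lambda>y. v s y $ j) x)"
    and p: "\<And>s. s \<in> {0..\<tau>} \<Longrightarrow> C1_torus (p s)"
    and cp: "\<And>j. continuous_on ({0..\<tau>} \<times> UNIV) (\<lambda>(s, x). partial j (p s) x)"
    and eq: "\<And>s x. s \<in> {0..\<tau>} \<Longrightarrow> 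
      ((\<lambda>r. v r x) has_vector_derivative (- advect (v s) (v s) x - grad (p s) x)) (at s within {0..\<tau>})"
  shows "grad_energy (v \<tau>) - grad_energy (v 0) = - 2 * integral {0..\<tau>} (\<lambda>s. integral unit_cube (stretching (v s)))"
proof -
  let ?K = "{0..\<tau>}"
  define w where "w s x = - advect (v s) (v s) x - grad (p s) x" for s x
  define D where "D h k j s x = dq h k (\<lambda>y. v s y $ j) x" for h k j s x
  define A where "A k j s x = partial k (\<lambda>y. v s y $ j) x" for k j s x
  define e where "e h s = integral unit_cube (\<lambda>x. \<Sum>k\<in>UNIV. \<Sum>j\<in>UNIV. D h k j s x * D h k j s x)" for h s
  define R where "R h s x = (\<Sum>k\<in>UNIV. \<Sum>j\<in>UNIV. \<Sum>i\<in>UNIV. D h k j s x * D h k i s x * A i j s x)" for h s x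
  have stretch: "stretching (v s) x = (\<Sum>k\<in>UNIV. \<Sum>j\<in>UNIV. \<Sum>i\<in>UNIV. A k j s x * A k i s x * A i j s x)" for s x
    by (simp add: stretching_def A_def)
  have cA: "continuous_on (?K \<times> X) (\<lambda>(s, x). A k j s x)" for k j X
    unfolding A_def using continuous_on_space_shift[OF cdv, of X k j 0] by simp
  have cD: "continuous_on (?K \<times> X) (\<lambda>(s, x). D h k j s x)" for h k j X
    unfolding D_def by (rule continuous_on_dq_param[OF cv])
  have cw: "continuous_on (?K \<times> UNIV) (\<lambda>(s, x). w s x $ j)" for j
    unfolding w_def advect_def grad_def split_beta vector_minus_component vector_uminus_component vec_lambda_beta
    by (intro continuous_on_diff continuous_on_minus continuous_on_sum continuous_on_mult
        cv[unfolded split_beta] cdv[unfolded split_beta] cp[unfolded split_beta])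
  have cR: "continuous_on (?K \<times> X) (\<lambda>(s, x). R h s x)" for h X
    using cA[of X] cD[of X] unfolding R_def split_beta by (intro continuous_intros)
  have cS: "continuous_on (?K \<times> X) (\<lambda>(s, x). stretching (v s) x)" for X
    using cA[of X] unfolding stretch split_beta by (intro continuous_intros)
  have slice: "continuous_on X (f s)" if "continuous_on (?K \<times> X) (\<lambda>(s, x). f s x)" "s \<in> ?K" for f :: "real \<Rightarrow> R3 \<Rightarrow> real" and s X
  proof -
    have "continuous_on X (\<lambda>x. (\<lambda>(s, x). f s x) (s, x))"
      by (rule continuous_on_compose2[OF that(1)]) (use that(2) in \<open>auto intro!: continuous_intros\<close>)
    then show ?thesis by simp
  qed
  note slice_int = integrable_unit_cube[OF slice[where X = UNIV]]
  have deriv: "(e h has_real_derivative - 2 * integral unit_cube (R h s)) (at s within ?K)" if s: "s \<in> ?K" for h s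
  proof -
    have dv: "((\<lambda>r. v r x $ j) has_real_derivative w s x $ j) (at s within ?K)" if "s \<in> ?K" for s x j
      using bounded_linear.has_vector_derivative[OF bounded_linear_vec_nth eq[OF that, of x], of j]
      by (simp add: w_def has_real_derivative_iff_has_vector_derivative)
    have dD: "((\<lambda>r. D h k j r x) has_real_derivative dq h k (\<lambda>y. w s y $ j) x) (at s within ?K)" if "s \<in> ?K" for s x k j
      unfolding D_def dq_def by (intro DERIV_cdivide DERIV_diff dv that)
    have "(e h has_real_derivative integral unit_cube (\<lambda>x. \<Sum>k\<in>UNIV. \<Sum>j\<in>UNIV. 
        D h k j s x * dq h k (\<lambda>y. w s y $ j) x + dq h k (\<lambda>y. w s y $ j) x * D h k j s x)) (at s within ?K)"
      unfolding e_def unit_cube_def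
    proof (rule leibniz_rule_field_derivative[where fx = "\<lambda>s x. \<Sum>k\<in>UNIV. \<Sum>j\<in>UNIV. 
        D h k j s x * dq h k (\<lambda>y. w s y $ j) x + dq h k (\<lambda>y. w s y $ j) x * D h k j s x"])
      show "((\<lambda>r. \<Sum>k\<in>UNIV. \<Sum>j\<in>UNIV. D h k j r x * D h k j r x) has_real_derivative
        (\<Sum>k\<in>UNIV. \<Sum>j\<in>UNIV. D h k j s x * dq h k (\<lambda>y. w s y $ j) x + dq h k (\<lambda>y. w s y $ j) x * D h k j s x)) (at s within ?K)"
        if "s \<in> ?K" for s x
        by (intro DERIV_sum DERIV_mult' dD that)
      show "(\<lambda>x. \<Sum>k\<in>UNIV. \<Sum>j\<in>UNIV. D h k j s x * D h k j s x) integrable_on cbox 0 1" if "s \<in> ?K" for s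
        unfolding unit_cube_def[symmetric]
        by (intro integrable_unit_cube continuous_intros slice[OF cD that])
      show "continuous_on (?K \<times> cbox 0 1) (\<lambda>(s, x). \<Sum>k\<in>UNIV. \<Sum>j\<in>UNIV. 
        D h k j s x * dq h k (\<lambda>y. w s y $ j) x + dq h k (\<lambda>y. w s y $ j) x * D h k j s x)"
        using cD[of "cbox 0 1"] continuous_on_dq_param[OF cw, of "cbox 0 1"] unfolding split_beta 
        by (intro continuous_intros)
    qed (use s in auto)
    also have "integral unit_cube (\<lambda>x. \<Sum>k\<in>UNIV. \<Sum>j\<in>UNIV. 
        D h k j s x * dq h k (\<lambda>y. w s y $ j) x + dq h k (\<lambda>y. w s y $ j) x * D h k j s x)
      = 2 * integral unit_cube (\<lambda>x. \<Sum>k\<in>UNIV. \<Sum>j\<in>UNIV. D h k j s x * dq h k (\<lambda>y. w s y $ j) x)"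
      unfolding integral_mult_right[symmetric]
      by (intro integral_cong) (simp add: sum.distrib mult.commute sum_distrib_left)
    also have "\<dots> = - 2 * integral unit_cube (R h s)"
      unfolding D_def w_def integral_dq_momentum[OF C1[OF s] div[OF s] p[OF s]] R_def A_def by simp
    finally show ?thesis .
  qed
  have bal: "e h \<tau> - e h 0 = integral ?K (\<lambda>s. - 2 * integral unit_cube (R h s))" for h
  proof (rule integral_unique[symmetric], rule fundamental_theorem_of_calculus[OF \<tau>])
    show "(e h has_vector_derivative - 2 * integral unit_cube (R h s)) (at s within ?K)" if "s \<in> ?K" for s
      using deriv[OF that] by (simp add: has_real_derivative_iff_has_vector_derivative)
  qed
  have bd: "bounded ((\<lambda>(s, x). A k j s x) ` (?K \<times> unit_cube))" for k j
    unfolding unit_cube_def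
    by (intro compact_imp_bounded compact_continuous_image cA compact_Times) auto
  have ulD: "uniform_limit (?K \<times> UNIV) (\<lambda>h (s, x). D h k j s x) (\<lambda>(s, x). A k j s x) (at_right 0)" for k j
    using uniform_limit_dq[of ?K "\<lambda>s y. v s y $ j" k 0] C1_torusD[OF C1] cdv unfolding D_def A_def by simp
  have ulR: "uniform_limit (?K \<times> unit_cube) (\<lambda>h (s, x). R h s x) (\<lambda>(s, x). stretching (v s) x) (at_right 0)"
  proof -
    have u: "uniform_limit (?K \<times> unit_cube) (\<lambda>h q. D h k j (fst q) (snd q)) (\<lambda>q. A k j (fst q) (snd q)) (at_right 0)" for k j
    proof -
      have "uniform_limit (?K \<times> unit_cube) (\<lambda>h (s, x). D h k j s x) (\<lambda>(s, x). A k j s x) (at_right 0)"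
        by (rule uniform_limit_on_subset[OF ulD]) auto
      then show ?thesis by (simp add: case_prod_beta')
    qed
    have b: "bounded ((\<lambda>q. A k j (fst q) (snd q)) ` (?K \<times> unit_cube))" for k j
      using bd[of k j] by (simp add: split_beta)
    have b2: "bounded ((\<lambda>q. A k j (fst q) (snd q) * A k' j' (fst q) (snd q)) ` (?K \<times> unit_cube))" for k j k' j'
      unfolding unit_cube_def using cA[of "cbox 0 1"] unfolding split_beta
      by (intro compact_imp_bounded compact_continuous_image compact_Times continuous_intros) auto
    show ?thesis
      unfolding R_def stretch split_beta
      by (intro uniform_limit_sum uniform_lim_mult u b b2 uniform_limit_const)
  qed
  have "uniform_limit ?K (\<lambda>h s. integral unit_cube (R h s)) (\<lambda>s. integral unit_cube (stretching (v s))) (at_right 0)"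
    by (intro uniform_limit_integral_unit_cube ulR slice_int cR cS)
  then have ul: "uniform_limit ?K (\<lambda>h s. - 2 * integral unit_cube (R h s)) (\<lambda>s. - 2 * integral unit_cube (stretching (v s))) (at_right 0)"
    by (intro uniform_limit_intros)
  have "continuous_on ?K (\<lambda>s. - 2 * integral unit_cube (R h s))" for h
    unfolding unit_cube_def by (intro continuous_intros integral_continuous_on_param cR)
  then obtain I J where IJ: "\<And>h. ((\<lambda>s. - 2 * integral unit_cube (R h s)) has_integral I h) ?K"
     "((\<lambda>s. - 2 * integral unit_cube (stretching (v s))) has_integral J) ?K" "(I \<longlongrightarrow> J) (at_right 0)"
    using uniform_limit_integral[OF ul] by (metis trivial_limit_at_right_real)
  have I: "I = (\<lambda>h. e h \<tau> - e h 0)" using bal integral_unique[OF IJ(1)] by (simp add: fun_eq_iff)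
  have lim1: "((\<lambda>h. e h \<tau> - e h 0) \<longlongrightarrow> integral ?K (\<lambda>s. - 2 * integral unit_cube (stretching (v s)))) (at_right 0)"
    using IJ(3) unfolding I integral_unique[OF IJ(2)] .
  have lime: "((\<lambda>h. e h s) \<longlongrightarrow> grad_energy (v s)) (at_right 0)" if s: "s \<in> ?K" for s
  proof -
    have u: "uniform_limit unit_cube (\<lambda>h. D h k j s) (A k j s) (at_right 0)" for k j
      using uniform_limit_dq_C1[OF C1[OF s] C1[OF s] C1[OF s], where i = k and w = 0] unfolding D_def A_def by simp
    have b: "bounded (A k j s ` unit_cube)" for k j
      by (intro bounded_image_unit_cube slice[OF cA s])
    have c: "continuous_on unit_cube (\<lambda>x. \<Sum>k\<in>UNIV. \<Sum>j\<in>UNIV. D h k j s x * D h k j s x)" for h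
      by (intro continuous_intros slice[OF cD s])
    show ?thesis
      unfolding e_def grad_energy_def power2_eq_square A_def[symmetric]
      by (intro integral_tendsto_uniform uniform_limit_sum uniform_lim_mult u b c) simp
  qed
  have "((\<lambda>h. e h \<tau> - e h 0) \<longlongrightarrow> grad_energy (v \<tau>) - grad_energy (v 0)) (at_right 0)"
    using \<tau> by (intro tendsto_diff lime) auto
  from tendsto_unique[OF _ this lim1] show ?thesis by simp
qed


subsection \<open>Quadratic and cubic integral identities\<close>

text \<open>
  The entries of the velocity gradient as free variables; the trace condition eliminates one of them.
\<close>

lemma cubic_trace_identity:
  fixes a11 a12 a13 a21 a22 a23 a31 a32 a33 :: real
  assumes "a11 + a22 + a33 = 0"
  shows "(a11*a11*a11 + a11*a12*a21 + a11*a13*a31) + (a12*a11*a12 + a12*a12*a22 + a12*a13*a32) + (a13*a11*a13 + a13*a12*a23 + a13*a13*a33)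
    + ((a21*a21*a11 + a21*a22*a21 + a21*a23*a31) + (a22*a21*a12 + a22*a22*a22 + a22*a23*a32) + (a23*a21*a13 + a23*a22*a23 + a23*a23*a33))
    + ((a31*a31*a11 + a31*a32*a21 + a31*a33*a31) + (a32*a31*a12 + a32*a32*a22 + a32*a33*a32) + (a33*a31*a13 + a33*a32*a23 + a33*a33*a33))
   = 4 * (a11 * a22 * a33 + (a12+a21)/2 * ((a23+a32)/2) * ((a13+a31)/2) + (a13+a31)/2 * ((a12+a21)/2) * ((a23+a32)/2)
      - a11 * ((a23+a32)/2) * ((a23+a32)/2) - (a12+a21)/2 * ((a12+a21)/2) * a33 - (a13+a31)/2 * a22 * ((a13+a31)/2))
    - (a11 * (a22 * a33) - a11 * (a32 * a23) + a21 * (a32 * a13) - a21 * (a12 * a33) + a31 * (a12 * a23) - a31 * (a22 * a13))"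
proof -
  have a: "a33 = - a11 - a22" using assms by simp
  show ?thesis unfolding a by (simp add: field_simps)
qed

text \<open>
  The determinant of the velocity gradient, its terms arranged as in \<open>integral_jacobian_eq_0\<close>.
\<close>

definition jacobian :: "vector_field \<Rightarrow> scalar_field" where
  "jacobian u x = (let d = \<lambda>i j. partial i (\<lambda>y. u y $ j) x in
     d 1 1 * (d 2 2 * d 3 3) - d 1 1 * (d 3 2 * d 2 3) + d 2 1 * (d 3 2 * d 1 3) - d 2 1 * (d 1 2 * d 3 3)
      + d 3 1 * (d 1 2 * d 2 3) - d 3 1 * (d 2 2 * d 1 3))"

text \<open>
  With \<open>A = \<nabla>u\<close> the left side is \<open>tr (A\<^sup>2 A\<^sup>T)\<close>. Expand \<open>tr (A + A\<^sup>T)\<^sup>3\<close> and use \<open>tr M\<^sup>3 = 3 det M\<close>,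
  valid for traceless \<open>M\<close>, for \<open>A\<close> and for its symmetric part.
\<close>

lemma stretching_eq:
  assumes "divergence u x = 0"
  shows "stretching u x = 4 * det (deformation u x) - jacobian u x"
proof -
  define a where "a i j = partial i (\<lambda>y. u y $ j) x" for i j
  have "a 1 1 + a 2 2 + a 3 3 = 0" using assms by (simp add: divergence_def sum_3 a_def)
  from cubic_trace_identity[OF this, of "a 1 2" "a 2 1" "a 1 3" "a 3 1" "a 3 2" "a 2 3"]
  show ?thesis
    unfolding stretching_def jacobian_def det_3 deformation_def vec_lambda_beta sum_3 Let_def a_def[symmetric]
    by (simp add: add.commute[of "a 2 1" "a 1 2"] add.commute[of "a 3 1" "a 1 3"] add.commute[of "a 3 2" "a 2 3"])
qed

lemma transpose_deformation: "transpose (deformation u x) = deformation u x"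
  by (simp add: transpose_def deformation_def vec_eq_iff add.commute)

lemma trace_deformation: "deformation u x $ 1 $ 1 + deformation u x $ 2 $ 2 + deformation u x $ 3 $ 3 = divergence u x"
  by (simp add: deformation_def divergence_def sum_3)

lemma norm_R3_sq: "(norm (z :: R3))\<^sup>2 = (z $ 1)\<^sup>2 + (z $ 2)\<^sup>2 + (z $ 3)\<^sup>2"
  by (simp add: norm_vec_def L2_set_def sum_nonneg sum_3)

lemma norm_curl_sq:
  "(norm (curl u x))\<^sup>2 = (\<Sum>i\<in>UNIV. \<Sum>j\<in>UNIV. (partial i (\<lambda>y. u y $ j) x)\<^sup>2)
     - (\<Sum>i\<in>UNIV. \<Sum>j\<in>UNIV. partial i (\<lambda>y. u y $ j) x * partial j (\<lambda>y. u y $ i) x)"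
  unfolding norm_R3_sq by (simp add: sum_3 curl_def power2_eq_square algebra_simps)

lemma norm_deformation_sq:
  "(norm (deformation u x))\<^sup>2 = (1 / 2) * (\<Sum>i\<in>UNIV. \<Sum>j\<in>UNIV. (partial i (\<lambda>y. u y $ j) x)\<^sup>2)
     + (1 / 2) * (\<Sum>i\<in>UNIV. \<Sum>j\<in>UNIV. partial i (\<lambda>y. u y $ j) x * partial j (\<lambda>y. u y $ i) x)"
  unfolding norm_matrix_sq by (simp add: sum_3 deformation_def power2_eq_square field_simps)

context
  fixes u :: vector_field
  assumes u: "\<And>j. C1_torus (\<lambda>x. u x $ j)" and div: "\<And>x. divergence u x = 0"
begin

lemma continuous_on_gradient_products:
  "continuous_on UNIV (\<lambda>x. \<Sum>i\<in>UNIV. \<Sum>j\<in>UNIV. (partial i (\<lambda>y. u y $ j) x)\<^sup>2)"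
  "continuous_on UNIV (\<lambda>x. \<Sum>i\<in>UNIV. \<Sum>j\<in>UNIV. partial i (\<lambda>y. u y $ j) x * partial j (\<lambda>y. u y $ i) x)"
  by (intro continuous_intros C1_torusD(3)[OF u])+

text \<open>
  Exchanging the derivatives turns the integrand into \<open>(div u)\<^sup>2\<close>.
\<close>

lemma integral_gradient_transpose_eq_0:
  "integral unit_cube (\<lambda>x. \<Sum>i\<in>UNIV. \<Sum>j\<in>UNIV. partial i (\<lambda>y. u y $ j) x * partial j (\<lambda>y. u y $ i) x) = 0"
proof -
  note ints = integrable_unit_cube continuous_intros C1_torusD(3)[OF u]
  have "integral unit_cube (\<lambda>x. \<Sum>i\<in>UNIV. \<Sum>j\<in>UNIV. partial i (\<lambda>y. u y $ j) x * partial j (\<lambda>y. u y $ i) x)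
     = (\<Sum>i\<in>UNIV. \<Sum>j\<in>UNIV. integral unit_cube (\<lambda>x. partial i (\<lambda>y. u y $ j) x * partial j (\<lambda>y. u y $ i) x))"
    by (subst integral_sum, simp, intro ints, subst integral_sum, simp, intro ints, simp)
  also have "\<dots> = (\<Sum>i\<in>UNIV. \<Sum>j\<in>UNIV. integral unit_cube (\<lambda>x. partial j (\<lambda>y. u y $ j) x * partial i (\<lambda>y. u y $ i) x))"
    by (intro sum.cong refl integral_partial_mult_swap u)
  also have "\<dots> = integral unit_cube (\<lambda>x. \<Sum>i\<in>UNIV. \<Sum>j\<in>UNIV. partial j (\<lambda>y. u y $ j) x * partial i (\<lambda>y. u y $ i) x)"
    by (subst integral_sum, simp, intro ints, subst integral_sum, simp, intro ints, simp)
  also have "\<dots> = integral unit_cube (\<lambda>x. divergence u x * divergence u x)"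
    by (simp add: divergence_def sum_distrib_left sum_distrib_right)
  finally show ?thesis by (simp add: div)
qed

lemma L2_norm_curl: "(L2_norm_torus (curl u))\<^sup>2 = grad_energy u" "0 \<le> grad_energy u"
proof -
  note c = continuous_on_gradient_products
  have "continuous_on UNIV (\<lambda>x. (norm (curl u x))\<^sup>2)"
    unfolding norm_curl_sq by (intro continuous_on_diff c)
  then have "(LINT x:unit_cube|lebesgue. (norm (curl u x))\<^sup>2) = integral unit_cube (\<lambda>x. (norm (curl u x))\<^sup>2)"
    by (rule LINT_continuous_cube)
  also have "\<dots> = grad_energy u - 0"
    unfolding norm_curl_sq grad_energy_def integral_gradient_transpose_eq_0[symmetric]
    by (intro integral_diff integrable_unit_cube c)
  finally have eq: "(LINT x:unit_cube|lebesgue. (norm (curl u x))\<^sup>2) = grad_energy u" by simp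
  show "0 \<le> grad_energy u"
    unfolding eq[symmetric] set_lebesgue_integral_def by (intro integral_nonneg_AE AE_I2) simp
  then show "(L2_norm_torus (curl u))\<^sup>2 = grad_energy u"
    unfolding L2_norm_torus_def eq by simp
qed

lemma continuous_on_deformation: "continuous_on UNIV (deformation u)"
  unfolding deformation_def[abs_def] by (intro continuous_intros C1_torusD(3)[OF u]) auto

lemma integral_norm_deformation: "integral unit_cube (\<lambda>x. (norm (deformation u x))\<^sup>2) = grad_energy u / 2"
proof -
  have "integral unit_cube (\<lambda>x. (norm (deformation u x))\<^sup>2) = (1 / 2) * grad_energy u + (1 / 2) * 0"
    unfolding norm_deformation_sq grad_energy_def integral_gradient_transpose_eq_0[symmetric]
    by (subst integral_add) (simp_all only: integral_mult_right integrable_on_mult_right integrable_unit_cube continuous_on_gradient_products)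
  then show ?thesis by simp
qed

lemma continuous_on_det_deformation: "continuous_on UNIV (\<lambda>x. det (deformation u x))"
  unfolding det_3 by (intro continuous_intros continuous_on_deformation)

lemma integral_stretching: "integral unit_cube (stretching u) = 4 * integral unit_cube (\<lambda>x. det (deformation u x))"
proof -
  let ?d = "\<lambda>i j x. partial i (\<lambda>y. u y $ j) x"
  let ?L = "\<lambda>i j k x. ?d i 1 x * (?d j 2 x * ?d k 3 x)"
  have i: "?L i j k integrable_on unit_cube" for i j k
    by (intro integrable_unit_cube continuous_intros C1_torusD(3)[OF u])
  have J: "jacobian u = (\<lambda>x. ?L 1 2 3 x - ?L 1 3 2 x + ?L 2 3 1 x - ?L 2 1 3 x + ?L 3 1 2 x - ?L 3 2 1 x)"
    by (simp add: fun_eq_iff jacobian_def Let_def)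
  have "jacobian u integrable_on unit_cube"
    unfolding J by (intro integrable_diff integrable_add i)
  moreover have "integral unit_cube (jacobian u) = 0"
    unfolding J
    by (simp only: integral_diff integral_add integrable_diff integrable_add i)
       (rule integral_jacobian_eq_0[OF u u u])
  moreover have "(\<lambda>x. 4 * det (deformation u x)) integrable_on unit_cube"
    by (intro integrable_unit_cube continuous_intros continuous_on_det_deformation)
  moreover have "stretching u = (\<lambda>x. 4 * det (deformation u x) - jacobian u x)"
    using stretching_eq[OF div] by auto
  ultimately show ?thesis by (simp add: integral_diff)
qed

end


section \<open>Regularity of solutions\<close>

lemma L2_set_integrable_mult_real:
  assumes g: "g \<in> L2_torus" and F: "continuous_on UNIV F"
  shows "set_integrable lebesgue unit_cube (\<lambda>x. g x * F x :: real)"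
proof -
  have "set_integrable lebesgue unit_cube (\<lambda>x. of_real (g x) * complex_of_real (F x))"
    by (intro L2_set_integrable_mult g continuous_intros F)
  from integrable_Re[OF this[unfolded set_integrable_def]] show ?thesis by (simp add: set_integrable_def)
qed

lemma L2_torus_diff:
  assumes f: "f \<in> L2_torus" and g: "g \<in> L2_torus"
  shows "(\<lambda>x. f x - g x) \<in> L2_torus"
proof -
  have [measurable]: "f \<in> borel_measurable lebesgue" "g \<in> borel_measurable lebesgue"
    using f g by (auto simp: L2_torus_def)
  have "set_integrable lebesgue unit_cube (\<lambda>x. (f x - g x)\<^sup>2)"
  proof (rule set_integrable_bound)
    show "set_integrable lebesgue unit_cube (\<lambda>x. 2 * (f x)\<^sup>2 + 2 * (g x)\<^sup>2)"
      using f g by (intro set_integral_add set_integrable_mult_right) (auto simp: L2_torus_def)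
    show "set_borel_measurable lebesgue unit_cube (\<lambda>x. (f x - g x)\<^sup>2)"
      unfolding set_borel_measurable_def by measurable
    have "(a - b)\<^sup>2 \<le> 2 * a\<^sup>2 + 2 * b\<^sup>2" for a b :: real
      using zero_le_power2[of "a + b"] by (simp add: power2_eq_square algebra_simps)
    then show "AE x in lebesgue. x \<in> unit_cube \<longrightarrow> norm ((f x - g x)\<^sup>2) \<le> norm (2 * (f x)\<^sup>2 + 2 * (g x)\<^sup>2)"
      by (auto intro!: AE_I2 order_trans[of "(f _ - g _)\<^sup>2"])
  qed
  then show ?thesis using f g by (auto simp: L2_torus_def periodic_def)
qed

lemma continuous_on_mi_deriv: "test_function \<phi> \<Longrightarrow> continuous_on UNIV (mi_deriv \<alpha> \<phi>)"
  unfolding test_function_def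
  by (meson continuous_at_imp_continuous_on differentiable_imp_continuous_within)

lemma mi_deriv_0: "mi_deriv 0 f = f"
  by (simp add: mi_deriv_def)

lemma is_weak_deriv_diff:
  assumes f: "f \<in> L2_torus" "f' \<in> L2_torus" and w: "is_weak_deriv \<alpha> f g" "is_weak_deriv \<alpha> f' g'"
  shows "is_weak_deriv \<alpha> (\<lambda>x. f x - f' x) (\<lambda>x. g x - g' x)"
proof -
  have g: "g \<in> L2_torus" "g' \<in> L2_torus" using w by (auto simp: is_weak_deriv_def)
  have "(LINT x:unit_cube|lebesgue. (f x - f' x) * mi_deriv \<alpha> \<phi> x) = (-1) ^ mi_order \<alpha> * (LINT x:unit_cube|lebesgue. (g x - g' x) * \<phi> x)"
    if \<phi>: "test_function \<phi>" for \<phi>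
  proof -
    note i = L2_set_integrable_mult_real[OF _ continuous_on_mi_deriv[OF \<phi>]]
    show ?thesis
      using w \<phi> i[OF f(1), of \<alpha>] i[OF f(2), of \<alpha>] i[OF g(1), of 0] i[OF g(2), of 0]
      by (simp add: is_weak_deriv_def left_diff_distrib set_integral_diff mi_deriv_0 right_diff_distrib)
  qed
  then show ?thesis using L2_torus_diff[OF g] by (simp add: is_weak_deriv_def)
qed

lemma sobolev_diff:
  assumes f: "f \<in> sobolev m" and g: "g \<in> sobolev m"
  shows "(\<lambda>x. f x - g x) \<in> sobolev m"
proof -
  have L2: "f \<in> L2_torus" "g \<in> L2_torus" using f g by (auto simp: sobolev_def intro: continuous_in_L2)
  have "periodic (\<lambda>x. f x - g x)" "continuous_on UNIV (\<lambda>x. f x - g x)"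
    using f g by (auto simp: sobolev_def periodic_def intro!: continuous_intros)
  moreover have "\<exists>h. is_weak_deriv \<alpha> (\<lambda>x. f x - g x) h" if "mi_order \<alpha> \<le> m" for \<alpha>
    using f g that is_weak_deriv_diff[OF L2, of \<alpha>] unfolding sobolev_def by blast
  ultimately show ?thesis by (simp add: sobolev_def)
qed

lemma scalar_sobolev_norm_le: "scalar_sobolev_norm m (\<lambda>x. u x $ j) \<le> sobolev_norm m u"
  unfolding scalar_sobolev_norm_def sobolev_norm_def real_sqrt_le_iff
  by (rule member_le_sum[where f = "\<lambda>j. \<Sum>\<alpha> | mi_order \<alpha> \<le> m. (L2_norm_torus (weak_deriv \<alpha> (\<lambda>x. u x $ j)))\<^sup>2"])
     (auto intro: sum_nonneg)

lemma continuous_on_family: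
  fixes F :: "'p::metric_space \<Rightarrow> 'x::metric_space \<Rightarrow> real"
  assumes c: "\<And>t. t \<in> I \<Longrightarrow> continuous_on UNIV (F t)"
    and le: "\<And>s t x. s \<in> I \<Longrightarrow> t \<in> I \<Longrightarrow> \<bar>F s x - F t x\<bar> \<le> N s t"
    and lim: "\<And>t. t \<in> I \<Longrightarrow> ((\<lambda>s. N s t) \<longlongrightarrow> 0) (at t within I)"
  shows "continuous_on (I \<times> UNIV) (\<lambda>(t, x). F t x)"
  unfolding continuous_on_iff
proof (intro ballI allI impI)
  fix q :: "'p \<times> 'x" and e :: real assume q: "q \<in> I \<times> UNIV" and e: "e > 0"
  obtain t x where tx: "q = (t, x)" "t \<in> I" using q by auto
  have "\<forall>\<^sub>F s in at t within I. dist (N s t) 0 < e / 2"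
    using lim[OF tx(2)] e by (intro tendstoD) auto
  then obtain d1 where d1: "d1 > 0" "\<And>s. s \<in> I \<Longrightarrow> s \<noteq> t \<Longrightarrow> dist s t < d1 \<Longrightarrow> \<bar>N s t\<bar> < e / 2"
    unfolding eventually_at by (auto simp: dist_real_def)
  obtain d2 where d2: "d2 > 0" "\<And>y. dist y x < d2 \<Longrightarrow> dist (F t y) (F t x) < e / 2"
    using c[OF tx(2)] e unfolding continuous_on_iff by (metis UNIV_I half_gt_zero)
  have "dist (F s y) (F t x) < e" if s: "s \<in> I" and d: "dist (s, y) (t, x) < min d1 d2" for s y
  proof -
    have d': "dist s t < d1" "dist y x < d2"
      using d dist_fst_le[of "(s, y)" "(t, x)"] dist_snd_le[of "(s, y)" "(t, x)"] by auto
    have "\<bar>F s y - F t y\<bar> < e / 2"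
    proof (cases "s = t")
      case False
      show ?thesis using le[OF s tx(2), of y] d1(2)[OF s False d'(1)] by simp
    qed (use e in simp)
    then show ?thesis using d2(2)[OF d'(2)] unfolding dist_real_def by linarith
  qed
  then show "\<exists>d>0. \<forall>x'\<in>I \<times> UNIV. dist x' q < d \<longrightarrow> dist (case x' of (t, x) \<Rightarrow> F t x) (case q of (t, x) \<Rightarrow> F t x) < e"
    using d1(1) d2(1) tx by (intro exI[of _ "min d1 d2"]) auto
qed

lemma sobolev_sigma_C1:
  assumes "3 \<le> m" "u \<in> sobolev_sigma m"
  shows "C1_torus (\<lambda>x. u x $ j)" "divergence u x = 0"
  using sobolev_embedding assms unfolding sobolev_sigma_def by blast+

text \<open>
  The Sobolev norm of \<open>v s - v t\<close> bounds the \<open>C\<^sup>1\<close> distance of \<open>v s\<close> and \<open>v t\<close> up to a constant.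
\<close>

lemma solution_regularity:
  assumes sol: "euler_solution m T v\<^sub>0 v" and m: "3 \<le> m"
  shows "continuous_on ({0..<T} \<times> UNIV) (\<lambda>(s, x). v s x $ j)"
    "continuous_on ({0..<T} \<times> UNIV) (\<lambda>(s, x). partial i (\<lambda>y. v s y $ j) x)"
proof -
  have v: "v s \<in> sobolev_sigma m" if "s \<in> {0..<T}" for s
    using sol that by (simp add: euler_solution_def)
  note C1 = sobolev_sigma_C1(1)[OF m v]
  obtain C where C: "C \<ge> 0" "\<And>f. f \<in> sobolev m \<Longrightarrow> (\<forall>x. \<bar>f x\<bar> \<le> C * scalar_sobolev_norm m f) \<and> 
      (\<forall>i x. \<bar>partial i f x\<bar> \<le> C * scalar_sobolev_norm m f)"
    using sobolev_embedding m by blast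
  define N where "N s t = C * sobolev_norm m (\<lambda>x. v s x - v t x)" for s t
  have lim: "((\<lambda>s. N s t) \<longlongrightarrow> 0) (at t within {0..<T})" if "t \<in> {0..<T}" for t
  proof -
    have "((\<lambda>s. sobolev_norm m (\<lambda>x. v s x - v t x)) \<longlongrightarrow> 0) (at t within {0..<T})"
      using sol that unfolding euler_solution_def by blast
    from tendsto_mult_left[OF this, of C] show ?thesis by (simp add: N_def)
  qed
  have le: "\<bar>v s x $ j - v t x $ j\<bar> \<le> N s t"
      "\<bar>partial i (\<lambda>y. v s y $ j) x - partial i (\<lambda>y. v t y $ j) x\<bar> \<le> N s t"
    if st: "s \<in> {0..<T}" "t \<in> {0..<T}" for s t x
  proof -
    have "(\<lambda>x. v s x $ j - v t x $ j) \<in> sobolev m"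
      using v[OF st(1)] v[OF st(2)] by (intro sobolev_diff) (auto simp: sobolev_sigma_def)
    note b = C(2)[OF this]
    have n: "C * scalar_sobolev_norm m (\<lambda>x. v s x $ j - v t x $ j) \<le> N s t"
      unfolding N_def using scalar_sobolev_norm_le[of m "\<lambda>x. v s x - v t x" j] C(1) by (simp add: mult_left_mono)
    show "\<bar>v s x $ j - v t x $ j\<bar> \<le> N s t"
      using b n by (meson order_trans)
    have "partial i (\<lambda>y. v s y $ j - v t y $ j) x = partial i (\<lambda>y. v s y $ j) x - partial i (\<lambda>y. v t y $ j) x"
      using C1_torus_lincomb(2)[OF C1[OF st(1)] C1[OF st(2)], of i 1 j "-1" j x] by simp
    moreover have "\<bar>partial i (\<lambda>y. v s y $ j - v t y $ j) x\<bar> \<le> N s t"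
      using b n by (meson order_trans)
    ultimately show "\<bar>partial i (\<lambda>y. v s y $ j) x - partial i (\<lambda>y. v t y $ j) x\<bar> \<le> N s t"
      by (simp only:)
  qed
  show "continuous_on ({0..<T} \<times> UNIV) (\<lambda>(s, x). v s x $ j)"
    by (rule continuous_on_family[OF C1_torusD(4)[OF C1] le(1) lim])
  show "continuous_on ({0..<T} \<times> UNIV) (\<lambda>(s, x). partial i (\<lambda>y. v s y $ j) x)"
    by (rule continuous_on_family[OF C1_torusD(3)[OF C1] le(2) lim])
qed

section \<open>The solution operator and the time of sign change\<close>

lemma euler_solution_restrict:
  assumes sol: "euler_solution m T v\<^sub>0 v" and T': "0 < T'" "T' \<le> T"
  shows "euler_solution m T' v\<^sub>0 v"
proof -
  have sub: "{0..<T'} \<subseteq> {0..<T}" using T' by auto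
  obtain p where p: "\<forall>t\<in>{0..<T}. periodic (p t) \<and> (\<forall>x. p t differentiable (at x))"
      "continuous_on ({0..<T} \<times> UNIV) (\<lambda>(t, x). grad (p t) x)"
      "\<forall>t\<in>{0..<T}. \<forall>x. ((\<lambda>s. v s x) has_vector_derivative (- advect (v t) (v t) x - grad (p t) x)) (at t within {0..<T})"
    using sol unfolding euler_solution_def by blast
  have "\<exists>p. (\<forall>t\<in>{0..<T'}. periodic (p t) \<and> (\<forall>x. p t differentiable (at x))) \<and>
        continuous_on ({0..<T'} \<times> UNIV) (\<lambda>(t, x). grad (p t) x) \<and>
        (\<forall>t\<in>{0..<T'}. \<forall>x. ((\<lambda>s. v s x) has_vector_derivative (- advect (v t) (v t) x - grad (p t) x)) (at t within {0..<T'}))"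
  proof (intro exI[of _ p] conjI)
    show "\<forall>t\<in>{0..<T'}. periodic (p t) \<and> (\<forall>x. p t differentiable (at x))" using p(1) sub by blast
    show "continuous_on ({0..<T'} \<times> UNIV) (\<lambda>(t, x). grad (p t) x)"
      by (rule continuous_on_subset[OF p(2)]) (use sub in auto)
    show "\<forall>t\<in>{0..<T'}. \<forall>x. ((\<lambda>s. v s x) has_vector_derivative (- advect (v t) (v t) x - grad (p t) x)) (at t within {0..<T'})"
      using p(3) sub has_vector_derivative_within_subset by blast
  qed
  moreover have "\<forall>t\<in>{0..<T'}. ((\<lambda>s. sobolev_norm m (\<lambda>x. v s x - v t x)) \<longlongrightarrow> 0) (at t within {0..<T'})"
    using sol sub tendsto_within_subset unfolding euler_solution_def by blast
  moreover have "v 0 = v\<^sub>0" "\<forall>t\<in>{0..<T'}. v t \<in> sobolev_sigma m"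
    using sol sub unfolding euler_solution_def by auto
  ultimately show ?thesis using T'(1) unfolding euler_solution_def by blast
qed

text \<open>
  The solution on the longer interval restricts to the shorter one, where uniqueness applies. Hence
  the description that defines \<open>S\<close> is unique.
\<close>

lemma solutions_agree:
  assumes "unique_existence m T v\<^sub>0" "euler_solution m T v\<^sub>0 v" "unique_existence m T' v\<^sub>0" "euler_solution m T' v\<^sub>0 v'"
    and "0 \<le> s" "s < T" "s < T'"
  shows "v s = v' s"
  using assms
proof (induction T T' arbitrary: v v' rule: linorder_wlog)
  case (le T T')
  have "euler_solution m T v\<^sub>0 v'"
    by (rule euler_solution_restrict[OF le(5)]) (use le in auto)
  then show ?case using le unfolding unique_existence_def by (metis atLeastLessThan_iff)
next
  case (sym T T')
  then show ?case by metis
qed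

lemma S_eq_solution:
  assumes "unique_existence m T v\<^sub>0" "euler_solution m T v\<^sub>0 v" "0 \<le> s" "s < T"
  shows "S m s v\<^sub>0 = v s"
  unfolding S_def
proof (rule the_equality)
  show "\<exists>T v'. s < T \<and> unique_existence m T v\<^sub>0 \<and> euler_solution m T v\<^sub>0 v' \<and> v s = v' s"
    using assms by blast
next
  fix u assume "\<exists>T v. s < T \<and> unique_existence m T v\<^sub>0 \<and> euler_solution m T v\<^sub>0 v \<and> u = v s"
  then show "u = v s" using assms solutions_agree by blast
qed

lemma T_sign_le_T_max: "T_sign m f \<le> T_max m f"
proof (cases "sign_change_times m f = {}")
  case False
  then obtain s where s: "s \<in> sign_change_times m f" by blast
  then have "T_sign m f \<le> ereal s" using False by (auto simp: T_sign_def intro: INF_lower)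
  also have "ereal s < T_max m f" using s by (auto simp: sign_change_times_def split: if_splits)
  finally show ?thesis by simp
qed (simp add: T_sign_def)

lemma before_T_sign:
  assumes "ereal s < T_sign m f"
  shows "s \<notin> sign_change_times m f"
proof
  assume s: "s \<in> sign_change_times m f"
  then have "T_sign m f \<le> ereal s" by (auto simp: T_sign_def intro: INF_lower)
  with assms show False by simp
qed

lemma solution_before_T_sign:
  assumes "ereal t < T_sign m v\<^sub>0"
  obtains T v where "t < T" "unique_existence m T v\<^sub>0" "euler_solution m T v\<^sub>0 v"
proof -
  have "ereal t < T_max m v\<^sub>0" using assms T_sign_le_T_max by (rule less_le_trans)
  then obtain T where "unique_existence m T v\<^sub>0" "t < T" unfolding T_max_def less_SUP_iff by auto
  then show ?thesis using that unfolding unique_existence_def by metis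
qed


section \<open>Growth of the enstrophy\<close>

text \<open>
  The derivative of \<open>y exp (-\<integral> a)\<close> is nonpositive inside the interval.
\<close>

lemma gronwall:
  fixes y y' a :: "real \<Rightarrow> real"
  assumes t: "0 \<le> t" and y: "\<And>s. s \<in> {0..t} \<Longrightarrow> (y has_real_derivative y' s) (at s within {0..t})"
    and a: "continuous_on {0..t} a" and le: "\<And>s. s \<in> {0<..<t} \<Longrightarrow> y' s \<le> a s * y s"
  shows "y t \<le> y 0 * exp (integral {0..t} a)"
proof -
  define A where "A s = integral {0..s} a" for s
  define z where "z s = y s * exp (- A s)" for s
  have A: "(A has_real_derivative a s) (at s within {0..t})" if "s \<in> {0..t}" for s
    unfolding A_def by (rule integral_has_real_derivative[OF a that])
  have z: "(z has_real_derivative (y' s - a s * y s) * exp (- A s)) (at s within {0..t})" if "s \<in> {0..t}" for s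
    unfolding z_def by (rule derivative_eq_intros y A that refl)+ (simp add: algebra_simps)
  have "z t \<le> z 0"
  proof (rule DERIV_nonpos_imp_decreasing_open[OF t])
    show "continuous_on {0..t} z" using z by (rule DERIV_continuous_on)
    fix s assume s: "0 < s" "s < t"
    then have "(z has_real_derivative (y' s - a s * y s) * exp (- A s)) (at s)"
      using z[of s] by (simp add: at_within_Icc_at)
    moreover have "(y' s - a s * y s) * exp (- A s) \<le> 0"
      using le[of s] s by (intro mult_nonpos_nonneg) auto
    ultimately show "\<exists>y. DERIV z s :> y \<and> y \<le> 0" by blast
  qed
  then have "y t * exp (- A t) \<le> y 0" by (simp add: z_def A_def)
  then have "y t * exp (- A t) * exp (A t) \<le> y 0 * exp (A t)" by (rule mult_right_mono) simp
  then show ?thesis by (simp add: A_def mult.assoc exp_add[symmetric])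
qed

lemma range_periodic:
  assumes "periodic f"
  shows "range f = f ` unit_cube"
proof (intro subset_antisym)
  show "f ` unit_cube \<subseteq> range f" by auto
  show "range f \<subseteq> f ` unit_cube"
  proof
    fix y assume "y \<in> range f"
    then obtain x where x: "y = f x" by blast
    obtain n where "x + (\<chi> i. of_int (n i)) \<in> unit_cube" using unit_cube_representative by blast
    then show "y \<in> f ` unit_cube"
      using x periodic_add_int[OF assms, of x n] by (metis image_eqI)
  qed
qed

lemma bounded_range_periodic:
  fixes f :: scalar_field
  assumes "periodic f" "continuous_on UNIV f"
  shows "bdd_above (range f)" "bdd_below (range f)"
  using bounded_image_unit_cube[OF assms(2)] unfolding range_periodic[OF assms(1)]
  by (auto intro: bounded_imp_bdd_above bounded_imp_bdd_below)

text \<open>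
  Uniform continuity on \<open>K \<times> unit_cube\<close> makes the functions \<open>F s\<close> depend on \<open>s\<close> continuously in the
  supremum norm.
\<close>

lemma continuous_on_SUP_torus:
  fixes F :: "real \<Rightarrow> scalar_field"
  assumes K: "compact K" and F: "continuous_on (K \<times> UNIV) (\<lambda>(s, x). F s x)" and per: "\<And>s. s \<in> K \<Longrightarrow> periodic (F s)"
  shows "continuous_on K (\<lambda>s. SUP x. F s x)"
  unfolding continuous_on_iff
proof (intro ballI allI impI)
  have cF: "continuous_on UNIV (F s)" if "s \<in> K" for s
  proof -
    have "continuous_on UNIV (\<lambda>x. (\<lambda>(s, x). F s x) (s, x))"
      by (rule continuous_on_compose2[OF F]) (use that in \<open>auto intro!: continuous_intros\<close>)
    then show ?thesis by simp
  qed
  have "uniformly_continuous_on (K \<times> unit_cube) (\<lambda>(s, x). F s x)"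
    unfolding unit_cube_def
    by (intro compact_uniformly_continuous compact_Times K continuous_on_subset[OF F]) auto
  moreover fix s and e :: real assume s: "s \<in> K" and e: "e > 0"
  ultimately obtain d where d0: "d > 0" "\<And>q q'. q \<in> K \<times> unit_cube \<Longrightarrow> q' \<in> K \<times> unit_cube \<Longrightarrow> dist q' q < d \<Longrightarrow>
      dist (case q' of (s, x) \<Rightarrow> F s x) (case q of (s, x) \<Rightarrow> F s x) < e / 2"
    unfolding uniformly_continuous_on_def using half_gt_zero[OF e] by meson
  have d: "d > 0" "\<And>r r' x. r \<in> K \<Longrightarrow> r' \<in> K \<Longrightarrow> x \<in> unit_cube \<Longrightarrow> dist r r' < d \<Longrightarrow> dist (F r x) (F r' x) < e / 2"
    using d0(1) d0(2)[of "(r', x)" "(r, x)" for r r' x] by (simp_all add: dist_Pair_Pair)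
  have le: "(SUP x. F r x) \<le> (SUP x. F r' x) + e / 2" if r: "r \<in> K" "r' \<in> K" "dist r r' < d" for r r'
    unfolding range_periodic[OF per[OF r(1)]]
  proof (rule cSUP_least)
    show "unit_cube \<noteq> {}" using unit_cube_representative by blast
    fix x assume x: "x \<in> unit_cube"
    have "F r x \<le> F r' x + e / 2" using d(2)[OF r(1,2) x r(3)] unfolding dist_real_def by linarith
    also have "F r' x \<le> (SUP x. F r' x)"
      by (rule cSUP_upper[OF _ bounded_range_periodic(1)[OF per[OF r(2)] cF[OF r(2)]]]) simp
    finally show "F r x \<le> (SUP x. F r' x) + e / 2" by simp
  qed
  have "dist (SUP x. F r x) (SUP x. F s x) < e" if "r \<in> K" "dist r s < d" for r
    using le[OF that(1) s that(2)] le[OF s that(1)] that(2) e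
    by (simp add: dist_real_def abs_less_iff dist_commute)
  then show "\<exists>d>0. \<forall>r\<in>K. dist r s < d \<longrightarrow> dist (SUP x. F r x) (SUP x. F s x) < e"
    using d(1) by blast
qed

lemma continuous_on_INF_torus:
  fixes F :: "real \<Rightarrow> scalar_field"
  assumes K: "compact K" and F: "continuous_on (K \<times> UNIV) (\<lambda>(s, x). F s x)" and per: "\<And>s. s \<in> K \<Longrightarrow> periodic (F s)"
  shows "continuous_on K (\<lambda>s. INF x. F s x)"
proof -
  have "continuous_on K (\<lambda>s. SUP x. - F s x)"
    using per continuous_on_minus[OF F]
    by (intro continuous_on_SUP_torus[OF K]) (auto simp: periodic_def split_beta)
  then have "continuous_on K (\<lambda>s. - (SUP x. - F s x))" by (rule continuous_on_minus)
  then show ?thesis by (simp add: Inf_real_def image_image)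
qed

context
  fixes u :: vector_field
  assumes u: "\<And>j. C1_torus (\<lambda>x. u x $ j)" and div: "\<And>x. divergence u x = 0"
begin

lemma periodic_deformation: "periodic (deformation u)"
  using C1_torusD(5)[OF u] unfolding periodic_def deformation_def by simp

lemma lam_torus: "periodic (lam i u)" "continuous_on UNIV (lam i u)"
proof -
  show "periodic (lam i u)" using periodic_deformation unfolding periodic_def lam_def by simp
  show "continuous_on UNIV (lam i u)"
    unfolding lam_def[abs_def]
    by (intro continuous_intros continuous_on_compose2[OF continuous_on_eigenvalues continuous_on_deformation[OF u div]])
       (auto simp: transpose_deformation)
qed

lemma lam_sq_le: "(lam i u x)\<^sup>2 \<le> (norm (deformation u x))\<^sup>2"
  unfolding lam_def norm_eigenvalues[OF transpose_deformation, symmetric]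
  using component_le_norm_cart by (metis abs_le_square_iff abs_norm_cancel)

lemma grad_energy_pos:
  assumes c: "0 < c" "\<And>x. c \<le> \<bar>lam i u x\<bar>"
  shows "0 < grad_energy u"
proof -
  have "c\<^sup>2 = integral unit_cube (\<lambda>x. c\<^sup>2)" using content_unit_cube by (simp add: unit_cube_def)
  also have "\<dots> \<le> integral unit_cube (\<lambda>x. (norm (deformation u x))\<^sup>2)"
  proof (rule integral_le)
    show "c\<^sup>2 \<le> (norm (deformation u x))\<^sup>2" for x
      using lam_sq_le[of i x] power_mono[OF c(2)[of x], of 2] c(1)
      unfolding power2_abs by (meson less_imp_le order_trans)
  qed (intro integrable_unit_cube continuous_intros continuous_on_deformation[OF u div])+
  finally show ?thesis using integral_norm_deformation[OF u div] c(1) zero_less_power[of c 2] by linarith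
qed

text \<open>
  Used with \<open>g = \<plusminus> det (deformation u)\<close>, according to the sign of the middle eigenvalue.
\<close>

lemma integral_bounds_by_middle_eigenvalue:
  assumes g: "continuous_on UNIV g"
    and pt: "\<And>x. \<bar>lam 2 u x\<bar> * (norm (deformation u x))\<^sup>2 \<le> 4 * g x" "\<And>x. 2 * g x \<le> \<bar>lam 2 u x\<bar> * (norm (deformation u x))\<^sup>2"
  shows "(INF x. \<bar>lam 2 u x\<bar>) * grad_energy u \<le> 8 * integral unit_cube g"
    "8 * integral unit_cube g \<le> 2 * (SUP x. \<bar>lam 2 u x\<bar>) * grad_energy u"
proof -
  let ?n = "\<lambda>x. (norm (deformation u x))\<^sup>2"
  have per: "periodic (\<lambda>x. \<bar>lam 2 u x\<bar>)" and cont: "continuous_on UNIV (\<lambda>x. \<bar>lam 2 u x\<bar>)"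
    using lam_torus by (auto simp: periodic_def intro!: continuous_intros)
  note b = bounded_range_periodic[OF per cont]
  have i: "(\<lambda>x. c * ?n x) integrable_on unit_cube" "(\<lambda>x. c * g x) integrable_on unit_cube" for c
    by (intro integrable_unit_cube continuous_intros continuous_on_deformation[OF u div] g)+
  have e: "integral unit_cube (\<lambda>x. c * ?n x) = c * (grad_energy u / 2)" for c
    using integral_norm_deformation[OF u div] by simp
  have "integral unit_cube (\<lambda>x. (INF x. \<bar>lam 2 u x\<bar>) * ?n x) \<le> integral unit_cube (\<lambda>x. 4 * g x)"
    by (intro integral_le i order_trans[OF mult_right_mono[OF cINF_lower[OF b(2)]] pt(1)]) auto
  then show "(INF x. \<bar>lam 2 u x\<bar>) * grad_energy u \<le> 8 * integral unit_cube g"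
    unfolding e by simp
  have "integral unit_cube (\<lambda>x. 2 * g x) \<le> integral unit_cube (\<lambda>x. (SUP x. \<bar>lam 2 u x\<bar>) * ?n x)"
    by (intro integral_le i order_trans[OF pt(2) mult_right_mono[OF cSUP_upper[OF _ b(1)]]]) auto
  then show "8 * integral unit_cube g \<le> 2 * (SUP x. \<bar>lam 2 u x\<bar>) * grad_energy u"
    unfolding e by (simp add: mult.commute)
qed

lemma middle_eigenvalue_nonneg_bounds:
  assumes nn: "\<And>x. 0 \<le> lam 2 u x"
  shows "(INF x. \<bar>lam 2 u x\<bar>) * grad_energy u \<le> - 8 * integral unit_cube (\<lambda>x. det (deformation u x))"
    "- 8 * integral unit_cube (\<lambda>x. det (deformation u x)) \<le> 2 * (SUP x. \<bar>lam 2 u x\<bar>) * grad_energy u"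
proof -
  have c: "continuous_on UNIV (\<lambda>x. - det (deformation u x))"
    by (intro continuous_on_minus continuous_on_det_deformation u div)
  have tr: "deformation u x $ 1 $ 1 + deformation u x $ 2 $ 2 + deformation u x $ 3 $ 3 = 0" for x
    unfolding trace_deformation div ..
  have h: "lam 2 u x * (norm (deformation u x))\<^sup>2 \<le> - 4 * det (deformation u x) \<and>
      - 2 * det (deformation u x) \<le> lam 2 u x * (norm (deformation u x))\<^sup>2" for x
    using middle_eigenvalue_bounds(1)[OF transpose_deformation tr] nn unfolding lam_def by blast
  have pt: "\<bar>lam 2 u x\<bar> * (norm (deformation u x))\<^sup>2 \<le> 4 * - det (deformation u x)"
    "2 * - det (deformation u x) \<le> \<bar>lam 2 u x\<bar> * (norm (deformation u x))\<^sup>2" for x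
    using h[of x] unfolding abs_of_nonneg[OF nn] by linarith+
  have "- 8 * integral unit_cube (\<lambda>x. det (deformation u x)) = 8 * integral unit_cube (\<lambda>x. - det (deformation u x))"
    by simp
  then show "(INF x. \<bar>lam 2 u x\<bar>) * grad_energy u \<le> - 8 * integral unit_cube (\<lambda>x. det (deformation u x))"
    "- 8 * integral unit_cube (\<lambda>x. det (deformation u x)) \<le> 2 * (SUP x. \<bar>lam 2 u x\<bar>) * grad_energy u"
    using integral_bounds_by_middle_eigenvalue[OF c pt] by (simp_all only:)
qed

lemma middle_eigenvalue_nonpos_bounds:
  assumes np: "\<And>x. lam 2 u x \<le> 0"
  shows "(INF x. \<bar>lam 2 u x\<bar>) * grad_energy u \<le> 8 * integral unit_cube (\<lambda>x. det (deformation u x))"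
    "8 * integral unit_cube (\<lambda>x. det (deformation u x)) \<le> 2 * (SUP x. \<bar>lam 2 u x\<bar>) * grad_energy u"
proof -
  have c: "continuous_on UNIV (\<lambda>x. det (deformation u x))"
    by (intro continuous_on_det_deformation u div)
  have tr: "deformation u x $ 1 $ 1 + deformation u x $ 2 $ 2 + deformation u x $ 3 $ 3 = 0" for x
    unfolding trace_deformation div ..
  have h: "- (lam 2 u x) * (norm (deformation u x))\<^sup>2 \<le> 4 * det (deformation u x) \<and>
      2 * det (deformation u x) \<le> - (lam 2 u x) * (norm (deformation u x))\<^sup>2" for x
    using middle_eigenvalue_bounds(2)[OF transpose_deformation tr] np unfolding lam_def by blast
  have pt: "\<bar>lam 2 u x\<bar> * (norm (deformation u x))\<^sup>2 \<le> 4 * det (deformation u x)"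
    "2 * det (deformation u x) \<le> \<bar>lam 2 u x\<bar> * (norm (deformation u x))\<^sup>2" for x
    using h[of x] unfolding abs_of_nonpos[OF np] by linarith+
  from integral_bounds_by_middle_eigenvalue[OF c pt]
  show "(INF x. \<bar>lam 2 u x\<bar>) * grad_energy u \<le> 8 * integral unit_cube (\<lambda>x. det (deformation u x))"
    "8 * integral unit_cube (\<lambda>x. det (deformation u x)) \<le> 2 * (SUP x. \<bar>lam 2 u x\<bar>) * grad_energy u" .
qed

end

lemma solution_continuous_deformation:
  assumes sol: "euler_solution m T v\<^sub>0 v" and m: "3 \<le> m"
  shows "continuous_on ({0..<T} \<times> UNIV) (\<lambda>(s, x). deformation (v s) x)"
  unfolding deformation_def split_beta
  by (intro continuous_on_vec_lambda continuous_on_divide continuous_on_add continuous_on_const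
        solution_regularity(2)[OF sol m, unfolded split_beta]) simp

lemma solution_continuous_lam:
  assumes sol: "euler_solution m T v\<^sub>0 v" and m: "3 \<le> m"
  shows "continuous_on ({0..<T} \<times> UNIV) (\<lambda>(s, x). lam i (v s) x)"
proof -
  have "continuous_on ({0..<T} \<times> UNIV) (\<lambda>q. eigenvalues (deformation (v (fst q)) (snd q)))"
    by (rule continuous_on_compose2[OF continuous_on_eigenvalues])
      (use solution_continuous_deformation[OF assms] in \<open>auto simp: split_beta transpose_deformation\<close>)
  then show ?thesis unfolding lam_def split_beta by (intro continuous_intros)
qed

lemma solution_enstrophy_derivative:
  assumes sol: "euler_solution m T v\<^sub>0 v" and m: "3 \<le> m" and t: "t < T" and s: "s \<in> {0..t}"
  shows "((\<lambda>s. grad_energy (v s)) has_real_derivative - 8 * integral unit_cube (\<lambda>x. det (deformation (v s) x))) (at s within {0..t})"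
proof -
  define d where "d s = integral unit_cube (\<lambda>x. det (deformation (v s) x))" for s
  have v: "v s \<in> sobolev_sigma m" if "s \<in> {0..<T}" for s
    using sol that by (simp add: euler_solution_def)
  note C1 = sobolev_sigma_C1(1)[OF m v] and div = sobolev_sigma_C1(2)[OF m v]
  obtain p where p: "\<And>s. s \<in> {0..<T} \<Longrightarrow> periodic (p s)" "\<And>s x. s \<in> {0..<T} \<Longrightarrow> p s differentiable (at x)"
      "continuous_on ({0..<T} \<times> UNIV) (\<lambda>(s, x). grad (p s) x)"
      "\<And>s x. s \<in> {0..<T} \<Longrightarrow> ((\<lambda>r. v r x) has_vector_derivative (- advect (v s) (v s) x - grad (p s) x)) (at s within {0..<T})"
    using sol unfolding euler_solution_def by blast
  have cp: "continuous_on ({0..<T} \<times> UNIV) (\<lambda>(s, x). partial j (p s) x)" for j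
  proof -
    have "continuous_on ({0..<T} \<times> UNIV) (\<lambda>q. (\<lambda>(s, x). grad (p s) x) q $ j)"
      by (intro continuous_on_component p(3))
    then show ?thesis by (simp add: grad_def split_beta)
  qed
  have p1: "C1_torus (p s)" if "s \<in> {0..<T}" for s
  proof -
    have "continuous_on UNIV (\<lambda>x. (\<lambda>(s, x). partial j (p s) x) (s, x))" for j
      by (rule continuous_on_compose2[OF cp[of j]]) (use that in \<open>auto intro!: continuous_intros\<close>)
    then show ?thesis using p(1,2)[OF that] by (simp add: C1_torus_def)
  qed
  have bal: "grad_energy (v \<tau>) = grad_energy (v 0) - 8 * integral {0..\<tau>} d" if \<tau>: "\<tau> \<in> {0..t}" for \<tau>
  proof -
    have sub: "{0..\<tau>} \<subseteq> {0..<T}" "{0..\<tau>} \<times> UNIV \<subseteq> {0..<T} \<times> UNIV" using \<tau> t by auto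
    have "grad_energy (v \<tau>) - grad_energy (v 0) = - 2 * integral {0..\<tau>} (\<lambda>s. integral unit_cube (stretching (v s)))"
    proof (rule grad_energy_balance)
      show "continuous_on ({0..\<tau>} \<times> UNIV) (\<lambda>(s, x). v s x $ j)" for j
        by (rule continuous_on_subset[OF solution_regularity(1)[OF sol m] sub(2)])
      show "continuous_on ({0..\<tau>} \<times> UNIV) (\<lambda>(s, x). partial i (\<lambda>y. v s y $ j) x)" for i j
        by (rule continuous_on_subset[OF solution_regularity(2)[OF sol m] sub(2)])
      show "continuous_on ({0..\<tau>} \<times> UNIV) (\<lambda>(s, x). partial j (p s) x)" for j
        by (rule continuous_on_subset[OF cp sub(2)])
      show "((\<lambda>r. v r x) has_vector_derivative (- advect (v s) (v s) x - grad (p s) x)) (at s within {0..\<tau>})"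
        if "s \<in> {0..\<tau>}" for s x
        by (rule has_vector_derivative_within_subset[OF p(4)]) (use that sub in auto)
    qed (use \<tau> sub C1 div p1 in auto)
    also have "integral {0..\<tau>} (\<lambda>s. integral unit_cube (stretching (v s))) = integral {0..\<tau>} (\<lambda>s. 4 * d s)"
    proof (rule integral_cong)
      fix s assume "s \<in> {0..\<tau>}"
      then have s: "s \<in> {0..<T}" using sub by blast
      show "integral unit_cube (stretching (v s)) = 4 * d s"
        unfolding d_def by (rule integral_stretching[OF C1[OF s] div[OF s]])
    qed
    finally show ?thesis by simp
  qed
  have "continuous_on {0..t} d"
    unfolding d_def unit_cube_def
  proof (rule integral_continuous_on_param)
    have "continuous_on ({0..t} \<times> cbox 0 1) (\<lambda>q. deformation (v (fst q)) (snd q))"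
    proof -
      have "{0..t} \<times> cbox 0 1 \<subseteq> {0..<T} \<times> (UNIV :: R3 set)" using t by auto
      from continuous_on_subset[OF solution_continuous_deformation[OF sol m] this]
      show ?thesis by (simp add: split_beta)
    qed
    then show "continuous_on ({0..t} \<times> cbox 0 1) (\<lambda>(s, x). det (deformation (v s) x))"
      unfolding det_3 split_beta by (intro continuous_intros)
  qed
  from integral_has_real_derivative[OF this s]
  have "((\<lambda>\<tau>. grad_energy (v 0) - 8 * integral {0..\<tau>} d) has_real_derivative - 8 * d s) (at s within {0..t})"
    by (auto intro!: derivative_eq_intros)
  then show ?thesis
    unfolding d_def[symmetric]
    by (rule has_field_derivative_transform_within[OF _ zero_less_one s]) (rule bal[symmetric])
qed

lemma L2_curl_ratio_sq:
  assumes "\<And>j. C1_torus (\<lambda>x. u x $ j)" "\<And>x. divergence u x = 0" "\<And>j. C1_torus (\<lambda>x. w x $ j)" "\<And>x. divergence w x = 0"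
  shows "(L2_norm_torus (curl u) / L2_norm_torus (curl w))\<^sup>2 = grad_energy u / grad_energy w"
    "0 \<le> L2_norm_torus (curl u) / L2_norm_torus (curl w)"
proof -
  show "(L2_norm_torus (curl u) / L2_norm_torus (curl w))\<^sup>2 = grad_energy u / grad_energy w"
    using L2_norm_curl(1)[OF assms(1,2)] L2_norm_curl(1)[OF assms(3,4)] by (simp add: power_divide)
  have "0 \<le> L2_norm_torus f" for f :: vector_field
    unfolding L2_norm_torus_def set_lebesgue_integral_def by (intro real_sqrt_ge_zero integral_nonneg_AE AE_I2) simp
  then show "0 \<le> L2_norm_torus (curl u) / L2_norm_torus (curl w)" by (intro divide_nonneg_nonneg)
qed

lemma set_lebesgue_integral_interval:
  fixes f g :: "real \<Rightarrow> real"
  assumes "continuous_on {a..b} f" "\<And>s. s \<in> {a..b} \<Longrightarrow> g s = f s"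
  shows "(LINT s:{a..b}|lebesgue. g s) = integral {a..b} f"
proof -
  have "(LINT s:{a..b}|lebesgue. g s) = (LINT s:{a..b}|lebesgue. f s)"
    by (rule set_lebesgue_integral_cong) (use assms(2) in auto)
  also have "\<dots> = integral {a..b} f"
    by (intro set_lebesgue_integral_eq_integral absolutely_integrable_continuous_real assms)
  finally show ?thesis .
qed

theorem theorem3p1:
  fixes m :: nat and v\<^sub>0 :: "real ^ 3 \<Rightarrow> real ^ 3" and t :: real
  assumes "real m > 5 / 2"
    and "v\<^sub>0 \<in> A_plus m \<union> A_minus m"
    and "0 < t" and "ereal t < T_sign m v\<^sub>0"
  shows
    "(v\<^sub>0 \<in> A_plus m \<longrightarrow>
        exp (1 / 2 * (LINT s:{0..t}|lebesgue. INF x. \<bar>lam 2 (S m s v\<^sub>0) x\<bar>))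
          \<le> L2_norm_torus (curl (S m t v\<^sub>0)) / L2_norm_torus (curl v\<^sub>0) \<and>
        L2_norm_torus (curl (S m t v\<^sub>0)) / L2_norm_torus (curl v\<^sub>0)
          \<le> exp (LINT s:{0..t}|lebesgue. SUP x. \<bar>lam 2 (S m s v\<^sub>0) x\<bar>)) \<and>
     (v\<^sub>0 \<in> A_minus m \<longrightarrow>
        exp (- (LINT s:{0..t}|lebesgue. SUP x. \<bar>lam 2 (S m s v\<^sub>0) x\<bar>))
          \<le> L2_norm_torus (curl (S m t v\<^sub>0)) / L2_norm_torus (curl v\<^sub>0) \<and>
        L2_norm_torus (curl (S m t v\<^sub>0)) / L2_norm_torus (curl v\<^sub>0)
          \<le> exp (- (1 / 2) * (LINT s:{0..t}|lebesgue. INF x. \<bar>lam 2 (S m s v\<^sub>0) x\<bar>)))"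
proof -
  have m: "3 \<le> m" using assms(1) by linarith
  obtain T v where T: "t < T" and ue: "unique_existence m T v\<^sub>0" and sol: "euler_solution m T v\<^sub>0 v"
    using solution_before_T_sign[OF assms(4)] .
  have v0: "v 0 = v\<^sub>0" and v: "\<And>s. s \<in> {0..t} \<Longrightarrow> v s \<in> sobolev_sigma m"
    using sol T by (auto simp: euler_solution_def)
  note C1 = sobolev_sigma_C1(1)[OF m v] and div = sobolev_sigma_C1(2)[OF m v]
  have t0: "t \<in> {0..t}" "0 \<in> {0..t}" using assms(3) by auto
  have S: "S m s v\<^sub>0 = v s" if "s \<in> {0..t}" for s
    using S_eq_solution[OF ue sol] that T by auto
  define E where "E s = grad_energy (v s)" for s
  define d where "d s = - 8 * integral unit_cube (\<lambda>x. det (deformation (v s) x))" for s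
  define lo where "lo s = (INF x. \<bar>lam 2 (v s) x\<bar>)" for s
  define up where "up s = (SUP x. \<bar>lam 2 (v s) x\<bar>)" for s
  have dE: "(E has_real_derivative d s) (at s within {0..t})" if "s \<in> {0..t}" for s
    unfolding E_def d_def by (rule solution_enstrophy_derivative[OF sol m T that])
  have clam: "continuous_on ({0..t} \<times> UNIV) (\<lambda>(s, x). \<bar>lam 2 (v s) x\<bar>)"
  proof -
    have "{0..t} \<times> UNIV \<subseteq> {0..<T} \<times> (UNIV :: R3 set)" using T by auto
    from continuous_on_rabs[OF continuous_on_subset[OF solution_continuous_lam[OF sol m] this]]
    show ?thesis by (simp add: split_beta)
  qed
  have plam: "periodic (\<lambda>x. \<bar>lam 2 (v s) x\<bar>)" if "s \<in> {0..t}" for s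
    using lam_torus(1)[OF C1[OF that] div[OF that]] by (simp add: periodic_def)
  have clo: "continuous_on {0..t} lo" and cup: "continuous_on {0..t} up"
    unfolding lo_def up_def
    by (intro continuous_on_INF_torus continuous_on_SUP_torus clam plam; simp)+
  have Ilo: "(LINT s:{0..t}|lebesgue. INF x. \<bar>lam 2 (S m s v\<^sub>0) x\<bar>) = integral {0..t} lo"
    by (rule set_lebesgue_integral_interval[OF clo]) (simp add: S lo_def)
  have Iup: "(LINT s:{0..t}|lebesgue. SUP x. \<bar>lam 2 (S m s v\<^sub>0) x\<bar>) = integral {0..t} up"
    by (rule set_lebesgue_integral_interval[OF cup]) (simp add: S up_def)
  define q where "q = L2_norm_torus (curl (S m t v\<^sub>0)) / L2_norm_torus (curl v\<^sub>0)"
  have q: "q\<^sup>2 = E t / E 0" "0 \<le> q"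
    using L2_curl_ratio_sq[OF C1[OF t0(1)] div[OF t0(1)] C1[OF t0(2)] div[OF t0(2)]]
    unfolding q_def S[OF t0(1)] E_def v0 by auto
  have l0: "periodic (lam 2 v\<^sub>0)" "continuous_on UNIV (lam 2 v\<^sub>0)"
    using lam_torus[OF C1[OF t0(2)] div[OF t0(2)]] by (simp_all add: v0)
  note b0 = bounded_range_periodic[OF l0]
  have plus0: "(INF x. lam 2 v\<^sub>0 x) \<le> lam 2 v\<^sub>0 x" and minus0: "lam 2 v\<^sub>0 x \<le> (SUP x. lam 2 v\<^sub>0 x)" for x
    using b0 by (auto intro: cINF_lower cSUP_upper)
  have sign: "ereal s < T_max m v\<^sub>0" "s \<notin> sign_change_times m v\<^sub>0" if "s \<in> {0<..<t}" for s
  proof -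
    have s: "ereal s < T_sign m v\<^sub>0" using that assms(4) by (meson ereal_less_eq(3) greaterThanLessThan_iff less_imp_le order_le_less_trans)
    then show "s \<notin> sign_change_times m v\<^sub>0" by (rule before_T_sign)
    show "ereal s < T_max m v\<^sub>0" using s T_sign_le_T_max by (rule less_le_trans)
  qed
  \<comment> \<open>the strict sign of the middle eigenvalue at time \<open>0\<close> makes the denominator nonzero\<close>
  have E0: "0 < E 0"
  proof -
    obtain c where c: "0 < c" "\<And>x. c \<le> \<bar>lam 2 v\<^sub>0 x\<bar>"
    proof (cases "v\<^sub>0 \<in> A_plus m")
      case True
      then have pos: "0 < (INF x. lam 2 v\<^sub>0 x)" by (simp add: A_plus_def)
      show ?thesis
      proof (rule that[OF pos])
        show "(INF x. lam 2 v\<^sub>0 x) \<le> \<bar>lam 2 v\<^sub>0 x\<bar>" for x using plus0[of x] by linarith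
      qed
    next
      case False
      then have neg: "(SUP x. lam 2 v\<^sub>0 x) < 0" using assms(2) by (simp add: A_minus_def)
      show ?thesis
      proof (rule that[of "- (SUP x. lam 2 v\<^sub>0 x)"])
        show "- (SUP x. lam 2 v\<^sub>0 x) \<le> \<bar>lam 2 v\<^sub>0 x\<bar>" for x using minus0[of x] by linarith
      qed (use neg in simp)
    qed
    then show ?thesis
      using grad_energy_pos[OF C1[OF t0(2)] div[OF t0(2)], of c 2] by (simp add: E_def v0)
  qed
  have ratio_le: "q \<le> exp X" if "E t \<le> E 0 * exp (2 * X)" for X
  proof (rule power2_le_imp_le)
    have "E t / E 0 \<le> exp (2 * X)" using that E0 by (simp add: divide_le_eq mult.commute)
    then show "q\<^sup>2 \<le> (exp X)\<^sup>2" by (simp add: q exp_double)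
  qed simp
  have ratio_ge: "exp X \<le> q" if "E 0 * exp (2 * X) \<le> E t" for X
  proof (rule power2_le_imp_le[OF _ q(2)])
    have "exp (2 * X) \<le> E t / E 0" using that E0 by (simp add: le_divide_eq mult.commute)
    then show "(exp X)\<^sup>2 \<le> q\<^sup>2" by (simp add: q exp_double)
  qed
  have upper: "E t \<le> E 0 * exp (integral {0..t} a)"
    if "continuous_on {0..t} a" "\<And>s. s \<in> {0<..<t} \<Longrightarrow> d s \<le> a s * E s" for a
    using gronwall[of t E d a] dE that assms(3) by auto
  have lower: "E 0 * exp (integral {0..t} a) \<le> E t"
    if "continuous_on {0..t} a" "\<And>s. s \<in> {0<..<t} \<Longrightarrow> a s * E s \<le> d s" for a
    using gronwall[of t "\<lambda>s. - E s" "\<lambda>s. - d s" a] DERIV_minus[OF dE] that assms(3) by auto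
  have plus: "exp (1 / 2 * integral {0..t} lo) \<le> q \<and> q \<le> exp (integral {0..t} up)" if A: "v\<^sub>0 \<in> A_plus m"
  proof -
    have nn: "0 \<le> lam 2 (v s) x" if s: "s \<in> {0<..<t}" for s x
      using sign[OF s] A s S[of s] by (force simp: sign_change_times_def not_less)
    have "lo s * E s \<le> d s \<and> d s \<le> 2 * up s * E s" if s: "s \<in> {0<..<t}" for s
    proof -
      have s': "s \<in> {0..t}" using s by auto
      show ?thesis
        unfolding lo_def up_def E_def d_def
        using middle_eigenvalue_nonneg_bounds[OF C1[OF s'] div[OF s'] nn[OF s]] by blast
    qed
    then show ?thesis
      using lower[OF clo] upper[OF continuous_on_mult_left[OF cup]] by (intro conjI ratio_le ratio_ge) simp_all
  qed
  have minus: "exp (- integral {0..t} up) \<le> q \<and> q \<le> exp (- (1 / 2) * integral {0..t} lo)" if A: "v\<^sub>0 \<in> A_minus m"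
  proof -
    \<comment> \<open>\<open>sign_change_times\<close> tests membership in \<open>A_plus\<close> first\<close>
    have "v\<^sub>0 \<notin> A_plus m" using A plus0[of 0] minus0[of 0] by (auto simp: A_plus_def A_minus_def)
    then have np: "lam 2 (v s) x \<le> 0" if s: "s \<in> {0<..<t}" for s x
      using sign[OF s] s S[of s] by (force simp: sign_change_times_def not_less)
    have "- 2 * up s * E s \<le> d s \<and> d s \<le> - lo s * E s" if s: "s \<in> {0<..<t}" for s
    proof -
      have s': "s \<in> {0..t}" using s by auto
      show ?thesis
        unfolding lo_def up_def E_def d_def
        using middle_eigenvalue_nonpos_bounds[OF C1[OF s'] div[OF s'] np[OF s]] by simp
    qed
    then show ?thesis
      using upper[OF continuous_on_minus[OF clo]] lower[OF continuous_on_mult_left[OF cup, of "- 2"]]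
      by (intro conjI ratio_le ratio_ge) simp_all
  qed
  from plus minus show ?thesis unfolding Ilo Iup q_def by blast
qed

end
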